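(* Consider the problem $\min\{f(x): x\in\Omega\}$ and the stochastic interior-point method with extrapolated Polyak momentum (SIPM-EM) described in the context, with input $s_\eta\in(0,1)$. Assume: (a) $\Omega^\circ\neq\emptyset$, and there is a finite $\phi_{\mathrm{low}}$ with $\inf_{x\in\Omega^\circ,\,\mu\in(0,1]}\{f(x)+\mu B(x)\}\ge\phi_{\mathrm{low}}$; (b) for every $s\in(0,1)$ there is a constant $L_1(s)>0$ such that $\|\nabla f(y)-\nabla f(x)\|_x^*\le L_1(s)\|y-x\|_x$ for all $x,y\in\Omega^\circ$ with $\|y-x\|_x\le s$; write $L_1=L_1(s_\eta)$; (c) the estimator $G:\Omega^\circ\times\Xi\to\mathbb{R}^n$ satisfies, for some $\sigma>0$, $\mathbb{E}_\xi[G(x;\xi)]=\nabla f(x)$ and $\mathbb{E}_\xi[(\|G(x;\xi)-\nabla f(x)\|_x^* )^2]\le\sigma^2$ for all $x\in\Omega^\circ$; (d) $f$ is twice continuously differentiable on $\Omega^\circ$, and for every $s\in(0,1)$ there is a constant $L_2(s)>0$ such that $\|\nabla^2f(y)-\nabla^2f(x)\|_x^*\le L_2(s)\|y-x\|_x$ for all $x,y\in\Omega^\circ$ with $\|y-x\|_x\le s$; write $L_2=L_2(s_\eta)$. Let $\epsilon\in(0,1)$ and let the input parameters be, for all $k\ge0$, $$\eta_k=\frac{5s_\eta}{7(k+1)^{5/7}},\qquad \gamma_k=\frac{1}{(k+1)^{4/7}},\qquad \mu_k=\max\Big\{\frac{1}{(k+1)^{2/7}},\frac{\epsilon}{1+\sqrt{\vartheta}}\Big\}.$$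 Let $\kappa(K)$ be uniformly drawn from $\{\lfloor K/2\rfloor,\ldots,K-1\}$, and define $$M_{\mathrm{em}}=\frac{14}{5}\bigg(\frac{\Delta(x^0)+\sigma^2}{s_\eta}+\frac{40s_\eta L_\phi}{49}+2\Big(\frac{200s_\eta}{7(7-5s_\eta)}+\frac{1250L_2^2s_\eta^3}{7(7-5s_\eta)^3}+\frac{2\sigma^2}{s_\eta(1-5s_\eta/7)^4}\Big)\bigg).$$ Then $$\mathbb{E}\big[\|\nabla\phi_{\mu_{\kappa(K)}}(x^{\kappa(K)})+A^T\lambda^{\kappa(K)}\|^*_{x^{\kappa(K)}}\big]\le\mu_{\kappa(K)}\quad\text{with}\quad \mu_{\kappa(K)}\le\frac{\epsilon}{1+\sqrt{\vartheta}}$$ for all integers $$K\ge\max\Big\{2\Big(\frac{1+\sqrt{\vartheta}}{\epsilon}\Big)^{7/2},\ \Big(\frac{7M_{\mathrm{em}}(1+\sqrt{\vartheta})}{\epsilon}\ln\Big(\frac{7M_{\mathrm{em}}(1+\sqrt{\vartheta})}{\epsilon}\Big)\Big)^{7/2},\ 3\Big\}.$$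
   Context: Setting. $\mathcal{K}\subseteq\mathbb{R}^n$ is a closed pointed convex cone with nonempty interior, $A\in\mathbb{R}^{m\times n}$ has full row rank, $b\in\mathbb{R}^m$, $\Omega=\{x: Ax=b,\ x\in\mathcal{K}\}$, $\Omega^\circ=\{x\in\mathrm{int}\,\mathcal{K}: Ax=b\}$; $f$ is continuously differentiable (possibly nonconvex) on $\Omega$, and $\min_{x\in\Omega}f(x)$ has at least one optimal solution. Barrier. $\mathcal{K}$ is equipped with a $\vartheta$-logarithmically homogeneous self-concordant barrier $B:\mathrm{int}\,\mathcal{K}\to\mathbb{R}$, $\vartheta\ge1$: $B$ is convex and three times continuously differentiable; for $\varphi(t)=B(x+tu)$ one has $|\varphi'''(0)|\le2(\varphi''(0))^{3/2}$ for all $x\in\mathrm{int}\,\mathcal{K}$, $u\in\mathbb{R}^n$; $B(x)\to\infty$ as $x$ approaches the boundary of $\mathcal{K}$; and $B(tx)=B(x)-\vartheta\ln t$ for all $x\in\mathrm{int}\,\mathcal{K}$, $t>0$. For $x\in\mathrm{int}\,\mathcal{K}$, $v\in\mathbb{R}^n$, $M\in\mathbb{R}^{n\times n}$: $\|v\|_x=(v^T\nabla^2B(x)v)^{1/2}$, $\|v\|_x^*=(v^T\nabla^2B(x)^{-1}v)^{1/2}$, and $\|M\|_x^*=\max_{\|v\|_x\le1}\|Mv\|_x^*$. Notation. $\phi_\mu(x)=f(x)+\mu(f(x)+B(x))$ for $x\in\Omega^\circ$, $\mu\in(0,1]$. With $[t]_+=\max\{t,0\}$ and $[t]_-=\min\{t,0\}$,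 $\Delta(x)=f(x)+[f(x)+B(x)]_+-2[\phi_{\mathrm{low}}]_-$, and $L_\phi=2L_1+1/(1-s_\eta)$. Algorithm (SIPM framework). Input: $s_\eta\in(0,1)$, $x^0\in\Omega^\circ$ (deterministic), nonincreasing step sizes $\{\eta_k\}_{k\ge0}\subset(0,s_\eta]$, nonincreasing barrier parameters $\{\mu_k\}_{k\ge0}\subset(0,1]$. For $k=0,1,2,\ldots$: construct an estimator $\overline m^k$ of $\nabla f(x^k)$, set $m^k=\overline m^k+\mu_k(\overline m^k+\nabla B(x^k))$, $H_k=\nabla^2B(x^k)^{-1}$, $$\lambda^k=-(AH_kA^T)^{-1}AH_km^k,\qquad x^{k+1}=x^k-\eta_k\frac{H_k(m^k+A^T\lambda^k)}{\|m^k+A^T\lambda^k\|^*_{x^k}}.$$ The update is understood to be well defined, i.e. $m^k+A^T\lambda^k\ne0$ for all $k$. SIPM-EM is this framework with momentum parameters $\{\gamma_k\}_{k\ge0}\subset(0,1]$ and $\gamma_{-1}=1$, $x^{-1}=x^0$, $\overline m^{-1}=0$, and for $k\ge0$: $z^k=x^k+\frac{1-\gamma_{k-1}}{\gamma_{k-1}}(x^k-x^{k-1})$, $\overline m^k=(1-\gamma_{k-1})\overline m^{k-1}+\gamma_{k-1}G(z^k;\xi^k)$, where $\xi^0,\xi^1,\ldots$ are independent copies of the random variable $\xi$ (with sample space $\Xi$). The draw of $\kappa(K)$ is independent of the samples; $\mathbb{E}$ is expectation over all randomness. *)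

theory Defs
  imports "HOL-Probability.Probability"
begin

subsection \<open>Derivatives\<close>

definition gradient :: "('a::real_inner \<Rightarrow> real) \<Rightarrow> 'a \<Rightarrow> 'a" where
  "gradient f x = (THE D. GDERIV f x :> D)"

definition hessian :: "(real^'n \<Rightarrow> real) \<Rightarrow> real^'n \<Rightarrow> real^'n^'n" where
  "hessian f x = jacobian (gradient f) (at x)"

lemma gradient_works:
  fixes f :: "real^'n \<Rightarrow> real"
  assumes "f differentiable at x"
  shows "GDERIV f x :> gradient f x"
proof -
  let ?F = "frechet_derivative f (at x)"
  obtain D where D: "GDERIV f x :> D"
  proof
    have lin: "linear ?F"
      using assms by (rule linear_frechet_derivative)
    have "?F h = h \<bullet> adjoint ?F 1" for h
      using adjoint_works[OF lin, of h 1] by simp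
    then have "?F = (\<lambda>h. h \<bullet> adjoint ?F 1)"
      by (rule ext)
    with assms[unfolded frechet_derivative_works] show "GDERIV f x :> adjoint ?F 1"
      unfolding gderiv_def by (rule has_derivative_eq_rhs)
  qed
  moreover have "D' = D" if "GDERIV f x :> D'" for D'
  proof -
    have "(\<lambda>h. h \<bullet> D') = (\<lambda>h. h \<bullet> D)"
      using that D unfolding gderiv_def by (rule has_derivative_unique)
    then have "h \<bullet> D' = h \<bullet> D" for h
      by (rule fun_cong)
    then show ?thesis
      using vector_eq_ldot[of D' D] by simp
  qed
  ultimately show ?thesis
    unfolding gradient_def by (rule theI)
qed

text \<open>
  On an open set \<open>U\<close>, being \<open>k\<close> times continuously differentiable is expressed recursively through
  the directional derivatives in all fixed directions, as the space is finite-dimensional.  On an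
  arbitrary set it means being so on some open neighbourhood of the set; for an open set the two
  notions agree.  The neighbourhood matters for sets such as \<open>{x \<in> K. A *v x = b}\<close>, which have empty
  interior, so that the full gradient would otherwise not be determined.
\<close>

primrec Ck_open :: "nat \<Rightarrow> ('a::euclidean_space \<Rightarrow> real) \<Rightarrow> 'a set \<Rightarrow> bool" where
  "Ck_open 0 f U \<longleftrightarrow> continuous_on U f"
| "Ck_open (Suc k) f U \<longleftrightarrow>
     (\<forall>x\<in>U. f differentiable at x) \<and> (\<forall>v. Ck_open k (\<lambda>x. frechet_derivative f (at x) v) U)"

definition Ck_on :: "nat \<Rightarrow> ('a::euclidean_space \<Rightarrow> real) \<Rightarrow> 'a set \<Rightarrow> bool" where
  "Ck_on k f S \<longleftrightarrow> (\<exists>U. open U \<and> S \<subseteq> U \<and> Ck_open k f U)"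

subsection \<open>The conic problem and the barrier\<close>

definition feasible :: "(real^'n) set \<Rightarrow> real^'n^'m \<Rightarrow> real^'m \<Rightarrow> (real^'n) set" where
  "feasible K A b = {x \<in> K. A *v x = b}"

definition strictly_feasible :: "(real^'n) set \<Rightarrow> real^'n^'m \<Rightarrow> real^'m \<Rightarrow> (real^'n) set" where
  "strictly_feasible K A b = {x \<in> interior K. A *v x = b}"

definition proper_cone :: "'a::euclidean_space set \<Rightarrow> bool" where
  "proper_cone K \<longleftrightarrow> cone K \<and> convex K \<and> closed K \<and> interior K \<noteq> {} \<and>
     (\<forall>x. x \<in> K \<and> - x \<in> K \<longrightarrow> x = 0)"

definition lh_self_concordant_barrier ::
    "(real^'n) set \<Rightarrow> real \<Rightarrow> (real^'n \<Rightarrow> real) \<Rightarrow> bool" where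
  "lh_self_concordant_barrier K \<theta> B \<longleftrightarrow>
     convex_on (interior K) B \<and>
     Ck_on 3 B (interior K) \<and>
     (\<forall>x\<in>interior K. \<forall>u. let \<phi> = (\<lambda>t. B (x + t *\<^sub>R u)) in
        \<bar>(deriv ^^ 3) \<phi> 0\<bar> \<le> 2 * ((deriv ^^ 2) \<phi> 0) powr (3/2)) \<and>
     (\<forall>y\<in>frontier K. filterlim B at_top (at y within interior K)) \<and>
     (\<forall>x\<in>interior K. \<forall>t>0. B (t *\<^sub>R x) = B x - \<theta> * ln t)"

definition local_norm :: "(real^'n \<Rightarrow> real) \<Rightarrow> real^'n \<Rightarrow> real^'n \<Rightarrow> real" where
  "local_norm B x v = sqrt (v \<bullet> (hessian B x *v v))"

definition inv_hessian :: "(real^'n \<Rightarrow> real) \<Rightarrow> real^'n \<Rightarrow> real^'n^'n" where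
  "inv_hessian B x = matrix_inv (hessian B x)"

definition dual_norm :: "(real^'n \<Rightarrow> real) \<Rightarrow> real^'n \<Rightarrow> real^'n \<Rightarrow> real" where
  "dual_norm B x v = sqrt (v \<bullet> (inv_hessian B x *v v))"

text \<open>
  The supremum is a maximum for interior \<open>x\<close>, the Hessian of the barrier of a pointed cone being
  positive definite.
\<close>

definition dual_mat_norm :: "(real^'n \<Rightarrow> real) \<Rightarrow> real^'n \<Rightarrow> real^'n^'n \<Rightarrow> real" where
  "dual_mat_norm B x M = (SUP v\<in>{v. local_norm B x v \<le> 1}. dual_norm B x (M *v v))"

definition barrier_obj ::
    "('a \<Rightarrow> real) \<Rightarrow> ('a \<Rightarrow> real) \<Rightarrow> real \<Rightarrow> 'a \<Rightarrow> real" where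
  "barrier_obj f B \<mu> x = f x + \<mu> * (f x + B x)"

subsection \<open>The algorithm\<close>

definition multiplier ::
    "real^'n^'m \<Rightarrow> (real^'n \<Rightarrow> real) \<Rightarrow> real^'n \<Rightarrow> real^'n \<Rightarrow> real^'m" where
  "multiplier A B x m =
     - (matrix_inv (A ** inv_hessian B x ** transpose A) *v ((A ** inv_hessian B x) *v m))"

definition step_dir ::
    "real^'n^'m \<Rightarrow> (real^'n \<Rightarrow> real) \<Rightarrow> real^'n \<Rightarrow> real^'n \<Rightarrow> real^'n" where
  "step_dir A B x m = m + transpose A *v multiplier A B x m"

definition sipm_step ::
    "real^'n^'m \<Rightarrow> (real^'n \<Rightarrow> real) \<Rightarrow> real \<Rightarrow> real^'n \<Rightarrow> real^'n \<Rightarrow> real^'n" where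
  "sipm_step A B \<eta> x m =
     x - (\<eta> / dual_norm B x (step_dir A B x m)) *\<^sub>R (inv_hessian B x *v step_dir A B x m)"

definition barrier_estimate ::
    "(real^'n \<Rightarrow> real) \<Rightarrow> real \<Rightarrow> real^'n \<Rightarrow> real^'n \<Rightarrow> real^'n" where
  "barrier_estimate B \<mu> x mbar = mbar + \<mu> *\<^sub>R (mbar + gradient B x)"

text \<open>\<open>shift_param \<gamma> k\<close> is the parameter with index \<open>k - 1\<close>, where the one with index \<open>-1\<close> is 1.\<close>

definition shift_param :: "(nat \<Rightarrow> real) \<Rightarrow> nat \<Rightarrow> real" where
  "shift_param \<gamma> k = (case k of 0 \<Rightarrow> 1 | Suc j \<Rightarrow> \<gamma> j)"

definition extrapolate :: "real \<Rightarrow> 'a::real_vector \<Rightarrow> 'a \<Rightarrow> 'a" where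
  "extrapolate g x xprev = x + ((1 - g) / g) *\<^sub>R (x - xprev)"

definition momentum :: "real \<Rightarrow> 'a::real_vector \<Rightarrow> 'a \<Rightarrow> 'a" where
  "momentum g mprev s = (1 - g) *\<^sub>R mprev + g *\<^sub>R s"

text \<open>
  The algorithm along one sample path \<open>w\<close>.  The state before iteration \<open>k\<close> consists of the iterates
  with index \<open>k\<close> and \<open>k - 1\<close> and of the momentum estimate with index \<open>k - 1\<close>.
\<close>

context
  fixes A :: "real^'n^'m" and B :: "real^'n \<Rightarrow> real" and G :: "real^'n \<Rightarrow> 's \<Rightarrow> real^'n"
    and \<eta> \<gamma> \<mu> :: "nat \<Rightarrow> real" and x0 :: "real^'n" and w :: "nat \<Rightarrow> 's"
begin

primrec em_state :: "nat \<Rightarrow> (real^'n) \<times> (real^'n) \<times> (real^'n)" where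
  "em_state 0 = (x0, x0, 0)"
| "em_state (Suc k) =
     (let (x, xprev, mprev) = em_state k;
          g = shift_param \<gamma> k;
          mbar = momentum g mprev (G (extrapolate g x xprev) (w k))
      in (sipm_step A B (\<eta> k) x (barrier_estimate B (\<mu> k) x mbar), x, mbar))"

definition em_x :: "nat \<Rightarrow> real^'n" where
  "em_x k = fst (em_state k)"

definition em_mbar :: "nat \<Rightarrow> real^'n" where
  "em_mbar k = snd (snd (em_state (Suc k)))"

definition em_m :: "nat \<Rightarrow> real^'n" where
  "em_m k = barrier_estimate B (\<mu> k) (em_x k) (em_mbar k)"

definition em_lambda :: "nat \<Rightarrow> real^'m" where
  "em_lambda k = multiplier A B (em_x k) (em_m k)"

lemma em_x_0: "em_x 0 = x0"
  by (simp add: em_x_def)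

lemma em_mbar_0: "em_mbar 0 = G x0 (w 0)"
  by (simp add: em_mbar_def momentum_def extrapolate_def shift_param_def Let_def)

lemma em_x_Suc:
  "em_x (Suc k) = em_x k - (\<eta> k / dual_norm B (em_x k) (em_m k + transpose A *v em_lambda k)) *\<^sub>R
     (inv_hessian B (em_x k) *v (em_m k + transpose A *v em_lambda k))"
  by (simp add: em_x_def em_mbar_def em_m_def em_lambda_def sipm_step_def step_dir_def Let_def
      split: prod.splits)

lemma em_mbar_Suc:
  "em_mbar (Suc k) = (1 - \<gamma> k) *\<^sub>R em_mbar k +
     \<gamma> k *\<^sub>R G (em_x (Suc k) + ((1 - \<gamma> k) / \<gamma> k) *\<^sub>R (em_x (Suc k) - em_x k)) (w (Suc k))"
  by (simp add: em_x_def em_mbar_def momentum_def extrapolate_def shift_param_def Let_def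
      split: prod.splits)

end

subsection \<open>Constants and input parameters\<close>

definition Delta ::
    "('a \<Rightarrow> real) \<Rightarrow> ('a \<Rightarrow> real) \<Rightarrow> real \<Rightarrow> 'a \<Rightarrow> real" where
  "Delta f B \<phi>low x = f x + max (f x + B x) 0 - 2 * min \<phi>low 0"

definition L_phi :: "real \<Rightarrow> real \<Rightarrow> real" where
  "L_phi L1 s = 2 * L1 + 1 / (1 - s)"

definition M_em :: "real \<Rightarrow> real \<Rightarrow> real \<Rightarrow> real \<Rightarrow> real \<Rightarrow> real" where
  "M_em \<Delta>0 L1 L2 \<sigma> s =
     14/5 * ((\<Delta>0 + \<sigma>\<^sup>2) / s + 40 * s * L_phi L1 s / 49
       + 2 * (200 * s / (7 * (7 - 5 * s)) + 1250 * L2\<^sup>2 * s ^ 3 / (7 * (7 - 5 * s) ^ 3)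
              + 2 * \<sigma>\<^sup>2 / (s * (1 - 5 * s / 7) ^ 4)))"

definition em_eta :: "real \<Rightarrow> nat \<Rightarrow> real" where
  "em_eta s k = 5 * s / (7 * real (k + 1) powr (5/7))"

definition em_gamma :: "nat \<Rightarrow> real" where
  "em_gamma k = 1 / real (k + 1) powr (4/7)"

definition em_mu :: "real \<Rightarrow> real \<Rightarrow> nat \<Rightarrow> real" where
  "em_mu \<epsilon> \<theta> k = max (1 / real (k + 1) powr (2/7)) (\<epsilon> / (1 + sqrt \<theta>))"

end

(* The iteration is a descent method for f + mu (f + B) in the local norms of the barrier.  Self-concordance
   along lines controls the Hessian of B inside the Dikin ellipsoid: the third derivative is a symmetric
   trilinear form whose bound on the diagonal extends to |T u v v| <= 2 |u| |v|^2, so that local norms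
   at two points of distance r < 1 differ by a factor of at most 1 / (1 - r).  A step of local length eta then
   decreases the barrier objective by eta times the stationarity measure, up to 4 eta |e| + O(eta^2), where e
   is the error of the momentum estimate.  Since x(k+1) is a convex combination of x(k) and the extrapolated
   point z(k+1), the bias that the momentum acquires in one step is of second order, and E |e|^2 contracts
   by the factor 1 - delta up to O(eta^4 / gamma^3 + gamma^2).  Adding E |e|^2 with weight (k+1)^(1/7) to
   the objective makes the contraction absorb 4 eta |e| by the AM-GM inequality; what remains is a multiple of
   1/(k+1) in each step, hence of ln K in total, and it is averaged over the second half of the iterations. *)
theory Submission
  imports Defs
begin

subsection \<open>Directional derivatives\<close>

text \<open>Each iteration measures vectors in several norms: the noise is controlled at the
  extrapolated point, the bias at x(k), and the new error is needed at x(k+1). Since \<eta> k \<le>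
  a \<gamma> k with a = 5 s / 7, these points lie in the Dikin ellipsoid of radius a around x(k),
  and every change of norm costs at most a factor 1 / (1 - a). This is the origin of the powers of 7
  - 5 s in \<open>M_em\<close>, and it turns the contraction rate \<gamma> into \<delta> = \<gamma>
  (1 - a). The weight has exponent 1/7 because this balances its two effects: \<eta>^2 / \<gamma> is
  of order (k+1)^(-6/7) and gets divided by it, \<eta>^4 / \<gamma>^3 + \<gamma>^2 is of order
  (k+1)^(-8/7) and gets multiplied by it, so both become multiples of 1 / (k+1). Dividing ln K by K
  \<eta>(K) leaves ln K / K^(2/7), which is compared with the floor of \<mu>. The geometric
  estimates hold on every sample path; probability enters through the independence of the fresh
  sample from the past and of \<kappa> from the samples.\<close>

definition dir_deriv :: "'a::euclidean_space \<Rightarrow> ('a \<Rightarrow> real) \<Rightarrow> 'a \<Rightarrow> real" where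
  "dir_deriv v f x = frechet_derivative f (at x) v"

lemma Ck_open_Suc_iff:
  "Ck_open (Suc k) f U \<longleftrightarrow> (\<forall>x\<in>U. f differentiable at x) \<and> (\<forall>v. Ck_open k (dir_deriv v f) U)"
  by (simp add: dir_deriv_def[abs_def])

lemma Ck_open_differentiable: "Ck_open (Suc k) f U \<Longrightarrow> x \<in> U \<Longrightarrow> f differentiable at x"
  by simp

lemma Ck_open_dir_deriv: "Ck_open (Suc k) f U \<Longrightarrow> Ck_open k (dir_deriv v f) U"
  by (simp add: Ck_open_Suc_iff del: Ck_open.simps)

lemma Ck_open_subset: "Ck_open k f U \<Longrightarrow> V \<subseteq> U \<Longrightarrow> Ck_open k f V"
  by (induction k arbitrary: f) (auto intro: continuous_on_subset)

lemma Ck_open_Suc_imp: "Ck_open (Suc k) f U \<Longrightarrow> Ck_open k f U"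
proof (induction k arbitrary: f)
  case 0
  then show ?case
    by (auto intro!: continuous_at_imp_continuous_on differentiable_imp_continuous_within)
next
  case (Suc k)
  then show ?case
    unfolding Ck_open_Suc_iff[of "Suc k"] Ck_open_Suc_iff[of k f] by blast
qed

lemma Ck_open_mono: "Ck_open k f U \<Longrightarrow> j \<le> k \<Longrightarrow> Ck_open j f U"
  by (induction k) (auto simp: le_Suc_eq dest: Ck_open_Suc_imp simp del: Ck_open.simps)

lemma Ck_open_continuous: "Ck_open k f U \<Longrightarrow> continuous_on U f"
  using Ck_open_mono[of k f U 0] by simp

lemma Ck_on_open: "open S \<Longrightarrow> Ck_on k f S \<Longrightarrow> Ck_open k f S"
  unfolding Ck_on_def by (blast intro: Ck_open_subset)

lemma has_derivative_dir_deriv: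
  "f differentiable at x \<Longrightarrow> (f has_derivative (\<lambda>h. dir_deriv h f x)) (at x)"
  unfolding dir_deriv_def by (simp flip: frechet_derivative_works)

lemma dir_deriv_eqI: "(f has_derivative F) (at x) \<Longrightarrow> dir_deriv v f x = F v"
  unfolding dir_deriv_def using frechet_derivative_at by metis

lemma linear_dir_deriv: "f differentiable at x \<Longrightarrow> linear (\<lambda>h. dir_deriv h f x)"
  unfolding dir_deriv_def by (rule linear_frechet_derivative)

lemma dir_deriv_cong:
  assumes "open U" "x \<in> U" "\<And>y. y \<in> U \<Longrightarrow> f y = g y" "f differentiable at x"
  shows "dir_deriv v f x = dir_deriv v g x"
  using has_derivative_transform_within_open[OF has_derivative_dir_deriv[OF assms(4)] assms(1-3)]
  by (simp add: dir_deriv_eqI)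

lemma has_real_derivative_along_line:
  assumes "f differentiable at (x + t *\<^sub>R u)"
  shows "((\<lambda>s. f (x + s *\<^sub>R u)) has_real_derivative dir_deriv u f (x + t *\<^sub>R u)) (at t)"
proof -
  have "((\<lambda>s. f (x + s *\<^sub>R u)) has_derivative (\<lambda>s. dir_deriv (s *\<^sub>R u) f (x + t *\<^sub>R u))) (at t)"
    by (rule has_derivative_compose[where f = "\<lambda>s. x + s *\<^sub>R u" and f' = "\<lambda>s. s *\<^sub>R u",
          OF _ has_derivative_dir_deriv[OF assms]]) (auto intro!: derivative_eq_intros)
  moreover have "dir_deriv (s *\<^sub>R u) f (x + t *\<^sub>R u) = dir_deriv u f (x + t *\<^sub>R u) * s" for s
    using linear_scale[OF linear_dir_deriv[OF assms]] by simp
  ultimately show ?thesis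
    by (simp add: has_field_derivative_def)
qed

text \<open>Two applications of the mean value theorem to the second difference; as the difference
  quotient is symmetric in the two directions, so is its limit.\<close>

lemma second_difference_tendsto:
  assumes C2: "Ck_open 2 f U" and U: "open U" "x \<in> U"
  shows "((\<lambda>h. (f (x + h *\<^sub>R u + h *\<^sub>R v) - f (x + h *\<^sub>R u) - f (x + h *\<^sub>R v) + f x) / h\<^sup>2)
    \<longlongrightarrow> dir_deriv v (dir_deriv u f) x) (at_right 0)"
proof (rule tendstoI)
  fix e :: real assume e: "e > 0"
  let ?g = "dir_deriv u f" and ?h = "dir_deriv v (dir_deriv u f)"
  have C1: "Ck_open (Suc 0) ?g U" and f1: "Ck_open (Suc 1) f U"
    using C2 by (simp_all add: numeral_2_eq_2 Ck_open_dir_deriv del: Ck_open.simps)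
  then have "continuous_on U ?h"
    using Ck_open_continuous Ck_open_dir_deriv by blast
  then have "isCont ?h x"
    using U by (simp add: continuous_on_eq_continuous_at)
  then obtain d1 where d1: "d1 > 0" "\<And>y. dist y x < d1 \<Longrightarrow> dist (?h y) (?h x) < e"
    using e unfolding continuous_at_eps_delta by blast
  obtain d2 where d2: "d2 > 0" "ball x d2 \<subseteq> U"
    using U open_contains_ball by blast
  define d where "d = min d1 d2"
  have d: "d > 0" and near: "\<And>y. dist y x < d \<Longrightarrow> y \<in> U \<and> dist (?h y) (?h x) < e"
    using d1 d2 by (auto simp: d_def mem_ball dist_commute subset_eq)
  \<comment> \<open>The summand 1 keeps \<open>c\<close> positive when both directions
    vanish.\<close>
  define c where "c = norm u + norm v + 1"
  have c: "c > 0" unfolding c_def by (smt (verit) norm_ge_zero)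
  have "\<forall>\<^sub>F h in at_right 0. h < d / c"
    using eventually_at_right_real[of 0 "d / c"] d c by (auto elim: eventually_mono)
  moreover have "\<forall>\<^sub>F h::real in at_right 0. 0 < h"
    by (rule eventually_at_right_less)
  ultimately show "\<forall>\<^sub>F h in at_right 0. dist ((f (x + h *\<^sub>R u + h *\<^sub>R v) - f (x + h *\<^sub>R u)
      - f (x + h *\<^sub>R v) + f x) / h\<^sup>2) (?h x) < e"
  proof eventually_elim
    case (elim h)
    have near': "x + s *\<^sub>R u + t *\<^sub>R v \<in> U \<and> dist (?h (x + s *\<^sub>R u + t *\<^sub>R v)) (?h x) < e"
      if "0 \<le> s" "s \<le> h" "0 \<le> t" "t \<le> h" for s t
    proof (rule near)
      have "dist (x + s *\<^sub>R u + t *\<^sub>R v) x = norm (s *\<^sub>R u + t *\<^sub>R v)"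
        by (simp add: dist_norm algebra_simps)
      also have "\<dots> \<le> s * norm u + t * norm v"
        using that by (intro order_trans[OF norm_triangle_ineq]) simp
      also have "\<dots> \<le> h * norm u + h * norm v"
        using that by (intro add_mono mult_right_mono) auto
      also have "\<dots> < h * c"
        using elim by (simp add: c_def algebra_simps)
      also have "\<dots> < d"
        using elim c by (simp add: field_simps)
      finally show "dist (x + s *\<^sub>R u + t *\<^sub>R v) x < d" .
    qed
    let ?F = "\<lambda>s. f (x + h *\<^sub>R v + s *\<^sub>R u) - f (x + s *\<^sub>R u)"
    have "\<exists>z. 0 < z \<and> z < h \<and> ?F h - ?F 0 = (h - 0) * (?g (x + h *\<^sub>R v + z *\<^sub>R u) - ?g (x + z *\<^sub>R u))"
    proof (rule MVT2)
      fix s assume s: "0 \<le> s" "s \<le> h"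
      have "x + h *\<^sub>R v + s *\<^sub>R u \<in> U" "x + s *\<^sub>R u \<in> U"
        using near'[of s h] near'[of s 0] s elim by (auto simp: algebra_simps)
      then show "(?F has_real_derivative (?g (x + h *\<^sub>R v + s *\<^sub>R u) - ?g (x + s *\<^sub>R u))) (at s)"
        using f1 by (intro derivative_intros has_real_derivative_along_line) auto
    qed (use elim in auto)
    then obtain z where z: "0 < z" "z < h" "?F h - ?F 0 = h * (?g (x + z *\<^sub>R u + h *\<^sub>R v) - ?g (x + z *\<^sub>R u))"
      by (auto simp: algebra_simps)
    have "\<exists>y. 0 < y \<and> y < h \<and> ?g (x + z *\<^sub>R u + h *\<^sub>R v) - ?g (x + z *\<^sub>R u + 0 *\<^sub>R v) =
        (h - 0) * ?h (x + z *\<^sub>R u + y *\<^sub>R v)"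
    proof (rule MVT2)
      fix s assume "0 \<le> s" "s \<le> h"
      then have "x + z *\<^sub>R u + s *\<^sub>R v \<in> U"
        using near'[of z s] z by auto
      then show "((\<lambda>s. ?g (x + z *\<^sub>R u + s *\<^sub>R v)) has_real_derivative ?h (x + z *\<^sub>R u + s *\<^sub>R v)) (at s)"
        using C1 by (intro has_real_derivative_along_line) auto
    qed (use elim in auto)
    then obtain y where y: "0 < y" "y < h"
      "?g (x + z *\<^sub>R u + h *\<^sub>R v) - ?g (x + z *\<^sub>R u) = h * ?h (x + z *\<^sub>R u + y *\<^sub>R v)"
      by auto
    have "f (x + h *\<^sub>R u + h *\<^sub>R v) - f (x + h *\<^sub>R u) - f (x + h *\<^sub>R v) + f x =
        h\<^sup>2 * ?h (x + z *\<^sub>R u + y *\<^sub>R v)"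
      using z(3) y(3) by (simp add: algebra_simps power2_eq_square)
    then show ?case
      using near'[of z y] z y elim by simp
  qed
qed

lemma dir_deriv_commute:
  assumes "Ck_open 2 f U" "open U" "x \<in> U"
  shows "dir_deriv u (dir_deriv v f) x = dir_deriv v (dir_deriv u f) x"
proof (rule tendsto_unique[OF _ second_difference_tendsto[OF assms, of v u]])
  show "((\<lambda>h. (f (x + h *\<^sub>R v + h *\<^sub>R u) - f (x + h *\<^sub>R v) - f (x + h *\<^sub>R u) + f x) / h\<^sup>2)
      \<longlongrightarrow> dir_deriv v (dir_deriv u f) x) (at_right 0)"
    using second_difference_tendsto[OF assms, of u v] by (simp add: algebra_simps)
qed simp

subsection \<open>Gradient and Hessian\<close>

lemma gradient_inner:
  fixes f :: "real^'n \<Rightarrow> real"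
  assumes "f differentiable at x"
  shows "gradient f x \<bullet> v = dir_deriv v f x"
  using gradient_works[OF assms] dir_deriv_eqI[of f _ x v]
  by (simp add: gderiv_def inner_commute)

lemma gradient_eqI:
  fixes f :: "real^'n \<Rightarrow> real"
  assumes "(f has_derivative (\<lambda>h. h \<bullet> D)) (at x)"
  shows "gradient f x = D"
  using assms gradient_inner[of f x] dir_deriv_eqI[OF assms]
  by (metis differentiableI inner_commute vector_eq_rdot)

lemma gradient_vec:
  fixes f :: "real^'n \<Rightarrow> real"
  assumes "f differentiable at x"
  shows "gradient f x = (\<chi> i. dir_deriv (axis i 1) f x)"
  using gradient_inner[OF assms, of "axis _ 1"] by (simp add: vec_eq_iff inner_axis)

context
  fixes f :: "real^'n \<Rightarrow> real" and U :: "(real^'n) set"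
  assumes C2: "Ck_open 2 f U" and U: "open U"
begin

lemma C2_differentiable: "x \<in> U \<Longrightarrow> f differentiable at x"
  and C2_dir_deriv: "Ck_open (Suc 0) (dir_deriv v f) U"
  and C2_dir_deriv_differentiable: "x \<in> U \<Longrightarrow> dir_deriv v f differentiable at x"
proof -
  have *: "Ck_open (Suc (Suc 0)) f U"
    using C2 by (simp only: numeral_2_eq_2)
  then show "x \<in> U \<Longrightarrow> f differentiable at x"
    by (rule Ck_open_differentiable)
  from * show "Ck_open (Suc 0) (dir_deriv v f) U"
    by (rule Ck_open_dir_deriv)
  then show "x \<in> U \<Longrightarrow> dir_deriv v f differentiable at x"
    using Ck_open_differentiable by blast
qed

lemma gradient_has_derivative:
  assumes x: "x \<in> U"
  shows "(gradient f has_derivative (\<lambda>h. \<chi> i. dir_deriv h (dir_deriv (axis i 1) f) x)) (at x)"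
proof (rule has_derivative_transform_within_open[OF _ U x])
  show "((\<lambda>y. \<chi> i. dir_deriv (axis i 1) f y) has_derivative
      (\<lambda>h. \<chi> i. dir_deriv h (dir_deriv (axis i 1) f) x)) (at x)"
    unfolding has_derivative_componentwise_within[where f = "\<lambda>y. \<chi> i. dir_deriv (axis i 1) f y"]
    using has_derivative_dir_deriv[OF C2_dir_deriv_differentiable[OF x]]
    by (auto simp: Basis_vec_def inner_axis)
qed (simp add: gradient_vec C2_differentiable)

lemma inner_hessian:
  assumes x: "x \<in> U"
  shows "u \<bullet> (hessian f x *v v) = dir_deriv v (dir_deriv u f) x"
proof -
  have "(gradient f has_derivative (\<lambda>h. hessian f x *v h)) (at x)"
    unfolding hessian_def using gradient_has_derivative[OF x] jacobian_works[of "gradient f" "at x"]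
    by (auto simp: differentiableI)
  then have H: "hessian f x *v h = (\<chi> i. dir_deriv h (dir_deriv (axis i 1) f) x)" for h
    using has_derivative_unique[OF _ gradient_has_derivative[OF x]] by metis
  note lin = linear_dir_deriv[OF C2_dir_deriv_differentiable[OF x, of v]]
  \<comment> \<open>Linearity is available in the direction of the outer derivative, so the mixed
    derivatives are interchanged, \<open>u\<close> is expanded there, and the interchange is undone
    at the end.\<close>
  have "u \<bullet> (hessian f x *v v) = (\<Sum>i\<in>UNIV. u $ i * dir_deriv (axis i 1) (dir_deriv v f) x)"
    using dir_deriv_commute[OF C2 U x] by (simp add: H inner_vec_def)
  also have "\<dots> = dir_deriv (\<Sum>i\<in>UNIV. u $ i *\<^sub>R axis i 1) (dir_deriv v f) x"
    unfolding linear_sum[OF lin] linear_scale[OF lin] real_scaleR_def ..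
  also have "(\<Sum>i\<in>UNIV. u $ i *\<^sub>R axis i 1) = u"
    by (simp add: vec_eq_iff axis_def if_distrib cong: if_cong)
  finally show ?thesis
    using dir_deriv_commute[OF C2 U x] by simp
qed

lemma hessian_symmetric: "x \<in> U \<Longrightarrow> u \<bullet> (hessian f x *v v) = v \<bullet> (hessian f x *v u)"
  using inner_hessian dir_deriv_commute[OF C2 U] by simp

lemma gradient_continuous: "continuous_on U (gradient f)"
  using gradient_has_derivative U
  by (auto intro!: continuous_at_imp_continuous_on has_derivative_continuous)

lemma hessian_entry:
  assumes "x \<in> U"
  shows "hessian f x $ i $ j = dir_deriv (axis j 1) (dir_deriv (axis i 1) f) x"
  using inner_hessian[OF assms, of "axis i 1" "axis j 1"]
  by (simp add: inner_axis' matrix_vector_mult_basis column_def)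

lemma hessian_continuous: "continuous_on U (hessian f)"
proof -
  have "continuous_on U (\<lambda>x. \<chi> i j. dir_deriv (axis j 1) (dir_deriv (axis i 1) f) x)"
    by (intro continuous_on_vec_lambda Ck_open_continuous[OF Ck_open_dir_deriv[OF C2_dir_deriv]])
  then show ?thesis
    by (rule continuous_on_eq) (simp add: vec_eq_iff hessian_entry)
qed

end

subsection \<open>Symmetric trilinear forms bounded on the diagonal\<close>

text \<open>On a plane spanned by orthonormal \<open>v\<close> and \<open>w\<close>, the value \<open>T u v v\<close> at \<open>u = cos \<theta> v + sin \<theta> w\<close> is a
  convex combination of the diagonal values of \<open>T\<close> at the three unit vectors whose angles trisect \<open>\<theta>\<close>.\<close>

lemma trisection_weight_nonneg:
  fixes x y :: real
  assumes "x\<^sup>2 + y\<^sup>2 = 1"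
  shows "0 \<le> 1 + 2 * (x * (4 * x ^ 3 - 3 * x) + y * (3 * y - 4 * y ^ 3) / 3)"
proof -
  have y: "y * y = 1 - x * x"
    using assms by (simp add: power2_eq_square)
  have "y * (3 * y - 4 * y ^ 3) = 3 * (y * y) - 4 * (y * y) * (y * y)"
    by algebra
  also have "\<dots> = 3 * (1 - x * x) - 4 * (1 - x * x) * (1 - x * x)"
    unfolding y ..
  finally have *: "y * (3 * y - 4 * y ^ 3) = 3 * (1 - x * x) - 4 * (1 - x * x) * (1 - x * x)" .
  \<comment> \<open>For x = cos \<alpha> and y = sin \<alpha> the two cubic polynomials are cos (3
    \<alpha>) and sin (3 \<alpha>), so this is three times a weight of the trisection below.\<close>
  have "1 + 2 * (x * (4 * x ^ 3 - 3 * x) + y * (3 * y - 4 * y ^ 3) / 3) = (4 * x\<^sup>2 - 1)\<^sup>2 / 3"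
    unfolding * by (simp add: power2_eq_square power3_eq_cube field_simps)
  then show ?thesis by (metis divide_nonneg_pos zero_le_power2 zero_less_numeral)
qed

text \<open>The three angles (\<theta> + 2 \<pi> j) / 3 have the same cosine and sine of the triple
  angle, so x^3 and y^3 are affine in x and in y, and x^2 y and x y^2 reduce to these. All cubic
  moments thus follow from the weighted moments of order at most one. The value sin \<theta> / 3
  anticipates the binomial factor 3 in the expansion of a cubic form.\<close>

lemma trisection:
  fixes \<theta> :: real
  obtains x y w :: "nat \<Rightarrow> real" where
    "\<And>j. (x j)\<^sup>2 + (y j)\<^sup>2 = 1" "\<And>j. 0 \<le> w j" "(\<Sum>j<3. w j) = 1"
    "(\<Sum>j<3. w j * x j ^ 3) = cos \<theta>" "(\<Sum>j<3. w j * ((x j)\<^sup>2 * y j)) = sin \<theta> / 3"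
    "(\<Sum>j<3. w j * (x j * (y j)\<^sup>2)) = 0" "(\<Sum>j<3. w j * y j ^ 3) = 0"
proof -
  define \<beta> where "\<beta> = \<theta> / 3"
  define a where "a j = \<beta> + real j * (2 * pi / 3)" for j :: nat
  define x where "x j = cos (a j)" for j
  define y where "y j = sin (a j)" for j
  define C S where "C = cos \<theta>" and "S = sin \<theta>"
  \<comment> \<open>Three equally spaced points of the circle have mean 0 and second moments 1/2, 0,
    1/2; a weight affine in x and y can therefore be given any total mass and any first moments,
    here 1 and (C, S / 3).\<close>
  define w where "w j = (1 + 2 * (x j * C + y j * S / 3)) / 3" for j
  have xy: "(x j)\<^sup>2 + (y j)\<^sup>2 = 1" for j
    by (simp add: x_def y_def)
  have a3: "3 * a j = \<theta> + 2 * real j * pi" for j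
    by (simp add: a_def \<beta>_def)
  have cs: "cos (3 * a j) = C" "sin (3 * a j) = S" for j
    unfolding a3 C_def S_def by (simp_all add: cos_add sin_add)
  have x3: "4 * x j ^ 3 - 3 * x j = C" for j
    using cs(1)[of j] unfolding cos_treble_cos x_def by simp
  have y3: "3 * y j - 4 * y j ^ 3 = S" for j
  proof -
    have "sin (3 * a j) = sin (a j) * (4 * (cos (a j))\<^sup>2 - 1)"
    proof -
      have "3 * a j = 2 * a j + a j" by simp
      then show ?thesis
        unfolding power2_eq_square
        by (simp only: sin_add sin_double cos_double_cos power2_eq_square) (simp add: algebra_simps)
    qed
    also have "\<dots> = 3 * sin (a j) - 4 * sin (a j) ^ 3"
      unfolding cos_squared_eq by (simp add: algebra_simps power2_eq_square power3_eq_cube)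
    finally show ?thesis
      using cs(2)[of j] by (simp add: y_def)
  qed
  have w0: "0 \<le> w j" for j
    using trisection_weight_nonneg[OF xy[of j]] unfolding x3 y3 by (simp add: w_def)
  define r where "r = sqrt 3"
  have r: "r * r = 3" by (simp add: r_def)
  have a0: "x 0 = cos \<beta>" "y 0 = sin \<beta>"
    by (simp_all add: x_def y_def a_def)
  have c1: "cos (2 * pi / 3) = - 1 / 2" "sin (2 * pi / 3) = r / 2"
    using cos_120 sin_120' by (simp_all add: r_def mult.commute)
  have c2: "cos (4 * pi / 3) = - 1 / 2" "sin (4 * pi / 3) = - (r / 2)"
    using cos_double[of "2 * pi / 3"] sin_double[of "2 * pi / 3"] r
    unfolding c1 by (simp_all add: power2_eq_square)
  have a1: "x 1 = - x 0 / 2 - r / 2 * y 0" "y 1 = - y 0 / 2 + r / 2 * x 0"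
    unfolding a0 by (simp_all add: x_def y_def a_def cos_add sin_add c1)
  have a2: "x 2 = - x 0 / 2 + r / 2 * y 0" "y 2 = - y 0 / 2 - r / 2 * x 0"
    unfolding a0 by (simp_all add: x_def y_def a_def cos_add sin_add c2)
  have xy0: "x 0 * x 0 + y 0 * y 0 = 1"
    using xy[of 0] by (simp add: power2_eq_square)
  have m1: "x 0 + x 1 + x 2 = 0" "y 0 + y 1 + y 2 = 0"
    unfolding a1 a2 by simp_all
  have m2: "x 0 * x 0 + x 1 * x 1 + x 2 * x 2 = 3 / 2" "x 0 * y 0 + x 1 * y 1 + x 2 * y 2 = 0"
      "y 0 * y 0 + y 1 * y 1 + y 2 * y 2 = 3 / 2"
  proof -
    have *: "r * (r * z) = 3 * z" for z
      by (simp only: mult.assoc[symmetric] r)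
    have yy: "y 0 * y 0 = 1 - x 0 * x 0" using xy0 by simp
    show "x 0 * x 0 + x 1 * x 1 + x 2 * x 2 = 3 / 2" "x 0 * y 0 + x 1 * y 1 + x 2 * y 2 = 0"
        "y 0 * y 0 + y 1 * y 1 + y 2 * y 2 = 3 / 2"
      unfolding a1 a2 by (simp_all add: algebra_simps * r yy)
  qed
  have sum3: "(\<Sum>j<3. g j) = g 0 + g 1 + g 2" for g :: "nat \<Rightarrow> real"
    by (simp add: eval_nat_numeral)
  have s0: "(\<Sum>j<3. w j) = 1"
  proof -
    have "(\<Sum>j<3. w j) = 1 + (2 / 3) * (C * (x 0 + x 1 + x 2) + S / 3 * (y 0 + y 1 + y 2))"
      unfolding sum3 w_def by (simp add: field_simps)
    then show ?thesis unfolding m1 by simp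
  qed
  have s1: "(\<Sum>j<3. w j * x j) = C" "(\<Sum>j<3. w j * y j) = S / 3"
  proof -
    have "(\<Sum>j<3. w j * x j) = (1 / 3) * (x 0 + x 1 + x 2) + (2 / 3) * (C * (x 0 * x 0 + x 1 * x 1 + x 2 * x 2)
        + S / 3 * (x 0 * y 0 + x 1 * y 1 + x 2 * y 2))"
      unfolding sum3 w_def by (simp add: field_simps)
    then show "(\<Sum>j<3. w j * x j) = C" unfolding m1 m2 by simp
    have "(\<Sum>j<3. w j * y j) = (1 / 3) * (y 0 + y 1 + y 2) + (2 / 3) * (C * (x 0 * y 0 + x 1 * y 1 + x 2 * y 2)
        + S / 3 * (y 0 * y 0 + y 1 * y 1 + y 2 * y 2))"
      unfolding sum3 w_def by (simp add: field_simps)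
    then show "(\<Sum>j<3. w j * y j) = S / 3" unfolding m1 m2 by simp
  qed
  have sx: "(\<Sum>j<3. w j * x j ^ 3) = C"
  proof -
    have e: "x j ^ 3 = (C + 3 * x j) / 4" for j using x3[of j] by simp
    have "(\<Sum>j<3. w j * x j ^ 3) = (C * (\<Sum>j<3. w j) + 3 * (\<Sum>j<3. w j * x j)) / 4"
      unfolding e sum3 by (simp add: field_simps)
    then show ?thesis unfolding s0 s1 by simp
  qed
  have sy: "(\<Sum>j<3. w j * y j ^ 3) = 0"
  proof -
    have e: "y j ^ 3 = (3 * y j - S) / 4" for j using y3[of j] by simp
    have "(\<Sum>j<3. w j * y j ^ 3) = (3 * (\<Sum>j<3. w j * y j) - S * (\<Sum>j<3. w j)) / 4"
      unfolding e sum3 by (simp add: field_simps)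
    then show ?thesis unfolding s0 s1 by simp
  qed
  have sxy: "(\<Sum>j<3. w j * ((x j)\<^sup>2 * y j)) = S / 3"
  proof -
    have e: "(x j)\<^sup>2 * y j = y j - y j ^ 3" for j using xy[of j] by algebra
    have "(\<Sum>j<3. w j * ((x j)\<^sup>2 * y j)) = (\<Sum>j<3. w j * y j) - (\<Sum>j<3. w j * y j ^ 3)"
      unfolding e sum3 by (simp add: field_simps)
    then show ?thesis unfolding sy s1 by simp
  qed
  have syx: "(\<Sum>j<3. w j * (x j * (y j)\<^sup>2)) = 0"
  proof -
    have e: "x j * (y j)\<^sup>2 = x j - x j ^ 3" for j using xy[of j] by algebra
    have "(\<Sum>j<3. w j * (x j * (y j)\<^sup>2)) = (\<Sum>j<3. w j * x j) - (\<Sum>j<3. w j * x j ^ 3)"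
      unfolding e sum3 by (simp add: field_simps)
    then show ?thesis unfolding sx s1 by simp
  qed
  show ?thesis
    using that[of x y w] xy w0 s0 sx sxy syx sy by (simp add: C_def S_def)
qed

text \<open>Kept abstract because it is instantiated both by the Hessian of the barrier and by its
  inverse.\<close>

locale pos_def_form =
  fixes q :: "'a::real_vector \<Rightarrow> 'a \<Rightarrow> real"
  assumes linear_left: "\<And>v. linear (\<lambda>u. q u v)"
    and symmetric: "\<And>u v. q u v = q v u"
    and pos: "\<And>v. v \<noteq> 0 \<Longrightarrow> 0 < q v v"
begin

lemma form_simps [simp]:
  "q (a + b) c = q a c + q b c" "q c (a + b) = q c a + q c b"
  "q (a - b) c = q a c - q b c" "q c (a - b) = q c a - q c b"
  "q (r *\<^sub>R a) c = r * q a c" "q c (r *\<^sub>R a) = r * q c a"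
  "q 0 c = 0" "q c 0 = 0"
proof -
  show *: "q (a + b) c = q a c + q b c" "q (a - b) c = q a c - q b c" "q (r *\<^sub>R a) c = r * q a c"
      "q 0 c = 0" for a b c r
    using linear_add[OF linear_left] linear_diff[OF linear_left] linear_scale[OF linear_left]
      linear_0[OF linear_left] by simp_all
  show "q c (a + b) = q c a + q c b" "q c (a - b) = q c a - q c b" "q c (r *\<^sub>R a) = r * q c a"
      "q c 0 = 0"
    using *[where c = c] by (simp_all add: symmetric[of c])
qed

lemma nonneg: "0 \<le> q v v"
  by (cases "v = 0") (auto simp: less_imp_le[OF pos])

lemma eq_0_iff: "q v v = 0 \<longleftrightarrow> v = 0"
  using pos[of v] by (cases "v = 0") auto

lemma Cauchy_Schwarz: "\<bar>q u v\<bar> \<le> sqrt (q u u) * sqrt (q v v)"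
proof -
  have "0 \<le> q (q v v *\<^sub>R u - q u v *\<^sub>R v) (q v v *\<^sub>R u - q u v *\<^sub>R v)"
    by (rule nonneg)
  then have *: "0 \<le> q v v * (q v v * q u u - q u v * q u v)"
    by (simp add: algebra_simps symmetric[of v u])
  have "(q u v)\<^sup>2 \<le> q u u * q v v"
  proof (cases "v = 0")
    case False
    with * pos[of v] show ?thesis
      by (simp add: zero_le_mult_iff power2_eq_square mult.commute)
  qed simp
  then have "\<bar>q u v\<bar> \<le> sqrt (q u u * q v v)"
    by (simp add: real_le_rsqrt)
  then show ?thesis by (simp add: real_sqrt_mult)
qed

lemma triangle: "sqrt (q (u + v) (u + v)) \<le> sqrt (q u u) + sqrt (q v v)"
proof (rule real_le_lsqrt)
  have "q (u + v) (u + v) = q u u + 2 * q u v + q v v"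
    by (simp add: symmetric[of v u])
  also have "\<dots> \<le> (sqrt (q u u))\<^sup>2 + 2 * (sqrt (q u u) * sqrt (q v v)) + (sqrt (q v v))\<^sup>2"
    using Cauchy_Schwarz[of u v] nonneg by simp
  finally show "q (u + v) (u + v) \<le> (sqrt (q u u) + sqrt (q v v))\<^sup>2"
    by (simp add: power2_sum mult.assoc)
qed (simp add: nonneg)

text \<open>The weights of the trisection sum to 1, so averaging the diagonal bound keeps the
  constant \<open>C\<close>; plain polarization would lose a factor. Homogeneity reduces the claim
  to unit vectors.\<close>

theorem symmetric_trilinear_bound:
  assumes lin: "\<And>v w. linear (\<lambda>u. T u v w)"
    and sym: "\<And>u v w. T u v w = T v u w" "\<And>u v w. T u v w = T u w v"
    and diag: "\<And>h. \<bar>T h h h\<bar> \<le> C * sqrt (q h h) ^ 3"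
  shows "\<bar>T u v v\<bar> \<le> C * sqrt (q u u) * q v v"
proof -
  have T1: "T (a + b) c d = T a c d + T b c d" "T (r *\<^sub>R a) c d = r * T a c d" "T 0 c d = 0" for a b c d r
    using linear_add[OF lin] linear_scale[OF lin] linear_0[OF lin] by simp_all
  have T2: "T c (a + b) d = T c a d + T c b d" "T c (r *\<^sub>R a) d = r * T c a d" "T c 0 d = 0" for a b c d r
    by (simp_all only: sym(1)[of c] T1)
  have T3: "T c d (a + b) = T c d a + T c d b" "T c d (r *\<^sub>R a) = r * T c d a" "T c d 0 = 0" for a b c d r
    by (simp_all only: sym(2)[of c d] T2)
  note T = T1 T2 T3
  have unit: "\<bar>T u v v\<bar> \<le> C" if u: "q u u = 1" and v: "q v v = 1" for u v
  proof -
    define k where "k = q u v"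
    have "\<bar>k\<bar> \<le> 1"
      using Cauchy_Schwarz[of u v] u v by (simp add: k_def)
    define \<theta> where "\<theta> = arccos k"
    have c: "cos \<theta> = k"
      using \<open>\<bar>k\<bar> \<le> 1\<close> by (simp add: \<theta>_def cos_arccos_abs)
    \<comment> \<open>Gram-Schmidt. If \<open>u\<close> and \<open>v\<close> are parallel, no
      direction is left to normalize and \<open>w\<close> is taken to be 0; this case needs the
      diagonal bound at \<open>v\<close> alone.\<close>
    obtain w where w: "u = cos \<theta> *\<^sub>R v + sin \<theta> *\<^sub>R w"
      "\<And>x y. x\<^sup>2 + y\<^sup>2 = 1 \<Longrightarrow> sin \<theta> \<noteq> 0 \<Longrightarrow> q (x *\<^sub>R v + y *\<^sub>R w) (x *\<^sub>R v + y *\<^sub>R w) = 1"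
    proof (cases "sin \<theta> = 0")
      case True
      then have "k * k = 1"
        using c sin_cos_squared_add[of \<theta>] by (simp add: power2_eq_square)
      have "q (u - k *\<^sub>R v) (u - k *\<^sub>R v) = 1 - k * k"
        using u v by (simp add: k_def[symmetric] symmetric[of v u])
      then have "u = k *\<^sub>R v"
        using \<open>k * k = 1\<close> eq_0_iff[of "u - k *\<^sub>R v"] by simp
      then show ?thesis
        by (intro that[of 0]) (simp_all add: True c)
    next
      case False
      define w where "w = (1 / sin \<theta>) *\<^sub>R (u - k *\<^sub>R v)"
      have "q (u - k *\<^sub>R v) (u - k *\<^sub>R v) = 1 - k * k"
        using u v by (simp add: k_def[symmetric] symmetric[of v u])
      also have "\<dots> = sin \<theta> * sin \<theta>"
        using sin_cos_squared_add[of \<theta>] by (simp add: c[symmetric] power2_eq_square)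
      finally have ww: "q w w = 1"
        using False unfolding w_def form_simps(5,6) by (simp del: form_simps)
      have vw: "q v w = 0" "q w v = 0"
        using v by (simp_all add: w_def k_def symmetric[of v u])
      show ?thesis
      proof
        show "u = cos \<theta> *\<^sub>R v + sin \<theta> *\<^sub>R w"
          using False by (simp add: w_def c)
        show "q (x *\<^sub>R v + y *\<^sub>R w) (x *\<^sub>R v + y *\<^sub>R w) = 1" if "x\<^sup>2 + y\<^sup>2 = 1" for x y
          using that by (simp add: v ww vw power2_eq_square)
      qed
    qed
    show ?thesis
    proof (cases "sin \<theta> = 0")
      case True
      then have "\<bar>k\<bar> = 1"
        using c sin_cos_squared_add[of \<theta>] by (simp add: abs_square_eq_1)
      moreover have "T u v v = k * T v v v"
        using True w(1) c by (simp add: T)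
      ultimately show ?thesis
        using diag[of v] v by (simp add: abs_mult)
    next
      case False
      obtain x y \<omega> :: "nat \<Rightarrow> real" where tri: "\<And>j. (x j)\<^sup>2 + (y j)\<^sup>2 = 1" "\<And>j. 0 \<le> \<omega> j" "(\<Sum>j<3. \<omega> j) = 1"
        "(\<Sum>j<3. \<omega> j * x j ^ 3) = cos \<theta>" "(\<Sum>j<3. \<omega> j * ((x j)\<^sup>2 * y j)) = sin \<theta> / 3"
        "(\<Sum>j<3. \<omega> j * (x j * (y j)\<^sup>2)) = 0" "(\<Sum>j<3. \<omega> j * y j ^ 3) = 0"
        by (rule trisection[of \<theta>]) (rule that)
      define h where "h j = x j *\<^sub>R v + y j *\<^sub>R w" for j :: nat
      have hh: "q (h j) (h j) = 1" for j
        using w(2)[of "x j" "y j"] tri(1)[of j] False by (simp add: h_def)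
      have Th: "T (h j) (h j) (h j) = x j ^ 3 * T v v v + 3 * ((x j)\<^sup>2 * y j) * T w v v
          + 3 * (x j * (y j)\<^sup>2) * T w w v + y j ^ 3 * T w w w" for j
      proof -
        have "T v w v = T w v v" "T v v w = T w v v" "T w v w = T w w v" "T v w w = T w w v"
          using sym by metis+
        then show ?thesis
          by (simp add: h_def T power2_eq_square power3_eq_cube algebra_simps)
      qed
      have "(\<Sum>j<3. \<omega> j * T (h j) (h j) (h j)) = (\<Sum>j<3. \<omega> j * x j ^ 3) * T v v v
          + 3 * (\<Sum>j<3. \<omega> j * ((x j)\<^sup>2 * y j)) * T w v v
          + 3 * (\<Sum>j<3. \<omega> j * (x j * (y j)\<^sup>2)) * T w w v + (\<Sum>j<3. \<omega> j * y j ^ 3) * T w w w"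
        unfolding Th by (simp add: sum.distrib sum_distrib_left sum_distrib_right algebra_simps)
      also have "\<dots> = T u v v"
        unfolding tri(4-7) by (subst w(1)) (simp add: T)
      finally have "\<bar>T u v v\<bar> \<le> (\<Sum>j<3. \<bar>\<omega> j * T (h j) (h j) (h j)\<bar>)"
        by (metis sum_abs)
      also have "\<dots> \<le> (\<Sum>j<3. \<omega> j * C)"
        using tri(2) diag[of "h _"] by (intro sum_mono) (simp add: abs_mult hh mult_left_mono)
      also have "\<dots> = C"
        using tri(3) by (simp flip: sum_distrib_right)
      finally show ?thesis .
    qed
  qed
  show ?thesis
  proof (cases "u = 0 \<or> v = 0")
    case True
    then show ?thesis by (auto simp: T)
  next
    case False
    define a b where "a = sqrt (q u u)" and "b = sqrt (q v v)"
    have ab: "a > 0" "b > 0" "q u u = a * a" "q v v = b * b"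
      using False pos nonneg by (simp_all add: a_def b_def)
    have "\<bar>T ((1/a) *\<^sub>R u) ((1/b) *\<^sub>R v) ((1/b) *\<^sub>R v)\<bar> \<le> C"
      using ab by (intro unit) simp_all
    then have "\<bar>T u v v\<bar> / (a * (b * b)) \<le> C"
      using ab by (simp add: T abs_mult mult_ac)
    then show ?thesis
      using ab by (simp add: a_def[symmetric] pos_divide_le_eq mult.assoc)
  qed
qed

end

subsection \<open>Differential inequalities\<close>

text \<open>The derivative of 1 / sqrt a is - a' / (2 a^(3/2)) and hence at least -1, so 1 / sqrt a
  + t is nondecreasing. As \<open>a\<close> may vanish, this is carried out for a + \<epsilon>, and
  \<epsilon> tends to 0 at the end.\<close>

lemma self_concordant_ode_bound:
  fixes a a' :: "real \<Rightarrow> real"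
  assumes deriv: "\<And>t. 0 \<le> t \<Longrightarrow> t \<le> \<tau> \<Longrightarrow> (a has_real_derivative a' t) (at t)"
    and nonneg: "\<And>t. 0 \<le> t \<Longrightarrow> t \<le> \<tau> \<Longrightarrow> 0 \<le> a t"
    and bound: "\<And>t. 0 \<le> t \<Longrightarrow> t \<le> \<tau> \<Longrightarrow> \<bar>a' t\<bar> \<le> 2 * sqrt (a t) ^ 3"
    and \<tau>: "0 \<le> \<tau>" "\<tau> * sqrt (a 0) < 1"
  shows "a \<tau> \<le> a 0 / (1 - \<tau> * sqrt (a 0))\<^sup>2"
proof -
  have main: "a \<tau> + \<epsilon> \<le> (a 0 + \<epsilon>) / (1 - \<tau> * sqrt (a 0 + \<epsilon>))\<^sup>2"
    if \<epsilon>: "\<epsilon> > 0" "\<tau> * sqrt (a 0 + \<epsilon>) < 1" for \<epsilon>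
  proof -
    define g where "g t = 1 / sqrt (a t + \<epsilon>) + t" for t
    have pos: "0 < a t + \<epsilon>" if "0 \<le> t" "t \<le> \<tau>" for t
      using nonneg[OF that] \<epsilon> by simp
    have "g 0 \<le> g \<tau>"
    proof (rule DERIV_nonneg_imp_nondecreasing[OF \<tau>(1)])
      fix t assume t: "0 \<le> t" "t \<le> \<tau>"
      let ?b = "sqrt (a t + \<epsilon>)"
      have b: "?b > 0" using pos[OF t] by simp
      have "(g has_real_derivative - (a' t / (2 * ?b)) / (?b * ?b) + 1) (at t)"
        unfolding g_def using b pos[OF t]
        by (auto intro!: derivative_eq_intros deriv[OF t] simp: field_simps)
      moreover have "a' t / (2 * ?b) \<le> ?b * ?b"
      proof -
        have "a' t \<le> 2 * sqrt (a t) ^ 3" using bound[OF t] by simp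
        also have "\<dots> \<le> 2 * ?b ^ 3"
          using \<epsilon> nonneg[OF t] by (intro mult_left_mono power_mono) auto
        finally show ?thesis using b by (simp add: field_simps power3_eq_cube)
      qed
      ultimately show "\<exists>y. (g has_real_derivative y) (at t) \<and> 0 \<le> y"
        using b by (intro exI[of _ "- (a' t / (2 * ?b)) / (?b * ?b) + 1"]) (simp add: divide_le_eq mult.commute)
    qed
    define r s where "r = sqrt (a 0 + \<epsilon>)" and "s = sqrt (a \<tau> + \<epsilon>)"
    have rs: "r > 0" "s > 0" "a 0 + \<epsilon> = r\<^sup>2" "a \<tau> + \<epsilon> = s\<^sup>2" "\<tau> * r < 1"
      using pos[of 0] pos[of \<tau>] \<tau> \<epsilon> by (simp_all add: r_def s_def less_imp_le)
    have "1 / r \<le> 1 / s + \<tau>"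
      using \<open>g 0 \<le> g \<tau>\<close> by (simp add: g_def r_def s_def)
    then have "s * (1 - \<tau> * r) \<le> r"
      using rs by (simp add: field_simps)
    then have "s \<le> r / (1 - \<tau> * r)"
      using rs by (simp add: field_simps)
    then have "s\<^sup>2 \<le> (r / (1 - \<tau> * r))\<^sup>2"
      using rs by (intro power_mono) auto
    then have "a \<tau> + \<epsilon> \<le> (a 0 + \<epsilon>) / (1 - \<tau> * r)\<^sup>2"
      unfolding power_divide rs(3,4) .
    then show ?thesis
      unfolding r_def .
  qed
  have lim: "((\<lambda>\<epsilon>. (a 0 + \<epsilon>) / (1 - \<tau> * sqrt (a 0 + \<epsilon>))\<^sup>2) \<longlongrightarrow>
      (a 0 + 0) / (1 - \<tau> * sqrt (a 0 + 0))\<^sup>2) (at_right 0)"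
    using \<tau> by (intro tendsto_intros) auto
  have "((\<lambda>\<epsilon>. 1 - \<tau> * sqrt (a 0 + \<epsilon>)) \<longlongrightarrow> 1 - \<tau> * sqrt (a 0 + 0)) (at_right 0)"
    by (intro tendsto_intros)
  then have "\<forall>\<^sub>F \<epsilon> in at_right 0. 0 < 1 - \<tau> * sqrt (a 0 + \<epsilon>)"
    using \<tau> by (intro order_tendstoD) auto
  moreover have "\<forall>\<^sub>F \<epsilon>::real in at_right 0. 0 < \<epsilon>"
    by (rule eventually_at_right_less)
  ultimately have ev: "\<forall>\<^sub>F \<epsilon> in at_right 0. a \<tau> + \<epsilon> \<le> (a 0 + \<epsilon>) / (1 - \<tau> * sqrt (a 0 + \<epsilon>))\<^sup>2"
    by eventually_elim (rule main; simp)
  have "((\<lambda>\<epsilon>. a \<tau> + \<epsilon>) \<longlongrightarrow> a \<tau> + 0) (at_right 0)"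
    by (intro tendsto_intros)
  then show ?thesis
    using tendsto_le[OF _ lim _ ev] by simp
qed

text \<open>Used with \<open>h\<close> equal to a function minus an explicit majorant of its
  curvature; this yields second-order Taylor bounds without integrals.\<close>

lemma concave_tangent_bound:
  fixes h h' h'' :: "real \<Rightarrow> real"
  assumes \<tau>: "0 \<le> \<tau>"
    and h: "\<And>t. 0 \<le> t \<Longrightarrow> t \<le> \<tau> \<Longrightarrow> (h has_real_derivative h' t) (at t)"
    and h': "\<And>t. 0 \<le> t \<Longrightarrow> t \<le> \<tau> \<Longrightarrow> (h' has_real_derivative h'' t) (at t)"
    and h'': "\<And>t. 0 \<le> t \<Longrightarrow> t \<le> \<tau> \<Longrightarrow> h'' t \<le> 0"
  shows "h \<tau> \<le> h 0 + \<tau> * h' 0"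
proof -
  have mono: "h' t \<le> h' 0" if "0 \<le> t" "t \<le> \<tau>" for t
    using that h' h'' by (intro DERIV_nonpos_imp_nonincreasing[OF that(1)]) (meson order_trans)
  have "h \<tau> - \<tau> * h' 0 \<le> h 0 - 0 * h' 0"
  proof (rule DERIV_nonpos_imp_nonincreasing[OF \<tau>, where f = "\<lambda>t. h t - t * h' 0"])
    fix t assume t: "0 \<le> t" "t \<le> \<tau>"
    have "((\<lambda>t. h t - t * h' 0) has_real_derivative h' t - h' 0) (at t)"
      by (auto intro!: derivative_eq_intros h[OF t])
    then show "\<exists>y. ((\<lambda>t. h t - t * h' 0) has_real_derivative y) (at t) \<and> y \<le> 0"
      using mono[OF t] by (intro exI[of _ "h' t - h' 0"]) simp
  qed
  then show ?thesis by simp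
qed

text \<open>Connects the iterated \<open>deriv\<close> in the definition of the barrier with
  explicit derivatives. The identities are needed on an open set, since each further
  \<open>deriv\<close> depends on the values nearby.\<close>

lemma iterated_deriv_eqI:
  fixes \<phi> \<phi>1 \<phi>2 \<phi>3 :: "real \<Rightarrow> real"
  assumes T: "open T" "t \<in> T"
    and d: "\<And>t. t \<in> T \<Longrightarrow> (\<phi> has_real_derivative \<phi>1 t) (at t)"
      "\<And>t. t \<in> T \<Longrightarrow> (\<phi>1 has_real_derivative \<phi>2 t) (at t)"
      "\<And>t. t \<in> T \<Longrightarrow> (\<phi>2 has_real_derivative \<phi>3 t) (at t)"
  shows "(deriv ^^ 2) \<phi> t = \<phi>2 t" "(deriv ^^ 3) \<phi> t = \<phi>3 t"
proof -
  have cong: "deriv f t = deriv g t" if "\<And>s. s \<in> T \<Longrightarrow> f s = g s" "t \<in> T" for f g :: "real \<Rightarrow> real" and t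
    using eventually_mono[OF eventually_nhds_in_open[OF T(1) that(2)] that(1)]
    by (intro deriv_cong_ev) auto
  have 1: "deriv \<phi> t = \<phi>1 t" if "t \<in> T" for t
    using d(1)[OF that] by (rule DERIV_imp_deriv)
  have 2: "deriv (deriv \<phi>) t = \<phi>2 t" if "t \<in> T" for t
    using cong[OF 1 that] DERIV_imp_deriv[OF d(2)[OF that]] by simp
  have 3: "deriv (deriv (deriv \<phi>)) t = \<phi>3 t" if "t \<in> T" for t
    using cong[OF 2 that] DERIV_imp_deriv[OF d(3)[OF that]] by simp
  show "(deriv ^^ 2) \<phi> t = \<phi>2 t" "(deriv ^^ 3) \<phi> t = \<phi>3 t"
    using 2 3 T(2) by (simp_all add: eval_nat_numeral)
qed

subsection \<open>Self-concordant barriers of proper cones\<close>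

locale barrier_cone =
  fixes K :: "(real^'n) set" and \<theta> :: real and B :: "real^'n \<Rightarrow> real"
  assumes cone: "proper_cone K"
    and barrier: "lh_self_concordant_barrier K \<theta> B"
begin

abbreviation hess_form :: "real^'n \<Rightarrow> real^'n \<Rightarrow> real^'n \<Rightarrow> real" where
  "hess_form x u v \<equiv> u \<bullet> (hessian B x *v v)"

definition third :: "real^'n \<Rightarrow> real^'n \<Rightarrow> real^'n \<Rightarrow> real^'n \<Rightarrow> real" where
  "third x u v w = dir_deriv u (dir_deriv v (dir_deriv w B)) x"

lemma C3: "Ck_open 3 B (interior K)"
  using barrier by (auto simp: lh_self_concordant_barrier_def intro: Ck_on_open)

lemma C2: "Ck_open 2 B (interior K)"
  using C3 by (rule Ck_open_mono) simp

lemma C2_dir: "Ck_open 2 (dir_deriv v B) (interior K)"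
  using C3 by (simp only: numeral_3_eq_3 numeral_2_eq_2 Ck_open_dir_deriv)

lemma differentiable: "x \<in> interior K \<Longrightarrow> B differentiable at x"
  by (rule C2_differentiable[OF C2 open_interior])

lemma hess_form_eq: "x \<in> interior K \<Longrightarrow> hess_form x u v = dir_deriv v (dir_deriv u B) x"
  by (rule inner_hessian[OF C2 open_interior])

lemma hess_form_sym: "x \<in> interior K \<Longrightarrow> hess_form x u v = hess_form x v u"
  by (rule hessian_symmetric[OF C2 open_interior])

lemma hess_form_linear: "linear (\<lambda>u. hess_form x u v)"
  by (auto intro!: linearI simp: inner_add_left)

lemma third_linear:
  assumes "x \<in> interior K"
  shows "linear (\<lambda>u. third x u v w)"
  unfolding third_def
  by (rule linear_dir_deriv, rule C2_dir_deriv_differentiable[OF C2_dir open_interior assms])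

text \<open>The first interchange is the symmetry of second derivatives applied to a first
  derivative of \<open>B\<close>; the second one differentiates that symmetry for \<open>B\<close>
  itself, which holds on the whole interior.\<close>

lemma third_sym:
  assumes x: "x \<in> interior K"
  shows "third x u v w = third x v u w" "third x u v w = third x u w v"
proof -
  show "third x u v w = third x v u w"
    unfolding third_def by (rule dir_deriv_commute[OF C2_dir open_interior x])
  show "third x u v w = third x u w v"
    unfolding third_def
    by (rule dir_deriv_cong[OF open_interior x])
      (simp_all add: dir_deriv_commute[OF C2 open_interior, of _ v w]
        C2_dir_deriv_differentiable[OF C2_dir open_interior x])
qed

lemma line_derivs:
  assumes "x + t *\<^sub>R u \<in> interior K"
  shows "((\<lambda>t. B (x + t *\<^sub>R u)) has_real_derivative gradient B (x + t *\<^sub>R u) \<bullet> u) (at t)"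
    "((\<lambda>t. gradient B (x + t *\<^sub>R u) \<bullet> v) has_real_derivative hess_form (x + t *\<^sub>R u) u v) (at t)"
    "((\<lambda>t. hess_form (x + t *\<^sub>R u) v v) has_real_derivative third (x + t *\<^sub>R u) u v v) (at t)"
proof -
  let ?T = "(\<lambda>t. x + t *\<^sub>R u) -` interior K"
  have T: "open ?T" "t \<in> ?T"
    using assms by (auto intro!: open_vimage continuous_intros)
  show "((\<lambda>t. B (x + t *\<^sub>R u)) has_real_derivative gradient B (x + t *\<^sub>R u) \<bullet> u) (at t)"
    using has_real_derivative_along_line[OF differentiable[OF assms]]
    by (simp add: gradient_inner differentiable[OF assms])
  have "((\<lambda>t. dir_deriv v B (x + t *\<^sub>R u)) has_real_derivative hess_form (x + t *\<^sub>R u) u v) (at t)"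
    using has_real_derivative_along_line[OF C2_dir_deriv_differentiable[OF C2 open_interior assms]]
    unfolding hess_form_eq[OF assms] dir_deriv_commute[OF C2 open_interior assms, of v u] .
  then show "((\<lambda>t. gradient B (x + t *\<^sub>R u) \<bullet> v) has_real_derivative hess_form (x + t *\<^sub>R u) u v) (at t)"
    by (rule has_field_derivative_transform_within_open[OF _ T]) (simp add: gradient_inner differentiable)
  have "((\<lambda>t. dir_deriv v (dir_deriv v B) (x + t *\<^sub>R u)) has_real_derivative third (x + t *\<^sub>R u) u v v) (at t)"
    unfolding third_def
    by (rule has_real_derivative_along_line[OF C2_dir_deriv_differentiable[OF C2_dir open_interior assms]])
  then show "((\<lambda>t. hess_form (x + t *\<^sub>R u) v v) has_real_derivative third (x + t *\<^sub>R u) u v v) (at t)"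
    by (rule has_field_derivative_transform_within_open[OF _ T]) (simp add: hess_form_eq)
qed

text \<open>For the directions \<open>u\<close> and \<open>-u\<close> the second difference is 2 B x
  - B (x + h u) - B (x - h u), nonpositive by midpoint convexity, and its scaled limit is the
  negative of the Hessian form.\<close>

lemma hess_form_nonneg:
  assumes x: "x \<in> interior K"
  shows "0 \<le> hess_form x u u"
proof -
  let ?g = "\<lambda>h. (B (x + h *\<^sub>R u + h *\<^sub>R (- u)) - B (x + h *\<^sub>R u) - B (x + h *\<^sub>R (- u)) + B x) / h\<^sup>2"
  have "(?g \<longlongrightarrow> dir_deriv (- u) (dir_deriv u B) x) (at_right 0)"
    by (rule second_difference_tendsto[OF C2 open_interior x])
  moreover have "\<forall>\<^sub>F h in at_right 0. ?g h \<le> 0"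
  proof -
    have "\<forall>\<^sub>F h in at_right (0::real). x + h *\<^sub>R v \<in> interior K" for v
    proof (rule topological_tendstoD[of _ x])
      have "((\<lambda>h. x + h *\<^sub>R v) \<longlongrightarrow> x + 0 *\<^sub>R v) (at_right 0)"
        by (intro tendsto_intros)
      then show "((\<lambda>h. x + h *\<^sub>R v) \<longlongrightarrow> x) (at_right 0)" by simp
    qed (use x in auto)
    from this[of u] this[of "- u"] show ?thesis
    proof eventually_elim
      case (elim h)
      have conv: "convex_on (interior K) B"
        using barrier by (simp add: lh_self_concordant_barrier_def)
      have "x = (1 - 1/2) *\<^sub>R (x + h *\<^sub>R u) + (1/2) *\<^sub>R (x + h *\<^sub>R (- u))"
        by (simp add: scaleR_add_right[symmetric])
      then have "B x \<le> (1 - 1/2) * B (x + h *\<^sub>R u) + (1/2) * B (x + h *\<^sub>R (- u))"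
        using convex_onD[OF conv, of "1/2" "x + h *\<^sub>R u" "x + h *\<^sub>R (- u)"] elim by simp
      then show ?case
        by (intro divide_nonpos_nonneg) auto
    qed
  qed
  ultimately have "dir_deriv (- u) (dir_deriv u B) x \<le> 0"
    by (rule tendsto_upperbound) simp
  then show ?thesis
    using linear_neg[OF linear_dir_deriv[OF C2_dir_deriv_differentiable[OF C2 open_interior x, of u]], of u]
    by (simp add: hess_form_eq[OF x])
qed

lemma local_norm_scaleR: "local_norm B x (c *\<^sub>R v) = \<bar>c\<bar> * local_norm B x v"
  by (simp add: local_norm_def matrix_vector_mult_scaleR real_sqrt_mult flip: mult.assoc)

lemma local_norm_sq: "x \<in> interior K \<Longrightarrow> (local_norm B x v)\<^sup>2 = hess_form x v v"
  by (simp add: local_norm_def hess_form_nonneg)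

lemma third_diag:
  assumes x: "x \<in> interior K"
  shows "\<bar>third x u u u\<bar> \<le> 2 * sqrt (hess_form x u u) ^ 3"
proof -
  let ?T = "(\<lambda>t. x + t *\<^sub>R u) -` interior K"
  have T: "open ?T" "0 \<in> ?T"
    using x by (auto intro!: open_vimage continuous_intros)
  have "(deriv ^^ 2) (\<lambda>t. B (x + t *\<^sub>R u)) 0 = hess_form (x + 0 *\<^sub>R u) u u"
    "(deriv ^^ 3) (\<lambda>t. B (x + t *\<^sub>R u)) 0 = third (x + 0 *\<^sub>R u) u u u"
    by (rule iterated_deriv_eqI[OF T]; use line_derivs[of x _ u] in force)+
  moreover have "\<bar>(deriv ^^ 3) (\<lambda>t. B (x + t *\<^sub>R u)) 0\<bar>
      \<le> 2 * ((deriv ^^ 2) (\<lambda>t. B (x + t *\<^sub>R u)) 0) powr (3/2)"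
    using barrier x unfolding lh_self_concordant_barrier_def Let_def by blast
  moreover have "hess_form x u u powr (3/2) = sqrt (hess_form x u u) ^ 3"
    using hess_form_nonneg[OF x] by (simp add: powr_half_sqrt_powr real_sqrt_power)
  ultimately show ?thesis by simp
qed

lemma hess_form_along_segment:
  assumes seg: "\<And>t. 0 \<le> t \<Longrightarrow> t \<le> \<tau> \<Longrightarrow> x + t *\<^sub>R u \<in> interior K"
    and \<tau>: "0 \<le> \<tau>" "\<tau> * local_norm B x u < 1"
  shows "hess_form (x + \<tau> *\<^sub>R u) u u \<le> (local_norm B x u)\<^sup>2 / (1 - \<tau> * local_norm B x u)\<^sup>2"
proof -
  have x: "x \<in> interior K"
    using seg[of 0] \<tau> by simp
  have "hess_form (x + \<tau> *\<^sub>R u) u u \<le> hess_form (x + 0 *\<^sub>R u) u u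
      / (1 - \<tau> * sqrt (hess_form (x + 0 *\<^sub>R u) u u))\<^sup>2"
    by (rule self_concordant_ode_bound[where a = "\<lambda>t. hess_form (x + t *\<^sub>R u) u u"
          and a' = "\<lambda>t. third (x + t *\<^sub>R u) u u u"])
      (use seg \<tau> in \<open>auto intro: line_derivs hess_form_nonneg third_diag simp: local_norm_def\<close>)
  then show ?thesis
    unfolding local_norm_sq[OF x] by (simp add: local_norm_def)
qed

text \<open>Follow the segment up to the first time \<tau> at which it leaves the interior. Before
  \<tau> the second derivative along the segment is bounded, so \<open>B\<close> stays bounded,
  although it must blow up at the boundary point reached.\<close>

lemma Dikin_ellipsoid:
  assumes x: "x \<in> interior K" and r: "local_norm B x (y - x) < 1"
  shows "y \<in> interior K"
proof (rule ccontr)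
  assume y: "y \<notin> interior K"
  define u where "u = y - x"
  define r where "r = local_norm B x u"
  have r: "0 \<le> r" "r < 1"
    using r hess_form_nonneg[OF x] by (simp_all add: r_def u_def local_norm_def)
  define T where "T = {t \<in> {0..1}. x + t *\<^sub>R u \<notin> interior K}"
  have "closed ((\<lambda>t. x + t *\<^sub>R u) -` (- interior K))"
    by (intro continuous_closed_vimage) (auto intro!: continuous_intros)
  moreover have "T = {0..1} \<inter> (\<lambda>t. x + t *\<^sub>R u) -` (- interior K)"
    by (auto simp: T_def)
  ultimately have "closed T" by auto
  have ne: "1 \<in> T" and bdd: "bdd_below T"
    using y by (auto simp: T_def u_def intro: bdd_belowI[of _ 0])
  define \<tau> where "\<tau> = Inf T"
  have \<tau>T: "\<tau> \<in> T"
    unfolding \<tau>_def using ne bdd \<open>closed T\<close> by (intro closed_contains_Inf) auto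
  then have \<tau>: "0 < \<tau>" "\<tau> \<le> 1" "x + \<tau> *\<^sub>R u \<notin> interior K"
    using x by (cases "\<tau> = 0"; auto simp: T_def)+
  have inside: "x + t *\<^sub>R u \<in> interior K" if "0 \<le> t" "t < \<tau>" for t
    using that \<tau> cInf_lower[OF _ bdd, of t] by (fastforce simp: T_def \<tau>_def)
  \<comment> \<open>Bound for the second derivative of \<open>B\<close> along the whole segment,
    uniform because t r \<le> r < 1.\<close>
  define C where "C = r\<^sup>2 / (1 - r)\<^sup>2"
  define M where "M = \<bar>B x\<bar> + \<bar>gradient B x \<bullet> u\<bar> + C"
  have bound: "B (x + t *\<^sub>R u) \<le> M" if t: "0 \<le> t" "t < \<tau>" for t
  proof -
    let ?h = "\<lambda>s. B (x + s *\<^sub>R u) - C * s\<^sup>2 / 2"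
    have "?h t \<le> ?h 0 + t * (gradient B (x + 0 *\<^sub>R u) \<bullet> u - C * 0)"
    proof (rule concave_tangent_bound[OF t(1),
          where h'' = "\<lambda>s. hess_form (x + s *\<^sub>R u) u u - C" and h' = "\<lambda>s. gradient B (x + s *\<^sub>R u) \<bullet> u - C * s"])
      fix s assume s: "0 \<le> s" "s \<le> t"
      then have "x + s *\<^sub>R u \<in> interior K"
        using t inside by simp
      note d = line_derivs[OF this]
      show "(?h has_real_derivative gradient B (x + s *\<^sub>R u) \<bullet> u - C * s) (at s)"
        by (auto intro!: derivative_eq_intros d(1))
      show "((\<lambda>s. gradient B (x + s *\<^sub>R u) \<bullet> u - C * s) has_real_derivative
          hess_form (x + s *\<^sub>R u) u u - C) (at s)"
        by (auto intro!: derivative_eq_intros d(2))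
      have "s * r \<le> 1 * r"
        using s t \<tau> r by (intro mult_right_mono) auto
      then have sr: "s * r \<le> r" by simp
      then have "hess_form (x + s *\<^sub>R u) u u \<le> r\<^sup>2 / (1 - s * r)\<^sup>2"
        using s t r inside unfolding r_def by (intro hess_form_along_segment) auto
      also have "\<dots> \<le> C"
        unfolding C_def using sr r by (intro divide_left_mono power_mono) (auto intro!: mult_pos_pos)
      finally show "hess_form (x + s *\<^sub>R u) u u - C \<le> 0" by simp
    qed
    moreover have "C * t\<^sup>2 / 2 \<le> C"
    proof -
      have "t\<^sup>2 \<le> 1" using t \<tau> by (simp add: power_le_one)
      then have "C * t\<^sup>2 \<le> C * 1" by (intro mult_left_mono) (simp_all add: C_def)
      moreover have "0 \<le> C" by (simp add: C_def)
      ultimately show ?thesis by simp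
    qed
    moreover have "t * (gradient B x \<bullet> u) \<le> \<bar>gradient B x \<bullet> u\<bar>"
    proof -
      have "t * (gradient B x \<bullet> u) \<le> t * \<bar>gradient B x \<bullet> u\<bar>"
        using t by (intro mult_left_mono) auto
      also have "\<dots> \<le> 1 * \<bar>gradient B x \<bullet> u\<bar>"
        using t \<tau> by (intro mult_right_mono) auto
      finally show ?thesis by simp
    qed
    ultimately show ?thesis by (simp add: M_def)
  qed
  have lim: "((\<lambda>t. x + t *\<^sub>R u) \<longlongrightarrow> x + \<tau> *\<^sub>R u) (at_left \<tau>)"
    by (intro tendsto_intros)
  have ev: "\<forall>\<^sub>F t in at_left \<tau>. 0 < t \<and> t < \<tau>"
    using eventually_at_left_real[OF \<tau>(1)] by eventually_elim auto
  have "x + \<tau> *\<^sub>R u \<in> closure (interior K)"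
  proof (rule Lim_in_closed_set[OF closed_closure _ _ lim])
    show "\<forall>\<^sub>F t in at_left \<tau>. x + t *\<^sub>R u \<in> closure (interior K)"
      using ev by eventually_elim (use inside closure_subset in force)
  qed simp
  then have front: "x + \<tau> *\<^sub>R u \<in> frontier K"
    using \<tau>(3) closure_mono[OF interior_subset, of K] by (auto simp: frontier_def)
  \<comment> \<open>The filter \<open>at\<close> excludes its centre, so the segment must not be
    constant.\<close>
  have "u \<noteq> 0"
    using x y by (auto simp: u_def)
  then have "filterlim (\<lambda>t. x + t *\<^sub>R u) (at (x + \<tau> *\<^sub>R u) within interior K) (at_left \<tau>)"
    unfolding filterlim_at using ev inside by (auto elim!: eventually_mono intro!: lim)
  moreover have "filterlim B at_top (at (x + \<tau> *\<^sub>R u) within interior K)"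
    using barrier front by (simp add: lh_self_concordant_barrier_def)
  ultimately have "filterlim (\<lambda>t. B (x + t *\<^sub>R u)) at_top (at_left \<tau>)"
    by (rule filterlim_compose[rotated])
  then have "\<forall>\<^sub>F t in at_left \<tau>. M < B (x + t *\<^sub>R u)"
    by (simp add: filterlim_at_top_dense)
  with ev have "\<forall>\<^sub>F t in at_left \<tau>. False"
  proof eventually_elim
    case (elim t)
    then show ?case using bound[of t] by simp
  qed
  then show False by simp
qed

text \<open>A direction in which the Hessian vanishes would span a line inside \<open>K\<close>.\<close>

lemma hess_form_pos:
  assumes x: "x \<in> interior K" and u: "u \<noteq> 0"
  shows "0 < hess_form x u u"
proof (rule ccontr)
  assume "\<not> 0 < hess_form x u u"
  then have z: "hess_form x u u = 0"
    using hess_form_nonneg[OF x, of u] by simp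
  have K: "closed K" "\<And>c y. y \<in> K \<Longrightarrow> 0 \<le> c \<Longrightarrow> c *\<^sub>R y \<in> K" "\<And>y. y \<in> K \<Longrightarrow> - y \<in> K \<Longrightarrow> y = 0"
    using cone by (auto simp: proper_cone_def cone_def)
  have line: "v \<in> K" if v: "hess_form x v v = 0" for v
  proof -
    have "x + s *\<^sub>R v \<in> K" for s
      using Dikin_ellipsoid[OF x, of "x + s *\<^sub>R v"] v interior_subset
      by (auto simp: local_norm_def matrix_vector_mult_scaleR)
    then have "(1 / real (Suc k)) *\<^sub>R (x + real (Suc k) *\<^sub>R v) \<in> K" for k
      using K(2) by simp
    then have mem: "(1 / real (Suc k)) *\<^sub>R x + v \<in> K" for k
      by (simp add: scaleR_add_right)
    have "(\<lambda>k. (1 / real (Suc k)) *\<^sub>R x + v) \<longlonglongrightarrow> 0 *\<^sub>R x + v"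
      using LIMSEQ_inverse_real_of_nat by (intro tendsto_intros) (simp add: inverse_eq_divide)
    then show ?thesis
      using closed_sequentially[OF K(1) mem] by simp
  qed
  have "- u \<in> K" "u \<in> K"
    using line[of u] line[of "- u"] z matrix_vector_mult_scaleR[of "hessian B x" "- 1" u] by simp_all
  then show False
    using K(3) u by blast
qed

lemma pos_def_form: "x \<in> interior K \<Longrightarrow> pos_def_form (hess_form x)"
  by (rule pos_def_form.intro[OF hess_form_linear hess_form_sym hess_form_pos])

lemma third_bound:
  assumes x: "x \<in> interior K"
  shows "\<bar>third x u v v\<bar> \<le> 2 * local_norm B x u * hess_form x v v"
proof -
  interpret pos_def_form "hess_form x" by (rule pos_def_form[OF x])
  show ?thesis
    unfolding local_norm_def
    by (rule symmetric_trilinear_bound[where T = "third x"])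
      (use third_linear[OF x] third_sym[OF x] third_diag[OF x] in blast)+
qed

text \<open>Let g t be the Hessian form of \<open>v\<close> at x + t u. The trilinear bound and the
  growth of |u| along the segment give |g' t| (1 - t r) \<le> 2 r g t. Hence g multiplied by (1 - t
  r)^2 decreases and g divided by (1 - t r)^2 increases.\<close>

lemma local_norm_change:
  assumes x: "x \<in> interior K" and r: "local_norm B x (y - x) < 1"
  shows "local_norm B y v \<le> local_norm B x v / (1 - local_norm B x (y - x))"
    "(1 - local_norm B x (y - x)) * local_norm B x v \<le> local_norm B y v"
proof -
  define u where "u = y - x"
  define r where "r = local_norm B x u"
  have y: "y = x + 1 *\<^sub>R u" by (simp add: u_def)
  have r: "0 \<le> r" "r < 1"
    using r hess_form_nonneg[OF x] by (simp_all add: r_def u_def local_norm_def)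
  have tr: "t * r < 1" if "0 \<le> t" "t \<le> 1" for t
    using mult_left_le_one_le[OF r(1) that] r by simp
  have inside: "x + t *\<^sub>R u \<in> interior K" if "0 \<le> t" "t \<le> 1" for t
    using tr[OF that] that by (intro Dikin_ellipsoid[OF x]) (simp add: local_norm_scaleR r_def)
  let ?g = "\<lambda>t. hess_form (x + t *\<^sub>R u) v v" and ?g' = "\<lambda>t. third (x + t *\<^sub>R u) u v v"
  have g': "\<bar>?g' t\<bar> * (1 - t * r) \<le> 2 * r * ?g t" if t: "0 \<le> t" "t \<le> 1" for t
  proof -
    have "hess_form (x + t *\<^sub>R u) u u \<le> r\<^sup>2 / (1 - t * r)\<^sup>2"
      using t inside tr unfolding r_def by (intro hess_form_along_segment) auto
    then have "local_norm B (x + t *\<^sub>R u) u \<le> r / (1 - t * r)"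
      using tr[OF t] r unfolding local_norm_def by (intro real_le_lsqrt) (auto simp: power_divide)
    then have "2 * local_norm B (x + t *\<^sub>R u) u * ?g t \<le> 2 * (r / (1 - t * r)) * ?g t"
      using hess_form_nonneg[OF inside[OF t]] by (intro mult_right_mono mult_left_mono) auto
    with third_bound[OF inside[OF t], of u v] have "\<bar>?g' t\<bar> \<le> 2 * (r / (1 - t * r)) * ?g t"
      by linarith
    then show ?thesis
      using tr[OF t] by (simp add: field_simps)
  qed
  have d: "(?g has_real_derivative ?g' t) (at t)" if "0 \<le> t" "t \<le> 1" for t
    using inside[OF that] by (rule line_derivs)
  have "(1 - 1 * r)\<^sup>2 * ?g 1 \<le> (1 - 0 * r)\<^sup>2 * ?g 0"
  proof (rule DERIV_nonpos_imp_nonincreasing[where f = "\<lambda>t. (1 - t * r)\<^sup>2 * ?g t"])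
    fix t :: real assume t: "0 \<le> t" "t \<le> 1"
    have "((\<lambda>t. (1 - t * r)\<^sup>2 * ?g t) has_real_derivative
        (1 - t * r) * (?g' t * (1 - t * r) - 2 * r * ?g t)) (at t)"
      by (auto intro!: derivative_eq_intros d[OF t] simp: power2_eq_square algebra_simps)
    moreover have "(1 - t * r) * (?g' t * (1 - t * r) - 2 * r * ?g t) \<le> 0"
    proof -
      have "?g' t * (1 - t * r) \<le> \<bar>?g' t\<bar> * (1 - t * r)"
        using tr[OF t] by (intro mult_right_mono) auto
      then show ?thesis
        using g'[OF t] tr[OF t] by (intro mult_nonneg_nonpos) linarith+
    qed
    ultimately show "\<exists>y. ((\<lambda>t. (1 - t * r)\<^sup>2 * ?g t) has_real_derivative y) (at t) \<and> y \<le> 0"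
      by blast
  qed simp
  then have le1: "(1 - r)\<^sup>2 * hess_form y v v \<le> hess_form x v v"
    by (simp add: y)
  define e where "e t = 1 / (1 - t * r)" for t
  have "(e 0)\<^sup>2 * ?g 0 \<le> (e 1)\<^sup>2 * ?g 1"
  proof (rule DERIV_nonneg_imp_nondecreasing[where f = "\<lambda>t. (e t)\<^sup>2 * ?g t"])
    fix t :: real assume t: "0 \<le> t" "t \<le> 1"
    have nz: "1 - t * r > 0" using tr[OF t] by simp
    have "(e has_real_derivative r * (e t)\<^sup>2) (at t)"
      unfolding e_def[abs_def] using nz by (auto intro!: derivative_eq_intros simp: power2_eq_square)
    then have "((\<lambda>t. (e t)\<^sup>2 * ?g t) has_real_derivative (e t)\<^sup>2 * (2 * r * e t * ?g t + ?g' t)) (at t)"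
      by (auto intro!: derivative_eq_intros d[OF t] simp: power2_eq_square algebra_simps)
    moreover have "0 \<le> 2 * r * e t * ?g t + ?g' t"
      using g'[OF t] nz by (simp add: e_def pos_le_divide_eq[symmetric])
    ultimately show "\<exists>y. ((\<lambda>t. (e t)\<^sup>2 * ?g t) has_real_derivative y) (at t) \<and> 0 \<le> y"
      by (intro exI conjI) (assumption, simp)
  qed simp
  then have le2: "(1 - r)\<^sup>2 * hess_form x v v \<le> hess_form y v v"
    using r by (simp add: y e_def field_simps)
  show "local_norm B y v \<le> local_norm B x v / (1 - local_norm B x (y - x))"
    using real_sqrt_le_mono[OF le1] r
    by (simp add: local_norm_def[of _ _ v] real_sqrt_mult r_def u_def pos_le_divide_eq mult.commute)
  show "(1 - local_norm B x (y - x)) * local_norm B x v \<le> local_norm B y v"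
    using real_sqrt_le_mono[OF le2] r
    by (simp add: local_norm_def[of _ _ v] real_sqrt_mult r_def u_def)
qed

text \<open>The second derivative along the segment is at most r^2 / (1 - t r)^2. Enlarging the
  exponent to 3 makes the double primitive rational, with remainder r^2 / (2 (1 - r)) instead of a
  logarithm; this produces the term 1 / (1 - s) of \<open>L_phi\<close>.\<close>

lemma barrier_descent:
  assumes x: "x \<in> interior K" and r: "local_norm B x (y - x) < 1"
  shows "B y \<le> B x + gradient B x \<bullet> (y - x)
    + (local_norm B x (y - x))\<^sup>2 / (2 * (1 - local_norm B x (y - x)))"
proof -
  define u where "u = y - x"
  define r where "r = local_norm B x u"
  have y: "y = x + 1 *\<^sub>R u" by (simp add: u_def)
  have r: "0 \<le> r" "r < 1"
    using r hess_form_nonneg[OF x] by (simp_all add: r_def u_def local_norm_def)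
  have tr: "t * r < 1" if "0 \<le> t" "t \<le> 1" for t
    using mult_left_le_one_le[OF r(1) that] r by simp
  have inside: "x + t *\<^sub>R u \<in> interior K" if "0 \<le> t" "t \<le> 1" for t
    using tr[OF that] that by (intro Dikin_ellipsoid[OF x]) (simp add: local_norm_scaleR r_def)
  let ?c = "\<lambda>t. (1 / (1 - t * r) - t * r) / 2"
  let ?h = "\<lambda>t. B (x + t *\<^sub>R u) - ?c t"
  let ?h' = "\<lambda>t. gradient B (x + t *\<^sub>R u) \<bullet> u - (r / (1 - t * r)\<^sup>2 - r) / 2"
  have "?h 1 \<le> ?h 0 + 1 * ?h' 0"
  proof (rule concave_tangent_bound[where
        h'' = "\<lambda>t. hess_form (x + t *\<^sub>R u) u u - r\<^sup>2 / (1 - t * r) ^ 3"])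
    fix t :: real assume t: "0 \<le> t" "t \<le> 1"
    note d = line_derivs[OF inside[OF t]]
    have nz: "1 - t * r > 0" using tr[OF t] by simp
    show "(?h has_real_derivative ?h' t) (at t)"
      using nz by (auto intro!: derivative_eq_intros d(1) simp: power2_eq_square)
    show "(?h' has_real_derivative hess_form (x + t *\<^sub>R u) u u - r\<^sup>2 / (1 - t * r) ^ 3) (at t)"
      using nz by (auto intro!: derivative_eq_intros d(2) simp: power2_eq_square power3_eq_cube)
    have "hess_form (x + t *\<^sub>R u) u u \<le> r\<^sup>2 / (1 - t * r)\<^sup>2"
      using t inside tr unfolding r_def by (intro hess_form_along_segment) auto
    also have "\<dots> \<le> r\<^sup>2 / (1 - t * r) ^ 3"
      using nz r t by (intro divide_left_mono power_decreasing mult_pos_pos) auto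
    finally show "hess_form (x + t *\<^sub>R u) u u - r\<^sup>2 / (1 - t * r) ^ 3 \<le> 0" by simp
  qed simp
  then have "B y \<le> B x + gradient B x \<bullet> u + (1 / (1 - r) - r - 1) / 2"
    by (simp add: y diff_divide_distrib)
  also have "(1 / (1 - r) - r - 1) / 2 = r\<^sup>2 / (2 * (1 - r))"
    using r by (simp add: field_simps power2_eq_square)
  finally show ?thesis
    by (simp add: r_def u_def)
qed

end

lemma matrix_inv_vector_mult:
  fixes M :: "real^'n^'n"
  assumes "\<And>v. M *v v = 0 \<Longrightarrow> v = 0"
  shows "M *v (matrix_inv M *v w) = w" "matrix_inv M *v (M *v w) = w"
proof -
  have "invertible M"
    using assms by (simp add: invertible_left_inverse matrix_left_invertible_ker)
  then have "M ** matrix_inv M = mat 1 \<and> matrix_inv M ** M = mat 1"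
    unfolding invertible_def matrix_inv_def by (rule someI_ex)
  then show "M *v (matrix_inv M *v w) = w" "matrix_inv M *v (M *v w) = w"
    by (simp_all add: matrix_vector_mul_assoc)
qed

lemma transpose_mult_inner:
  fixes M :: "real^'n^'m"
  shows "(transpose M *v y) \<bullet> v = y \<bullet> (M *v v)"
  by (metis dot_lmul_matrix transpose_matrix_vector)

context barrier_cone
begin

subsection \<open>Dual local norms\<close>

abbreviation dual_form :: "real^'n \<Rightarrow> real^'n \<Rightarrow> real^'n \<Rightarrow> real" where
  "dual_form x u v \<equiv> u \<bullet> (inv_hessian B x *v v)"

lemma hessian_inv_hessian:
  assumes "x \<in> interior K"
  shows "hessian B x *v (inv_hessian B x *v v) = v" "inv_hessian B x *v (hessian B x *v v) = v"
proof -
  have "v = 0" if "hessian B x *v v = 0" for v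
    using hess_form_pos[OF assms, of v] that by fastforce
  from matrix_inv_vector_mult[OF this]
  show "hessian B x *v (inv_hessian B x *v v) = v" "inv_hessian B x *v (hessian B x *v v) = v"
    by (simp_all add: inv_hessian_def)
qed

lemma dual_form_eq:
  assumes "x \<in> interior K"
  shows "dual_form x u v = hess_form x (inv_hessian B x *v u) (inv_hessian B x *v v)"
  using hess_form_sym[OF assms, of "inv_hessian B x *v u" "inv_hessian B x *v v"]
  by (simp add: hessian_inv_hessian[OF assms] inner_commute)

lemma dual_pos_def_form:
  assumes x: "x \<in> interior K"
  shows "pos_def_form (dual_form x)"
proof
  fix u v :: "real^'n"
  show "dual_form x u v = dual_form x v u"
    unfolding dual_form_eq[OF x] by (rule hess_form_sym[OF x])
  show "0 < dual_form x v v" if "v \<noteq> 0"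
  proof -
    have "inv_hessian B x *v v \<noteq> 0"
      using hessian_inv_hessian(1)[OF x, of v] that by auto
    then show ?thesis
      unfolding dual_form_eq[OF x] by (rule hess_form_pos[OF x])
  qed
qed (auto simp: inner_add_left)

lemma dual_norm_sq: "x \<in> interior K \<Longrightarrow> (dual_norm B x v)\<^sup>2 = dual_form x v v"
  unfolding dual_norm_def using pos_def_form.nonneg[OF dual_pos_def_form] by simp

lemma dual_norm_nonneg [simp]: "x \<in> interior K \<Longrightarrow> 0 \<le> dual_norm B x v"
  unfolding dual_norm_def using pos_def_form.nonneg[OF dual_pos_def_form] by simp

lemma local_norm_nonneg [simp]: "x \<in> interior K \<Longrightarrow> 0 \<le> local_norm B x v"
  by (simp add: local_norm_def hess_form_nonneg)

lemma dual_norm_triangle: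
  "x \<in> interior K \<Longrightarrow> dual_norm B x (u + v) \<le> dual_norm B x u + dual_norm B x v"
  unfolding dual_norm_def using pos_def_form.triangle[OF dual_pos_def_form] .

lemma dual_norm_scaleR: "dual_norm B x (c *\<^sub>R v) = \<bar>c\<bar> * dual_norm B x v"
  by (simp add: dual_norm_def matrix_vector_mult_scaleR real_sqrt_mult flip: mult.assoc)

lemma dual_norm_minus: "dual_norm B x (- v) = dual_norm B x v"
  using dual_norm_scaleR[of x "- 1" v] by simp

lemma dual_norm_zero [simp]: "dual_norm B x 0 = 0"
  using dual_norm_scaleR[of x 0 0] by simp

lemma dual_norm_triangle_diff:
  "x \<in> interior K \<Longrightarrow> dual_norm B x (u - v) \<le> dual_norm B x u + dual_norm B x v"
  using dual_norm_triangle[of x u "- v"] by (simp add: dual_norm_minus)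

lemma dual_norm_sum:
  assumes "x \<in> interior K"
  shows "dual_norm B x (\<Sum>i\<in>I. g i) \<le> (\<Sum>i\<in>I. dual_norm B x (g i))"
proof (induction I rule: infinite_finite_induct)
  case (insert i I)
  then show ?case
    using dual_norm_triangle[OF assms, of "g i" "sum g I"] by simp
qed simp_all

lemma local_norm_inv_hessian: "x \<in> interior K \<Longrightarrow> local_norm B x (inv_hessian B x *v v) = dual_norm B x v"
  by (simp add: local_norm_def dual_norm_def dual_form_eq)

lemma inner_le_dual_local:
  assumes x: "x \<in> interior K"
  shows "u \<bullet> v \<le> dual_norm B x u * local_norm B x v"
proof -
  interpret pos_def_form "hess_form x" by (rule pos_def_form[OF x])
  have "u \<bullet> v = hess_form x (inv_hessian B x *v u) v"
    using hess_form_sym[OF x, of "inv_hessian B x *v u" v]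
    by (simp add: hessian_inv_hessian[OF x] inner_commute)
  also have "\<dots> \<le> local_norm B x (inv_hessian B x *v u) * local_norm B x v"
    using Cauchy_Schwarz[of "inv_hessian B x *v u" v] by (simp add: local_norm_def)
  finally show ?thesis
    by (simp add: local_norm_inv_hessian[OF x])
qed

text \<open>Testing with the inverse Hessian applied to \<open>u\<close> gives the squared dual norm
  on the left and \<open>C\<close> times the dual norm on the right.\<close>

lemma dual_norm_leI:
  assumes x: "x \<in> interior K" and C: "0 \<le> C" "\<And>v. u \<bullet> v \<le> C * local_norm B x v"
  shows "dual_norm B x u \<le> C"
proof (cases "dual_norm B x u = 0")
  case False
  have "dual_norm B x u * dual_norm B x u \<le> C * dual_norm B x u"
    using C(2)[of "inv_hessian B x *v u"] dual_norm_sq[OF x, of u]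
    by (simp add: local_norm_inv_hessian[OF x] power2_eq_square)
  then show ?thesis
    using False dual_norm_nonneg[OF x, of u] by simp
qed (use C in simp)

lemma dual_norm_change:
  assumes x: "x \<in> interior K" and r: "local_norm B x (y - x) < 1"
  shows "dual_norm B x v \<le> dual_norm B y v / (1 - local_norm B x (y - x))"
    "dual_norm B y v \<le> dual_norm B x v / (1 - local_norm B x (y - x))"
proof -
  have y: "y \<in> interior K" using x r by (rule Dikin_ellipsoid)
  show "dual_norm B x v \<le> dual_norm B y v / (1 - local_norm B x (y - x))"
  proof (rule dual_norm_leI[OF x])
    fix w
    have "v \<bullet> w \<le> dual_norm B y v * local_norm B y w"
      by (rule inner_le_dual_local[OF y])
    also have "\<dots> \<le> dual_norm B y v * (local_norm B x w / (1 - local_norm B x (y - x)))"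
      by (intro mult_left_mono local_norm_change[OF x r]) (simp add: y)
    finally show "v \<bullet> w \<le> dual_norm B y v / (1 - local_norm B x (y - x)) * local_norm B x w"
      by simp
  qed (use r y in simp)
  show "dual_norm B y v \<le> dual_norm B x v / (1 - local_norm B x (y - x))"
  proof (rule dual_norm_leI[OF y])
    fix w
    have "v \<bullet> w \<le> dual_norm B x v * local_norm B x w"
      by (rule inner_le_dual_local[OF x])
    also have "\<dots> \<le> dual_norm B x v * (local_norm B y w / (1 - local_norm B x (y - x)))"
      using local_norm_change(2)[OF x r, of w] r
      by (intro mult_left_mono) (simp_all add: x pos_le_divide_eq mult.commute)
    finally show "v \<bullet> w \<le> dual_norm B x v / (1 - local_norm B x (y - x)) * local_norm B y w"
      by simp
  qed (use r x in simp)
qed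

text \<open>A real \<open>SUP\<close> bounds its family only if the family is bounded above, which
  is most of the work: every coordinate of a vector in the unit ball is at most the dual norm of the
  corresponding basis vector.\<close>

lemma dual_norm_matrix_mult:
  assumes x: "x \<in> interior K"
  shows "dual_norm B x (M *v v) \<le> dual_mat_norm B x M * local_norm B x v"
proof (cases "v = 0")
  case False
  let ?S = "{v. local_norm B x v \<le> 1}"
  let ?e = "\<lambda>i. axis i 1 :: real^'n"
  have "dual_norm B x (M *v v) \<le> (\<Sum>i\<in>UNIV. dual_norm B x (?e i) * dual_norm B x (M *v ?e i))"
    if "v \<in> ?S" for v
  proof -
    have "v = (\<Sum>i\<in>UNIV. v $ i *\<^sub>R ?e i)"
      by (simp add: vec_eq_iff axis_def if_distrib cong: if_cong)
    then have "M *v v = M *v (\<Sum>i\<in>UNIV. v $ i *\<^sub>R ?e i)" by simp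
    also have "\<dots> = (\<Sum>i\<in>UNIV. v $ i *\<^sub>R (M *v ?e i))"
      unfolding linear_sum[OF matrix_vector_mul_linear] by (simp add: matrix_vector_mult_scaleR)
    finally have "dual_norm B x (M *v v) \<le> (\<Sum>i\<in>UNIV. dual_norm B x (v $ i *\<^sub>R (M *v ?e i)))"
      using dual_norm_sum[OF x] by simp
    also have "\<dots> \<le> (\<Sum>i\<in>UNIV. dual_norm B x (?e i) * dual_norm B x (M *v ?e i))"
    proof (rule sum_mono)
      fix i
      have le: "u \<bullet> v \<le> dual_norm B x u" for u
        using inner_le_dual_local[OF x, of u v] that mult_left_mono[of "local_norm B x v" 1 "dual_norm B x u"]
        by (simp add: x)
      have "\<bar>v $ i\<bar> \<le> dual_norm B x (?e i)"
        using le[of "?e i"] le[of "- ?e i"] by (simp add: dual_norm_minus inner_axis')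
      then show "dual_norm B x (v $ i *\<^sub>R (M *v ?e i)) \<le> dual_norm B x (?e i) * dual_norm B x (M *v ?e i)"
        by (simp add: dual_norm_scaleR mult_right_mono x)
    qed
    finally show ?thesis .
  qed
  then have bdd: "bdd_above ((\<lambda>v. dual_norm B x (M *v v)) ` ?S)"
    by (rule bdd_aboveI2)
  define n where "n = local_norm B x v"
  have n: "n > 0"
    using False hess_form_pos[OF x] by (simp add: n_def local_norm_def)
  have "dual_norm B x (M *v ((1 / n) *\<^sub>R v)) \<le> dual_mat_norm B x M"
    unfolding dual_mat_norm_def using n
    by (intro cSUP_upper bdd) (simp add: local_norm_scaleR flip: n_def)
  then show ?thesis
    using n by (simp add: matrix_vector_mult_scaleR dual_norm_scaleR pos_divide_le_eq flip: n_def)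
qed (simp add: local_norm_def)

subsection \<open>The projected step\<close>

context
  fixes A :: "real^'n^'m" and x :: "real^'n"
  assumes rank: "rank A = CARD('m)" and x: "x \<in> interior K"
begin

text \<open>The quadratic form of this matrix at \<open>y\<close> is the squared dual norm of the
  transpose of \<open>A\<close> applied to \<open>y\<close>, and full row rank makes the transpose
  injective.\<close>

lemma normal_matrix_kernel:
  assumes "A ** inv_hessian B x ** transpose A *v y = 0"
  shows "y = 0"
proof -
  have "dual_form x (transpose A *v y) (transpose A *v y) = y \<bullet> (A ** inv_hessian B x ** transpose A *v y)"
    by (simp only: transpose_mult_inner matrix_vector_mul_assoc matrix_mul_assoc)
  then have "transpose A *v y = 0"
    using assms pos_def_form.eq_0_iff[OF dual_pos_def_form[OF x]] by simp
  moreover have "inj ((*v) (transpose A))"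
    using rank full_rank_injective[of "transpose A"] by (simp add: rank_transpose)
  ultimately show "y = 0"
    by (metis injD matrix_vector_mult_0_right)
qed

text \<open>The multiplier solves the normal equations, which keeps every step in the kernel of
  \<open>A\<close> and thus the iterates on the affine slice.\<close>

lemma step_dir_projected: "A *v (inv_hessian B x *v step_dir A B x m) = 0"
proof -
  let ?S = "A ** inv_hessian B x ** transpose A"
  have "A *v (inv_hessian B x *v step_dir A B x m) =
      (A ** inv_hessian B x) *v m + ?S *v multiplier A B x m"
    by (simp add: step_dir_def matrix_vector_right_distrib matrix_vector_mul_assoc matrix_mul_assoc
        del: transpose_matrix_vector)
  also have "?S *v multiplier A B x m = - (?S *v (matrix_inv ?S *v ((A ** inv_hessian B x) *v m)))"
    using linear_neg[OF matrix_vector_mul_linear[of ?S]] by (simp add: multiplier_def)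
  also have "\<dots> = - ((A ** inv_hessian B x) *v m)"
    using matrix_inv_vector_mult(1)[OF normal_matrix_kernel] by simp
  finally show ?thesis by simp
qed

text \<open>If the step direction vanishes, \<open>\<eta> / 0 = 0\<close> makes the step trivial and the three claims still hold; this is
  why all estimates below are valid on every sample path.\<close>

lemma sipm_step_props:
  fixes m :: "real^'n"
  assumes "0 \<le> \<eta>"
  defines "u \<equiv> sipm_step A B \<eta> x m - x"
  shows "A *v u = 0" "local_norm B x u \<le> \<eta>" "m \<bullet> u = - \<eta> * dual_norm B x (step_dir A B x m)"
proof -
  define d where "d = step_dir A B x m"
  define n where "n = dual_norm B x d"
  have u: "u = - (\<eta> / n) *\<^sub>R (inv_hessian B x *v d)"
    by (simp add: u_def sipm_step_def n_def d_def)
  have Au: "A *v u = 0"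
    unfolding u matrix_vector_mult_scaleR d_def step_dir_projected by simp
  then show "A *v u = 0" .
  have n: "0 \<le> n" by (simp add: n_def x)
  show "local_norm B x u \<le> \<eta>"
    unfolding u local_norm_scaleR local_norm_inv_hessian[OF x] n_def[symmetric]
    using assms(1) n by (cases "n = 0") auto
  \<comment> \<open>The multiplier part of \<open>d\<close> lies in the range of the transpose of
    \<open>A\<close> and is orthogonal to \<open>u\<close>.\<close>
  have "d \<bullet> u = m \<bullet> u"
    by (simp add: d_def step_dir_def inner_add_left transpose_mult_inner Au del: transpose_matrix_vector)
  moreover have "d \<bullet> u = - (\<eta> / n) * n\<^sup>2"
    by (simp add: u n_def dual_norm_sq[OF x])
  ultimately show "m \<bullet> u = - \<eta> * dual_norm B x (step_dir A B x m)"
    by (cases "n = 0") (auto simp: power2_eq_square simp flip: n_def d_def)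
qed

end

end

subsection \<open>One step of the method\<close>

text \<open>The Lipschitz constants are those at the single radius \<open>s\<close>; every
  displacement considered from here on has local length at most \<open>s\<close>.\<close>

locale sipm_problem = barrier_cone K \<theta> B
  for K :: "(real^'n) set" and \<theta> :: real and B :: "real^'n \<Rightarrow> real" +
  fixes A :: "real^'n^'m" and b :: "real^'m" and f :: "real^'n \<Rightarrow> real" and L1 L2 s :: real
  assumes full_row_rank: "rank A = CARD('m)"
    and s: "0 < s" "s < 1"
    and L1: "0 < L1"
    and L2: "0 < L2"
    and f_C2: "Ck_on 2 f (strictly_feasible K A b)"
    and gradient_Lipschitz: "\<And>x y. x \<in> strictly_feasible K A b \<Longrightarrow> y \<in> strictly_feasible K A b \<Longrightarrow>
      local_norm B x (y - x) \<le> s \<Longrightarrow>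
      dual_norm B x (gradient f y - gradient f x) \<le> L1 * local_norm B x (y - x)"
    and hessian_Lipschitz: "\<And>x y. x \<in> strictly_feasible K A b \<Longrightarrow> y \<in> strictly_feasible K A b \<Longrightarrow>
      local_norm B x (y - x) \<le> s \<Longrightarrow>
      dual_mat_norm B x (hessian f y - hessian f x) \<le> L2 * local_norm B x (y - x)"
begin

abbreviation F :: "(real^'n) set" where
  "F \<equiv> strictly_feasible K A b"

lemma F_interior: "x \<in> F \<Longrightarrow> x \<in> interior K"
  by (simp add: strictly_feasible_def)

lemma F_add:
  assumes "x \<in> F" "A *v u = 0" "local_norm B x u < 1"
  shows "x + u \<in> F"
  using assms Dikin_ellipsoid[of x "x + u"]
  by (simp add: strictly_feasible_def matrix_vector_right_distrib)

lemma F_segment: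
  assumes x: "x \<in> F" and y: "x + u \<in> F" and t: "0 \<le> t" "t \<le> 1"
  shows "x + t *\<^sub>R u \<in> F"
proof -
  have "convex (interior K)"
    using cone by (simp add: proper_cone_def)
  then have "(1 - t) *\<^sub>R x + t *\<^sub>R (x + u) \<in> interior K"
    using x y t by (intro convexD) (auto simp: strictly_feasible_def)
  moreover have "(1 - t) *\<^sub>R x + t *\<^sub>R (x + u) = x + t *\<^sub>R u"
    by (simp add: algebra_simps)
  moreover have "A *v u = 0"
    using x y by (simp add: strictly_feasible_def matrix_vector_right_distrib)
  ultimately show ?thesis
    using x by (simp add: strictly_feasible_def matrix_vector_right_distrib matrix_vector_mult_scaleR)
qed

text \<open>The slice \<open>F\<close> need not be open, so the gradient is identified with
  directional derivatives on the preimage of a neighbourhood \<open>U\<close> on which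
  \<open>f\<close> is twice continuously differentiable.\<close>

lemma f_line_derivs:
  assumes "x + t *\<^sub>R u \<in> F"
  shows "((\<lambda>t. f (x + t *\<^sub>R u)) has_real_derivative gradient f (x + t *\<^sub>R u) \<bullet> u) (at t)"
    "((\<lambda>t. gradient f (x + t *\<^sub>R u) \<bullet> w) has_real_derivative (hessian f (x + t *\<^sub>R u) *v u) \<bullet> w) (at t)"
proof -
  obtain U where U: "open U" "F \<subseteq> U" "Ck_open 2 f U"
    using f_C2 by (auto simp: Ck_on_def)
  let ?T = "(\<lambda>t. x + t *\<^sub>R u) -` U"
  have T: "open ?T" "t \<in> ?T" and xU: "x + t *\<^sub>R u \<in> U"
    using assms U by (auto intro!: open_vimage continuous_intros)
  note d = C2_differentiable[OF U(3,1)] and d' = C2_dir_deriv_differentiable[OF U(3,1) xU]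
  show "((\<lambda>t. f (x + t *\<^sub>R u)) has_real_derivative gradient f (x + t *\<^sub>R u) \<bullet> u) (at t)"
    using has_real_derivative_along_line[OF d[OF xU]] by (simp add: gradient_inner d[OF xU])
  have "((\<lambda>t. dir_deriv w f (x + t *\<^sub>R u)) has_real_derivative (hessian f (x + t *\<^sub>R u) *v u) \<bullet> w) (at t)"
    using has_real_derivative_along_line[OF d'] by (simp add: inner_hessian[OF U(3,1) xU] inner_commute)
  then show "((\<lambda>t. gradient f (x + t *\<^sub>R u) \<bullet> w) has_real_derivative (hessian f (x + t *\<^sub>R u) *v u) \<bullet> w) (at t)"
    by (rule has_field_derivative_transform_within_open[OF _ T]) (simp add: gradient_inner d)
qed

lemma f_differentiable: "x \<in> F \<Longrightarrow> f differentiable at x"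
  using f_C2 C2_differentiable unfolding Ck_on_def by blast

lemma gradient_f_continuous: "continuous_on F (gradient f)"
  using f_C2 gradient_continuous unfolding Ck_on_def by (meson continuous_on_subset)

lemma gradient_barrier_obj:
  assumes "x \<in> F"
  shows "gradient (barrier_obj f B \<mu>) x = gradient f x + \<mu> *\<^sub>R (gradient f x + gradient B x)"
proof (rule gradient_eqI)
  have "(f has_derivative (\<lambda>h. h \<bullet> gradient f x)) (at x)" "(B has_derivative (\<lambda>h. h \<bullet> gradient B x)) (at x)"
    using gradient_works[of f x] gradient_works[of B x] f_differentiable differentiable F_interior assms
    by (auto simp: gderiv_def)
  then show "(barrier_obj f B \<mu> has_derivative (\<lambda>h. h \<bullet> (gradient f x + \<mu> *\<^sub>R (gradient f x + gradient B x)))) (at x)"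
    unfolding barrier_obj_def[abs_def]
    by (auto intro!: derivative_eq_intros simp: inner_add_right algebra_simps)
qed

context
  fixes x u :: "real^'n"
  assumes x: "x \<in> F" and xu: "x + u \<in> F" and u: "local_norm B x u \<le> s"
begin

lemma segment_props:
  assumes "0 \<le> t" "t \<le> 1"
  shows "x + t *\<^sub>R u \<in> F" "local_norm B x (t *\<^sub>R u) = t * local_norm B x u"
    "local_norm B x (x + t *\<^sub>R u - x) \<le> s"
proof -
  show "x + t *\<^sub>R u \<in> F" by (rule F_segment[OF x xu assms])
  show *: "local_norm B x (t *\<^sub>R u) = t * local_norm B x u"
    using assms by (simp add: local_norm_scaleR)
  show "local_norm B x (x + t *\<^sub>R u - x) \<le> s"
    using mult_left_le_one_le[OF local_norm_nonneg[OF F_interior[OF x], of u] assms] u * by simp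
qed

lemma f_descent: "f (x + u) \<le> f x + gradient f x \<bullet> u + L1 / 2 * (local_norm B x u)\<^sup>2"
proof -
  let ?r = "local_norm B x u"
  let ?h = "\<lambda>t. f (x + t *\<^sub>R u) - t * (gradient f x \<bullet> u) - L1 / 2 * ?r\<^sup>2 * t\<^sup>2"
  have "?h 1 \<le> ?h 0"
  proof (rule DERIV_nonpos_imp_nonincreasing[where f = ?h])
    fix t :: real assume t: "0 \<le> t" "t \<le> 1"
    let ?D = "(gradient f (x + t *\<^sub>R u) - gradient f x) \<bullet> u - L1 * ?r\<^sup>2 * t"
    have "(?h has_real_derivative ?D) (at t)"
      by (auto intro!: derivative_eq_intros f_line_derivs segment_props t simp: inner_diff_left)
    moreover have "?D \<le> 0"
    proof -
      have "(gradient f (x + t *\<^sub>R u) - gradient f x) \<bullet> u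
          \<le> dual_norm B x (gradient f (x + t *\<^sub>R u) - gradient f x) * ?r"
        by (rule inner_le_dual_local[OF F_interior[OF x]])
      also have "\<dots> \<le> (L1 * (t * ?r)) * ?r"
        using gradient_Lipschitz[OF x segment_props(1,3)[OF t]] segment_props(2)[OF t] F_interior[OF x]
        by (intro mult_right_mono) auto
      finally show ?thesis by (simp add: power2_eq_square mult_ac)
    qed
    ultimately show "\<exists>y. (?h has_real_derivative y) (at t) \<and> y \<le> 0" by blast
  qed simp
  then show ?thesis by simp
qed

text \<open>By duality the remainder is tested against an arbitrary \<open>w\<close>, which leaves a
  real function of t; the Lipschitz bound on the Hessian makes its comparison with a parabola
  monotone.\<close>

lemma gradient_remainder:
  "dual_norm B x (gradient f (x + u) - gradient f x - hessian f x *v u) \<le> L2 / 2 * (local_norm B x u)\<^sup>2"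
proof (rule dual_norm_leI[OF F_interior[OF x]])
  fix w
  let ?r = "local_norm B x u" and ?w = "local_norm B x w"
  let ?h = "\<lambda>t. gradient f (x + t *\<^sub>R u) \<bullet> w - t * ((hessian f x *v u) \<bullet> w) - L2 / 2 * ?r\<^sup>2 * ?w * t\<^sup>2"
  have "?h 1 \<le> ?h 0"
  proof (rule DERIV_nonpos_imp_nonincreasing[where f = ?h])
    fix t :: real assume t: "0 \<le> t" "t \<le> 1"
    let ?M = "hessian f (x + t *\<^sub>R u) - hessian f x"
    let ?D = "(?M *v u) \<bullet> w - L2 * ?r\<^sup>2 * ?w * t"
    have "(?h has_real_derivative ?D) (at t)"
      by (auto intro!: derivative_eq_intros f_line_derivs segment_props t
          simp: inner_diff_left matrix_vector_mult_diff_rdistrib)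
    moreover have "?D \<le> 0"
    proof -
      have "(?M *v u) \<bullet> w \<le> dual_norm B x (?M *v u) * ?w"
        by (rule inner_le_dual_local[OF F_interior[OF x]])
      also have "\<dots> \<le> (dual_mat_norm B x ?M * ?r) * ?w"
        using F_interior[OF x] by (intro mult_right_mono dual_norm_matrix_mult) auto
      also have "\<dots> \<le> ((L2 * (t * ?r)) * ?r) * ?w"
        using hessian_Lipschitz[OF x segment_props(1,3)[OF t]] segment_props(2)[OF t] F_interior[OF x]
        by (intro mult_right_mono) auto
      finally show ?thesis by (simp add: power2_eq_square mult_ac)
    qed
    ultimately show "\<exists>y. (?h has_real_derivative y) (at t) \<and> y \<le> 0" by blast
  qed simp
  then show "(gradient f (x + u) - gradient f x - hessian f x *v u) \<bullet> w \<le> L2 / 2 * ?r\<^sup>2 * ?w"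
    by (simp add: inner_diff_left)
qed (use L2 in simp)

end

text \<open>As \<open>x + u = (1 - \<gamma>) x + \<gamma> z\<close> for the extrapolated point \<open>z\<close>, the terms of first order cancel.\<close>

lemma extrapolation_remainder:
  assumes x: "x \<in> F" and Au: "A *v u = 0" and u: "local_norm B x u \<le> \<eta>"
    and \<gamma>: "0 < \<gamma>" "\<gamma> \<le> 1" and \<eta>: "\<eta> / \<gamma> \<le> s"
  defines "z \<equiv> x + (1 / \<gamma>) *\<^sub>R u"
  shows "x + u \<in> F" "z \<in> F" "local_norm B x (z - x) \<le> \<eta> / \<gamma>"
    "dual_norm B x ((1 - \<gamma>) *\<^sub>R gradient f x + \<gamma> *\<^sub>R gradient f z - gradient f (x + u)) \<le> L2 * \<eta>\<^sup>2 / \<gamma>"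
proof -
  let ?r = "local_norm B x u" and ?v = "(1 / \<gamma>) *\<^sub>R u"
  note xi = F_interior[OF x]
  have r: "0 \<le> ?r" using xi by simp
  then have \<eta>0: "0 \<le> \<eta>" using u by simp
  have "\<eta> * \<gamma> \<le> \<eta> * 1" using \<gamma> \<eta>0 by (intro mult_left_mono) auto
  then have \<eta>\<gamma>: "\<eta> \<le> \<eta> / \<gamma>" using \<gamma> by (simp add: pos_le_divide_eq)
  have rv: "local_norm B x ?v = ?r / \<gamma>"
    using \<gamma> by (simp add: local_norm_scaleR)
  have rv': "?r / \<gamma> \<le> \<eta> / \<gamma>" using u \<gamma> by (simp add: divide_right_mono)
  have s1: "?r \<le> s" "local_norm B x ?v \<le> s"
    using u \<eta> \<eta>\<gamma> rv rv' by linarith+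
  show xu: "x + u \<in> F"
    using s1 s by (intro F_add x Au) simp
  show z: "z \<in> F"
    unfolding z_def using s1 s by (intro F_add x) (simp_all add: matrix_vector_mult_scaleR Au)
  show "local_norm B x (z - x) \<le> \<eta> / \<gamma>"
    using rv rv' by (simp add: z_def)
  let ?h = "\<lambda>v. gradient f (x + v) - gradient f x - hessian f x *v v"
  have eq: "(1 - \<gamma>) *\<^sub>R gradient f x + \<gamma> *\<^sub>R gradient f z - gradient f (x + u) = \<gamma> *\<^sub>R ?h ?v - ?h u"
    using \<gamma> by (simp add: z_def matrix_vector_mult_scaleR algebra_simps)
  have "dual_norm B x ((1 - \<gamma>) *\<^sub>R gradient f x + \<gamma> *\<^sub>R gradient f z - gradient f (x + u))
      \<le> \<gamma> * dual_norm B x (?h ?v) + dual_norm B x (?h u)"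
    unfolding eq
    using dual_norm_triangle_diff[OF xi, of "\<gamma> *\<^sub>R ?h ?v" "?h u"] \<gamma>
    unfolding dual_norm_scaleR by simp
  also have "\<dots> \<le> \<gamma> * (L2 / 2 * (?r / \<gamma>)\<^sup>2) + L2 / 2 * ?r\<^sup>2"
    using gradient_remainder[OF x, of ?v] gradient_remainder[OF x xu] s1 z \<gamma>
    by (intro add_mono mult_left_mono) (simp_all add: z_def rv)
  also have "\<dots> \<le> \<gamma> * (L2 / 2 * (\<eta> / \<gamma>)\<^sup>2) + L2 / 2 * \<eta>\<^sup>2"
    using L2 \<gamma> u r rv' by (intro add_mono mult_left_mono power_mono) auto
  \<comment> \<open>Each of the two terms is at most half of the right-hand side, the second one
    because \<gamma> \<le> 1.\<close>
  also have "\<dots> \<le> L2 * \<eta>\<^sup>2 / \<gamma>"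
  proof -
    have "L2 * \<eta>\<^sup>2 * \<gamma> \<le> L2 * \<eta>\<^sup>2 * 1"
      using L2 \<gamma> by (intro mult_left_mono) auto
    then have "L2 * \<eta>\<^sup>2 \<le> L2 * \<eta>\<^sup>2 / \<gamma>"
      using \<gamma> by (simp add: pos_le_divide_eq)
    then show ?thesis
      using \<gamma> by (simp add: power2_eq_square)
  qed
  finally show "dual_norm B x ((1 - \<gamma>) *\<^sub>R gradient f x + \<gamma> *\<^sub>R gradient f z - gradient f (x + u)) \<le> L2 * \<eta>\<^sup>2 / \<gamma>" .
qed

text \<open>The exact gradient differs from the estimate \<open>m\<close> by (1 + \<mu>) times the
  momentum error, and 1 + \<mu> \<le> 2. This difference is paid for twice, once in the directional
  derivative along the step and once in replacing the norm of the step direction by the stationarity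
  measure with the same multiplier; hence the factor 4.\<close>

lemma barrier_obj_descent:
  fixes mbar :: "real^'n"
  assumes x: "x \<in> F" and \<mu>: "0 \<le> \<mu>" "\<mu> \<le> 1" and \<eta>: "0 \<le> \<eta>" "\<eta> \<le> s"
  defines "m \<equiv> barrier_estimate B \<mu> x mbar"
  shows "barrier_obj f B \<mu> (sipm_step A B \<eta> x m) \<le> barrier_obj f B \<mu> x
    - \<eta> * dual_norm B x (gradient (barrier_obj f B \<mu>) x + transpose A *v multiplier A B x m)
    + 4 * \<eta> * dual_norm B x (mbar - gradient f x) + L_phi L1 s / 2 * \<eta>\<^sup>2"
proof -
  note xi = F_interior[OF x]
  define y where "y = sipm_step A B \<eta> x m"
  define u where "u = y - x"
  have y: "y = x + u" by (simp add: u_def)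
  define r where "r = local_norm B x u"
  define g where "g = gradient (barrier_obj f B \<mu>) x"
  define d where "d = step_dir A B x m"
  define e where "e = mbar - gradient f x"
  note step = sipm_step_props[OF full_row_rank xi \<eta>(1), of m, folded y_def, folded u_def]
  have r: "0 \<le> r" "r \<le> \<eta>" using step xi by (simp_all add: r_def)
  have xu: "x + u \<in> F"
    using step \<eta> s by (intro F_add x) simp_all
  have f: "f y \<le> f x + gradient f x \<bullet> u + L1 / 2 * r\<^sup>2"
    unfolding y r_def using f_descent[OF x xu] r \<eta> by (simp add: r_def)
  have B: "B y \<le> B x + gradient B x \<bullet> u + 1 / (2 * (1 - s)) * r\<^sup>2"
  proof -
    have "B y \<le> B x + gradient B x \<bullet> u + r\<^sup>2 / (2 * (1 - r))"
      using barrier_descent[OF xi, of y] r \<eta> s by (simp add: u_def r_def)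
    also have "r\<^sup>2 / (2 * (1 - r)) \<le> r\<^sup>2 / (2 * (1 - s))"
      using r \<eta> s by (intro divide_left_mono mult_pos_pos) auto
    finally show ?thesis by simp
  qed
  have g: "g = gradient f x + \<mu> *\<^sub>R (gradient f x + gradient B x)"
    unfolding g_def by (rule gradient_barrier_obj[OF x])
  have ge: "g - m = - ((1 + \<mu>) *\<^sub>R e)"
    by (simp add: g m_def barrier_estimate_def e_def algebra_simps)
  have ne: "0 \<le> dual_norm B x e" using xi by simp
  have e2: "(1 + \<mu>) * dual_norm B x e \<le> 2 * dual_norm B x e"
    using \<mu> ne by (intro mult_right_mono) auto
  have "g \<bullet> u = m \<bullet> u + (g - m) \<bullet> u" by (simp add: inner_diff_left)
  also have "(g - m) \<bullet> u \<le> dual_norm B x (g - m) * r"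
    unfolding r_def by (rule inner_le_dual_local[OF xi])
  also have "dual_norm B x (g - m) \<le> 2 * dual_norm B x e"
    unfolding ge dual_norm_minus dual_norm_scaleR using e2 \<mu> by simp
  also have "2 * dual_norm B x e * r \<le> 2 * dual_norm B x e * \<eta>"
    using r ne by (intro mult_left_mono) auto
  finally have gu: "g \<bullet> u \<le> - \<eta> * dual_norm B x d + 2 * dual_norm B x e * \<eta>"
    using r step(3) by (simp add: d_def mult_right_mono)
  have "g + transpose A *v multiplier A B x m = d + (g - m)"
    by (simp add: d_def step_dir_def)
  then have "dual_norm B x (g + transpose A *v multiplier A B x m) \<le> dual_norm B x d + 2 * dual_norm B x e"
    using dual_norm_triangle[OF xi, of d "g - m"] e2 \<mu> unfolding ge
    by (simp add: dual_norm_minus dual_norm_scaleR)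
  then have "\<eta> * dual_norm B x (g + transpose A *v multiplier A B x m) \<le> \<eta> * (dual_norm B x d + 2 * dual_norm B x e)"
    using \<eta>(1) by (rule mult_left_mono)
  with gu have gu': "g \<bullet> u \<le> - \<eta> * dual_norm B x (g + transpose A *v multiplier A B x m) + 4 * \<eta> * dual_norm B x e"
    by (simp add: algebra_simps)
  have "barrier_obj f B \<mu> y = (1 + \<mu>) * f y + \<mu> * B y"
    by (simp add: barrier_obj_def algebra_simps)
  also have "\<dots> \<le> (1 + \<mu>) * (f x + gradient f x \<bullet> u + L1 / 2 * r\<^sup>2)
      + \<mu> * (B x + gradient B x \<bullet> u + 1 / (2 * (1 - s)) * r\<^sup>2)"
    using f B \<mu> by (intro add_mono mult_left_mono) auto
  also have "\<dots> = barrier_obj f B \<mu> x + g \<bullet> u + ((1 + \<mu>) * (L1 / 2) + \<mu> * (1 / (2 * (1 - s)))) * r\<^sup>2"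
    by (simp add: barrier_obj_def g inner_add_left algebra_simps)
  also have "\<dots> \<le> barrier_obj f B \<mu> x + g \<bullet> u + L_phi L1 s / 2 * \<eta>\<^sup>2"
  proof -
    have "(1 + \<mu>) * (L1 / 2) \<le> 2 * (L1 / 2)" "\<mu> * (1 / (2 * (1 - s))) \<le> 1 * (1 / (2 * (1 - s)))"
      using \<mu> L1 s by (intro mult_right_mono; simp)+
    moreover have "L_phi L1 s / 2 = 2 * (L1 / 2) + 1 * (1 / (2 * (1 - s)))"
      using s by (simp add: L_phi_def field_simps)
    ultimately have "(1 + \<mu>) * (L1 / 2) + \<mu> * (1 / (2 * (1 - s))) \<le> L_phi L1 s / 2"
      by linarith
    moreover have "0 \<le> L_phi L1 s / 2" using L1 s by (simp add: L_phi_def)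
    ultimately show ?thesis
      using r by (intro add_left_mono mult_mono power_mono) auto
  qed
  finally show ?thesis
    using gu' unfolding y_def g_def e_def by linarith
qed

end

subsection \<open>Measurability of the iterates\<close>

lemma matrix_vector_mult_measurable:
  fixes M :: "'b \<Rightarrow> real^'n^'m"
  assumes "M \<in> borel_measurable N" "v \<in> borel_measurable N"
  shows "(\<lambda>w. M w *v v w) \<in> borel_measurable N"
proof (rule borel_measurable_continuous_Pair[OF assms, where H = "(*v)"])
  show "continuous_on UNIV (\<lambda>x. fst x *v snd x :: real^'m)"
    unfolding matrix_vector_mult_def by (intro continuous_intros)
qed

text \<open>By Cramer's rule the entries of the inverse are quotients of determinants, which are
  polynomials in the entries.\<close>

lemma matrix_inv_continuous:
  fixes M :: "'b::topological_space \<Rightarrow> real^'n^'n"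
  assumes M: "continuous_on S M" and inv: "\<And>x v. x \<in> S \<Longrightarrow> M x *v v = 0 \<Longrightarrow> v = 0"
  shows "continuous_on S (\<lambda>x. matrix_inv (M x))"
proof -
  let ?C = "\<lambda>x i j. det (\<chi> i' j'. if j' = i then axis j 1 $ i' else M x $ i' $ j') / det (M x)"
  have det: "det (M x) \<noteq> 0" if "x \<in> S" for x
    using inv[OF that] by (simp add: invertible_left_inverse matrix_left_invertible_ker flip: invertible_det_nz)
  have "matrix_inv (M x) = (\<chi> i j. ?C x i j)" if x: "x \<in> S" for x
  proof -
    have "matrix_inv (M x) *v axis j 1 = (\<chi> i. ?C x i j)" for j
      using cramer[OF det[OF x]] matrix_inv_vector_mult(1)[OF inv[OF x]] by blast
    then show ?thesis
      by (simp add: vec_eq_iff matrix_vector_mult_basis column_def)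
  qed
  moreover have "continuous_on S (\<lambda>x. (\<chi> i j. ?C x i j) :: real^'n^'n)"
  proof (intro continuous_on_vec_lambda continuous_on_divide)
    fix i j
    have "continuous_on S (\<lambda>x. if j' = i then axis j 1 $ i' else M x $ i' $ j')" for i' j'
      using M by (cases "j' = i") (auto intro!: continuous_intros)
    then show "continuous_on S (\<lambda>x. det (\<chi> i' j'. if j' = i then axis j 1 $ i' else M x $ i' $ j'))"
      unfolding det_def vec_lambda_beta by (intro continuous_intros)
    show "continuous_on S (\<lambda>x. det (M x))"
      unfolding det_def by (intro continuous_intros M)
  qed (use det in blast)
  ultimately show ?thesis
    by (subst continuous_on_cong[OF refl])
qed

lemma matrix_matrix_mult_continuous:
  fixes M :: "'b::topological_space \<Rightarrow> real^'n^'m" and N :: "'b \<Rightarrow> real^'k^'n"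
  assumes "continuous_on S M" "continuous_on S N"
  shows "continuous_on S (\<lambda>x. M x ** N x)"
  unfolding matrix_matrix_mult_def using assms by (intro continuous_intros)

context sipm_problem
begin

text \<open>The functions of interest are continuous on \<open>F\<close> alone, so the composition
  goes through the Borel sets restricted to \<open>F\<close>.\<close>

lemma measurable_comp_F:
  assumes "x \<in> borel_measurable M" "\<And>w. w \<in> space M \<Longrightarrow> x w \<in> F" "continuous_on F g"
  shows "(\<lambda>w. g (x w)) \<in> borel_measurable M"
  using measurable_compose[OF measurable_restrict_space2 borel_measurable_continuous_on_restrict[OF assms(3)]]
    assms(1,2) by blast

lemma inv_hessian_continuous: "continuous_on F (inv_hessian B)"
proof -
  have "continuous_on (interior K) (\<lambda>x. matrix_inv (hessian B x))"
  proof (rule matrix_inv_continuous)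
    show "continuous_on (interior K) (hessian B)"
      by (rule hessian_continuous[OF C2 open_interior])
    show "v = 0" if "x \<in> interior K" "hessian B x *v v = 0" for x v
      using hess_form_pos[OF that(1), of v] that by fastforce
  qed
  then show ?thesis
    by (simp add: inv_hessian_def[abs_def]) (auto elim: continuous_on_subset intro: F_interior)
qed

lemma gradient_B_continuous: "continuous_on F (gradient B)"
  using gradient_continuous[OF C2 open_interior] by (rule continuous_on_subset) (auto intro: F_interior)

context
  fixes M :: "'b measure" and x m :: "'b \<Rightarrow> real^'n"
  assumes x: "x \<in> borel_measurable M" "\<And>w. w \<in> space M \<Longrightarrow> x w \<in> F"
    and m: "m \<in> borel_measurable M"
begin

lemma dual_norm_measurable: "(\<lambda>w. dual_norm B (x w) (m w)) \<in> borel_measurable M"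
  unfolding dual_norm_def
  using matrix_vector_mult_measurable[OF measurable_comp_F[OF x inv_hessian_continuous] m] m by measurable

lemma barrier_estimate_measurable: "(\<lambda>w. barrier_estimate B \<mu> (x w) (m w)) \<in> borel_measurable M"
  unfolding barrier_estimate_def using m measurable_comp_F[OF x gradient_B_continuous] by measurable

lemma multiplier_measurable: "(\<lambda>w. multiplier A B (x w) (m w)) \<in> borel_measurable M"
proof -
  have "continuous_on F (\<lambda>x. A ** inv_hessian B x)"
    by (intro matrix_matrix_mult_continuous inv_hessian_continuous continuous_intros)
  moreover from this have "continuous_on F (\<lambda>x. matrix_inv (A ** inv_hessian B x ** transpose A))"
    by (rule matrix_inv_continuous[OF matrix_matrix_mult_continuous[OF _ continuous_on_const]])
      (rule normal_matrix_kernel[OF full_row_rank F_interior])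
  ultimately show ?thesis
    unfolding multiplier_def
    by (intro borel_measurable_uminus matrix_vector_mult_measurable m measurable_comp_F[OF x])
qed

lemma step_dir_measurable: "(\<lambda>w. step_dir A B (x w) (m w)) \<in> borel_measurable M"
  unfolding step_dir_def
  by (intro borel_measurable_add m matrix_vector_mult_measurable multiplier_measurable borel_measurable_const)

end

lemma sipm_step_measurable:
  assumes x: "x \<in> borel_measurable M" "\<And>w. w \<in> space M \<Longrightarrow> x w \<in> F" and m: "m \<in> borel_measurable M"
  shows "(\<lambda>w. sipm_step A B \<eta> (x w) (m w)) \<in> borel_measurable M"
proof -
  note d = step_dir_measurable[OF assms]
  note n = dual_norm_measurable[OF x d]
  note H = matrix_vector_mult_measurable[OF measurable_comp_F[OF x inv_hessian_continuous] d]
  show ?thesis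
    unfolding sipm_step_def using x(1) n H by measurable
qed

end

subsection \<open>The momentum estimate along a sample path\<close>

text \<open>With \<open>q = (1 - \<gamma>) / (1 - a \<gamma>)\<close> the left-hand side is at most \<open>(q e + (1 - q) r)\<^sup>2\<close> for a suitable \<open>r\<close>,
  so that convexity of the square applies.\<close>

lemma momentum_contraction:
  fixes \<gamma> a \<eta> e \<rho> c :: real
  assumes \<gamma>: "0 < \<gamma>" "\<gamma> \<le> 1" and a: "0 \<le> a" "a < 1" and \<eta>: "\<eta> \<le> a * \<gamma>"
    and e: "0 \<le> e" "0 \<le> \<rho>" and c: "0 \<le> c" "c \<le> (1 - \<gamma>) * e + \<rho>"
  shows "(c / (1 - \<eta>))\<^sup>2 \<le> (1 - \<gamma> * (1 - a)) * e\<^sup>2 + \<rho>\<^sup>2 / ((1 - a) ^ 3 * \<gamma>)"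
proof -
  have a\<gamma>: "a * \<gamma> \<le> a" using a \<gamma> by (simp add: mult_left_le)
  define g where "g = 1 - a * \<gamma>"
  have g: "0 < g" "1 - a \<le> g" using a\<gamma> a by (simp_all add: g_def)
  define q where "q = (1 - \<gamma>) / g"
  \<comment> \<open>The factor 1 / (1 - \<eta>) is bounded by 1 / g and absorbed into the two
    weights \<open>q\<close> and \<open>p = 1 - q\<close>; it reduces the contraction rate from
    \<gamma> to \<gamma> (1 - a).\<close>
  define p where "p = (1 - a) * \<gamma> / g"
  define r where "r = \<rho> / g"
  have p: "0 < p" using a \<gamma> g by (simp add: p_def)
  have pq: "p = 1 - q" using g by (simp add: p_def q_def g_def field_simps)
  have q: "0 \<le> q" using \<gamma> g by (simp add: q_def)
  have "c / (1 - \<eta>) \<le> ((1 - \<gamma>) * e + \<rho>) / g"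
    using c \<eta> g by (intro frac_le) (auto simp: g_def)
  then have "c / (1 - \<eta>) \<le> q * e + r"
    by (simp add: q_def r_def add_divide_distrib)
  then have "(c / (1 - \<eta>))\<^sup>2 \<le> (q * e + r)\<^sup>2"
    using c \<eta> g by (intro power_mono) (auto simp: g_def)
  also have "\<dots> \<le> q * e\<^sup>2 + r\<^sup>2 / p"
  proof -
    have "q * e\<^sup>2 + r\<^sup>2 / p - (q * e + r)\<^sup>2 = q / p * (p * e - r)\<^sup>2"
      using p unfolding pq by (simp add: field_simps power2_eq_square)
    moreover have "0 \<le> q / p * (p * e - r)\<^sup>2" using p q by simp
    ultimately show ?thesis by linarith
  qed
  also have "q * e\<^sup>2 \<le> (1 - \<gamma> * (1 - a)) * e\<^sup>2"
  proof (rule mult_right_mono)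
    have "0 \<le> a * \<gamma>\<^sup>2 * (1 - a)" using a \<gamma> by simp
    then have "1 - \<gamma> \<le> (1 - \<gamma> * (1 - a)) * g"
      by (simp add: g_def algebra_simps power2_eq_square)
    then show "q \<le> 1 - \<gamma> * (1 - a)"
      using g by (simp add: q_def pos_divide_le_eq)
  qed simp
  also have "r\<^sup>2 / p = \<rho>\<^sup>2 / (g * (1 - a) * \<gamma>)"
    using g a \<gamma> by (simp add: r_def p_def field_simps power2_eq_square)
  \<comment> \<open>Here g is bounded below by (1 - a)^2; this yields the cube that appears in
    \<open>M_em\<close>.\<close>
  also have "\<dots> \<le> \<rho>\<^sup>2 / ((1 - a) ^ 3 * \<gamma>)"
  proof (rule divide_left_mono)
    have "(1 - a) ^ 2 \<le> (1 - a) ^ 1" using a by (intro power_decreasing) auto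
    then have "(1 - a) ^ 2 * ((1 - a) * \<gamma>) \<le> g * ((1 - a) * \<gamma>)"
      using g a \<gamma> by (intro mult_right_mono) auto
    then show "(1 - a) ^ 3 * \<gamma> \<le> g * (1 - a) * \<gamma>"
      by (simp add: power2_eq_square power3_eq_cube mult_ac)
  qed (use g a \<gamma> in simp_all)
  finally show ?thesis by simp
qed

text \<open>The bound \<eta> k \<le> a \<gamma> k is what keeps the extrapolated points, at distance
  up to \<eta> k / \<gamma> k, inside the Dikin ellipsoid of radius \<open>a\<close>.\<close>

locale sipm_em = sipm_problem K \<theta> B A b f L1 L2 s
  for K :: "(real^'n) set" and \<theta> :: real and B :: "real^'n \<Rightarrow> real" and A :: "real^'n^'m"
    and b :: "real^'m" and f :: "real^'n \<Rightarrow> real" and L1 L2 s :: real +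
  fixes D :: "'s measure" and G :: "real^'n \<Rightarrow> 's \<Rightarrow> real^'n" and \<sigma> a \<phi>low :: real
    and x0 :: "real^'n" and \<eta> \<gamma> \<mu> :: "nat \<Rightarrow> real"
  assumes prob_D: "prob_space D"
    and G_measurable: "case_prod G \<in> borel_measurable (restrict_space borel F \<Otimes>\<^sub>M D)"
    and unbiased: "\<And>x. x \<in> F \<Longrightarrow> has_bochner_integral D (G x) (gradient f x)"
    and variance_integrable: "\<And>x. x \<in> F \<Longrightarrow> integrable D (\<lambda>t. (dual_norm B x (G x t - gradient f x))\<^sup>2)"
    and variance: "\<And>x. x \<in> F \<Longrightarrow> (\<integral>t. (dual_norm B x (G x t - gradient f x))\<^sup>2 \<partial>D) \<le> \<sigma>\<^sup>2"
    and x0: "x0 \<in> F"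
    and lower: "\<And>x m. x \<in> F \<Longrightarrow> 0 < m \<Longrightarrow> m \<le> 1 \<Longrightarrow> \<phi>low \<le> f x + m * B x"
    and a: "0 \<le> a" "a \<le> s"
    and \<gamma>: "\<And>k. 0 < \<gamma> k" "\<And>k. \<gamma> k \<le> 1"
    and \<eta>: "\<And>k. 0 < \<eta> k" "\<And>k. \<eta> k \<le> a * \<gamma> k"
    and \<mu>: "\<And>k. 0 < \<mu> k" "\<And>k. \<mu> k \<le> 1" "\<And>k. \<mu> (Suc k) \<le> \<mu> k"
begin

abbreviation X :: "(nat \<Rightarrow> 's) \<Rightarrow> nat \<Rightarrow> real^'n" where
  "X \<equiv> em_x A B G \<eta> \<gamma> \<mu> x0"

abbreviation mbar :: "(nat \<Rightarrow> 's) \<Rightarrow> nat \<Rightarrow> real^'n" where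
  "mbar \<equiv> em_mbar A B G \<eta> \<gamma> \<mu> x0"

text \<open>This is the extrapolated point with index k + 1. Based at \<open>X w k\<close>, it shows
  X w (k + 1) as the convex combination (1 - \<gamma>) X w k + \<gamma> Z w k.\<close>

definition Z :: "(nat \<Rightarrow> 's) \<Rightarrow> nat \<Rightarrow> real^'n" where
  "Z w k = X w k + (1 / \<gamma> k) *\<^sub>R (X w (Suc k) - X w k)"

definition err :: "(nat \<Rightarrow> 's) \<Rightarrow> nat \<Rightarrow> real^'n" where
  "err w k = mbar w k - gradient f (X w k)"

definition sqerr :: "(nat \<Rightarrow> 's) \<Rightarrow> nat \<Rightarrow> real" where
  "sqerr w k = (dual_norm B (X w k) (err w k))\<^sup>2"

text \<open>The error with index \<open>k + 1\<close> as a function of the fresh sample.\<close>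

definition next_err :: "(nat \<Rightarrow> 's) \<Rightarrow> nat \<Rightarrow> 's \<Rightarrow> real^'n" where
  "next_err w k t = (1 - \<gamma> k) *\<^sub>R mbar w k + \<gamma> k *\<^sub>R G (Z w k) t - gradient f (X w (Suc k))"

lemma a_less_1: "a < 1"
  using a s by simp

lemma \<eta>_le_a: "\<eta> k \<le> a"
  using \<eta>(2)[of k] mult_left_le[of "\<gamma> k" a] \<gamma>(2)[of k] a by linarith

lemma X_Suc: "X w (Suc k) = sipm_step A B (\<eta> k) (X w k) (barrier_estimate B (\<mu> k) (X w k) (mbar w k))"
  by (simp add: em_x_Suc em_m_def em_lambda_def sipm_step_def step_dir_def)

lemma mbar_Suc: "mbar w (Suc k) = (1 - \<gamma> k) *\<^sub>R mbar w k + \<gamma> k *\<^sub>R G (Z w k) (w (Suc k))"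
proof -
  have "((1 - \<gamma> k) / \<gamma> k) = 1 / \<gamma> k - 1" using \<gamma>(1)[of k] by (simp add: field_simps)
  then have "X w (Suc k) + ((1 - \<gamma> k) / \<gamma> k) *\<^sub>R (X w (Suc k) - X w k) = Z w k"
    by (simp add: Z_def scaleR_diff_left)
  then show ?thesis
    by (simp add: em_mbar_Suc)
qed

lemma err_Suc: "err w (Suc k) = next_err w k (w (Suc k))"
  by (simp add: err_def next_err_def mbar_Suc)

lemma step_props:
  assumes "X w k \<in> F"
  shows "X w (Suc k) \<in> F" "Z w k \<in> F" "local_norm B (X w k) (X w (Suc k) - X w k) \<le> \<eta> k"
    "local_norm B (X w k) (Z w k - X w k) \<le> a"
    "dual_norm B (X w k) ((1 - \<gamma> k) *\<^sub>R gradient f (X w k) + \<gamma> k *\<^sub>R gradient f (Z w k) - gradient f (X w (Suc k)))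
      \<le> L2 * (\<eta> k)\<^sup>2 / \<gamma> k"
proof -
  let ?u = "X w (Suc k) - X w k"
  have "A *v ?u = 0" and le: "local_norm B (X w k) ?u \<le> \<eta> k"
    using sipm_step_props[OF full_row_rank F_interior[OF assms], of "\<eta> k"] \<eta>(1)[of k]
    by (simp_all add: X_Suc)
  moreover have "\<eta> k / \<gamma> k \<le> a"
    using \<gamma>(1)[of k] \<eta>(2)[of k] by (simp add: pos_divide_le_eq)
  moreover from this have "\<eta> k / \<gamma> k \<le> s" using a by simp
  ultimately show "X w (Suc k) \<in> F" "Z w k \<in> F" "local_norm B (X w k) (X w (Suc k) - X w k) \<le> \<eta> k"
    "local_norm B (X w k) (Z w k - X w k) \<le> a"
    "dual_norm B (X w k) ((1 - \<gamma> k) *\<^sub>R gradient f (X w k) + \<gamma> k *\<^sub>R gradient f (Z w k) - gradient f (X w (Suc k)))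
      \<le> L2 * (\<eta> k)\<^sup>2 / \<gamma> k"
    using extrapolation_remainder[OF assms, of ?u "\<eta> k" "\<gamma> k"] \<gamma>[of k] unfolding Z_def by auto
qed

lemma X_in_F: "X w k \<in> F"
  by (induction k) (auto simp: em_x_0 x0 step_props)

lemmas X_interior = F_interior[OF X_in_F]

lemma Z_in_F: "Z w k \<in> F"
  using step_props(2)[OF X_in_F] .

lemma dual_norm_X_Z: "dual_norm B (X w k) v \<le> dual_norm B (Z w k) v / (1 - a)"
proof -
  have r: "local_norm B (X w k) (Z w k - X w k) \<le> a" by (rule step_props(4)[OF X_in_F])
  then have "dual_norm B (X w k) v \<le> dual_norm B (Z w k) v / (1 - local_norm B (X w k) (Z w k - X w k))"
    using a_less_1 by (intro dual_norm_change(1) X_interior) simp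
  also have "\<dots> \<le> dual_norm B (Z w k) v / (1 - a)"
    using r a_less_1 F_interior[OF Z_in_F] by (intro divide_left_mono mult_pos_pos) auto
  finally show ?thesis .
qed

lemma dual_norm_X_Suc: "dual_norm B (X w (Suc k)) v \<le> dual_norm B (X w k) v / (1 - \<eta> k)"
proof -
  have r: "local_norm B (X w k) (X w (Suc k) - X w k) \<le> \<eta> k" by (rule step_props(3)[OF X_in_F])
  then have "dual_norm B (X w (Suc k)) v \<le> dual_norm B (X w k) v / (1 - local_norm B (X w k) (X w (Suc k) - X w k))"
    using a_less_1 \<eta>_le_a[of k] by (intro dual_norm_change(2) X_interior) simp
  also have "\<dots> \<le> dual_norm B (X w k) v / (1 - \<eta> k)"
    using r a_less_1 \<eta>_le_a[of k] X_interior by (intro divide_left_mono mult_pos_pos) auto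
  finally show ?thesis .
qed

section \<open>One step of the error recursion for a fixed past\<close>

lemma continuous_dual_norm: "continuous_on UNIV (dual_norm B x)"
  unfolding dual_norm_def[abs_def] by (intro continuous_intros)

lemma square_integrable_dual_norm:
  assumes "N \<in> borel_measurable D" "integrable D (\<lambda>t. (dual_norm B z (N t))\<^sup>2)"
    and "\<And>v. dual_norm B x v \<le> c * dual_norm B z v" "x \<in> interior K"
  shows "integrable D (\<lambda>t. (dual_norm B x (N t))\<^sup>2)"
proof (rule Bochner_Integration.integrable_bound)
  show "integrable D (\<lambda>t. c\<^sup>2 * (dual_norm B z (N t))\<^sup>2)"
    using assms(2) by simp
  have "(\<lambda>t. dual_norm B x (N t)) \<in> borel_measurable D"
    by (rule borel_measurable_continuous_on[OF continuous_dual_norm assms(1)])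
  then show "(\<lambda>t. (dual_norm B x (N t))\<^sup>2) \<in> borel_measurable D" by measurable
  have "(dual_norm B x v)\<^sup>2 \<le> (c * dual_norm B z v)\<^sup>2" for v
    using assms(3,4) by (intro power_mono) auto
  then show "AE t in D. norm ((dual_norm B x (N t))\<^sup>2) \<le> norm (c\<^sup>2 * (dual_norm B z (N t))\<^sup>2)"
    by (simp add: power_mult_distrib)
qed

text \<open>The squared dual norm is a quadratic form, and its cross term is linear in the centred
  noise \<open>N\<close>, so it integrates to 0.\<close>

lemma bias_variance:
  assumes x: "x \<in> interior K" and N: "has_bochner_integral D N 0"
    and int: "integrable D (\<lambda>t. (dual_norm B x (N t))\<^sup>2)"
  shows "integrable D (\<lambda>t. (dual_norm B x (C + g *\<^sub>R N t))\<^sup>2)"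
    "(\<integral>t. (dual_norm B x (C + g *\<^sub>R N t))\<^sup>2 \<partial>D) = (dual_norm B x C)\<^sup>2 + g\<^sup>2 * (\<integral>t. (dual_norm B x (N t))\<^sup>2 \<partial>D)"
proof -
  interpret D: prob_space D by (rule prob_D)
  interpret pos_def_form "dual_form x" by (rule dual_pos_def_form[OF x])
  define c where "c = inv_hessian B x *v C"
  have eq: "(dual_norm B x (C + g *\<^sub>R N t))\<^sup>2 =
      (dual_norm B x C)\<^sup>2 + 2 * g * (N t \<bullet> c) + g\<^sup>2 * (dual_norm B x (N t))\<^sup>2" for t
    unfolding dual_norm_sq[OF x] c_def using symmetric[of C "N t"]
    by (simp add: power2_eq_square algebra_simps)
  have Ni: "integrable D N" "integral\<^sup>L D N = 0"
    using N by (auto simp: has_bochner_integral_iff)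
  then have i: "integrable D (\<lambda>t. N t \<bullet> c)" "(\<integral>t. N t \<bullet> c \<partial>D) = 0"
    by simp_all
  show "integrable D (\<lambda>t. (dual_norm B x (C + g *\<^sub>R N t))\<^sup>2)"
    unfolding eq using i int by simp
  show "(\<integral>t. (dual_norm B x (C + g *\<^sub>R N t))\<^sup>2 \<partial>D) = (dual_norm B x C)\<^sup>2 + g\<^sup>2 * (\<integral>t. (dual_norm B x (N t))\<^sup>2 \<partial>D)"
    unfolding eq using i int by (simp add: D.prob_space)
qed

text \<open>Bias and noise of one step. The bias carries the denominator of
  \<open>momentum_contraction\<close>; the fourth power in the noise comes from two changes of norm,
  from the extrapolated point to x(k) and from there to x(k+1), each of them squared.\<close>

definition recursion_const :: "nat \<Rightarrow> real" where
  "recursion_const k = (L2 * (\<eta> k)\<^sup>2 / \<gamma> k)\<^sup>2 / ((1 - a) ^ 3 * \<gamma> k) + (\<gamma> k)\<^sup>2 * \<sigma>\<^sup>2 / (1 - a) ^ 4"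

lemma noise_centered:
  assumes "z \<in> F"
  shows "has_bochner_integral D (\<lambda>t. G z t - gradient f z) 0"
proof -
  interpret D: prob_space D by (rule prob_D)
  show ?thesis
    using unbiased[OF assms] by (simp add: has_bochner_integral_iff D.prob_space)
qed

text \<open>With the past fixed, the fresh sample is the only randomness: the new error is a
  deterministic part \<open>C\<close> plus \<gamma> times centred noise. \<open>C\<close> is
  contracted by \<open>momentum_contraction\<close>, and the variance, known in the norm at
  \<open>Z w k\<close>, is carried over to the other two norms.\<close>

lemma next_err_bound:
  "integrable D (\<lambda>t. (dual_norm B (X w (Suc k)) (next_err w k t))\<^sup>2)"
  "(\<integral>t. (dual_norm B (X w (Suc k)) (next_err w k t))\<^sup>2 \<partial>D)
    \<le> (1 - \<gamma> k * (1 - a)) * sqerr w k + recursion_const k"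
proof -
  interpret D: prob_space D by (rule prob_D)
  let ?x = "X w k" and ?y = "X w (Suc k)" and ?z = "Z w k" and ?g = "\<gamma> k"
  define N where "N t = G ?z t - gradient f ?z" for t
  define C where "C = (1 - ?g) *\<^sub>R mbar w k + ?g *\<^sub>R gradient f ?z - gradient f ?y"
  have eq: "next_err w k t = C + ?g *\<^sub>R N t" for t
    by (simp add: next_err_def C_def N_def algebra_simps)
  have N: "has_bochner_integral D N 0"
    unfolding N_def[abs_def] by (rule noise_centered[OF Z_in_F])
  then have Nm: "N \<in> borel_measurable D"
    by (auto simp: has_bochner_integral_iff)
  have Nz: "integrable D (\<lambda>t. (dual_norm B ?z (N t))\<^sup>2)" "(\<integral>t. (dual_norm B ?z (N t))\<^sup>2 \<partial>D) \<le> \<sigma>\<^sup>2"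
    unfolding N_def using variance_integrable variance Z_in_F by blast+
  have Nx: "integrable D (\<lambda>t. (dual_norm B ?x (N t))\<^sup>2)"
    using dual_norm_X_Z[of w k] by (intro square_integrable_dual_norm[OF Nm Nz(1), where c = "1 / (1 - a)"]) (auto simp: X_interior)
  have Ny: "integrable D (\<lambda>t. (dual_norm B ?y (N t))\<^sup>2)"
    using dual_norm_X_Suc[of w k] by (intro square_integrable_dual_norm[OF Nm Nx, where c = "1 / (1 - \<eta> k)"]) (auto simp: X_interior)
  show int: "integrable D (\<lambda>t. (dual_norm B ?y (next_err w k t))\<^sup>2)"
    unfolding eq by (rule bias_variance[OF X_interior N Ny])
  have a': "0 < 1 - a" using a_less_1 by simp
  have \<eta>': "1 - a \<le> 1 - \<eta> k" using \<eta>_le_a by simp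
  have "(\<integral>t. (dual_norm B ?y (next_err w k t))\<^sup>2 \<partial>D)
      \<le> (\<integral>t. (dual_norm B ?x (next_err w k t))\<^sup>2 / (1 - \<eta> k)\<^sup>2 \<partial>D)"
  proof (rule integral_mono[OF int])
    show "integrable D (\<lambda>t. (dual_norm B ?x (next_err w k t))\<^sup>2 / (1 - \<eta> k)\<^sup>2)"
      unfolding eq using bias_variance(1)[OF X_interior N Nx] by simp
    show "(dual_norm B ?y (next_err w k t))\<^sup>2 \<le> (dual_norm B ?x (next_err w k t))\<^sup>2 / (1 - \<eta> k)\<^sup>2" for t
      using dual_norm_X_Suc[of w k] X_interior by (simp add: power_mono flip: power_divide)
  qed
  also have "\<dots> = (dual_norm B ?x C / (1 - \<eta> k))\<^sup>2 + ?g\<^sup>2 * (\<integral>t. (dual_norm B ?x (N t))\<^sup>2 \<partial>D) / (1 - \<eta> k)\<^sup>2"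
    unfolding eq by (simp add: bias_variance(2)[OF X_interior N Nx] power_divide add_divide_distrib)
  also have "(dual_norm B ?x C / (1 - \<eta> k))\<^sup>2 \<le>
      (1 - ?g * (1 - a)) * sqerr w k + (L2 * (\<eta> k)\<^sup>2 / ?g)\<^sup>2 / ((1 - a) ^ 3 * ?g)"
    unfolding sqerr_def
  proof (rule momentum_contraction)
    let ?R = "(1 - ?g) *\<^sub>R gradient f ?x + ?g *\<^sub>R gradient f ?z - gradient f ?y"
    have "C = (1 - ?g) *\<^sub>R err w k + ?R"
      by (simp add: C_def err_def algebra_simps)
    then show "dual_norm B ?x C \<le> (1 - ?g) * dual_norm B ?x (err w k) + L2 * (\<eta> k)\<^sup>2 / ?g"
      using dual_norm_triangle[OF X_interior, of w k "(1 - ?g) *\<^sub>R err w k" ?R] step_props(5)[OF X_in_F, of w k] \<gamma>[of k]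
      by (simp add: dual_norm_scaleR)
  qed (use \<gamma> a a_less_1 \<eta> L2 X_interior in \<open>auto simp: less_imp_le\<close>)
  also have "?g\<^sup>2 * (\<integral>t. (dual_norm B ?x (N t))\<^sup>2 \<partial>D) / (1 - \<eta> k)\<^sup>2 \<le> ?g\<^sup>2 * \<sigma>\<^sup>2 / (1 - a) ^ 4"
  proof -
    have "(\<integral>t. (dual_norm B ?x (N t))\<^sup>2 \<partial>D) \<le> (\<integral>t. (dual_norm B ?z (N t))\<^sup>2 / (1 - a)\<^sup>2 \<partial>D)"
    proof (rule integral_mono[OF Nx])
      show "integrable D (\<lambda>t. (dual_norm B ?z (N t))\<^sup>2 / (1 - a)\<^sup>2)" using Nz by simp
      show "(dual_norm B ?x (N t))\<^sup>2 \<le> (dual_norm B ?z (N t))\<^sup>2 / (1 - a)\<^sup>2" for t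
        using dual_norm_X_Z[of w k] X_interior by (simp add: power_mono flip: power_divide)
    qed
    also have "\<dots> \<le> \<sigma>\<^sup>2 / (1 - a)\<^sup>2"
      using Nz by (simp add: divide_right_mono)
    finally have "(\<integral>t. (dual_norm B ?x (N t))\<^sup>2 \<partial>D) / (1 - \<eta> k)\<^sup>2 \<le> (\<sigma>\<^sup>2 / (1 - a)\<^sup>2) / (1 - a)\<^sup>2"
      using a' \<eta>' by (intro frac_le power_mono) auto
    then have "?g\<^sup>2 * ((\<integral>t. (dual_norm B ?x (N t))\<^sup>2 \<partial>D) / (1 - \<eta> k)\<^sup>2) \<le> ?g\<^sup>2 * ((\<sigma>\<^sup>2 / (1 - a)\<^sup>2) / (1 - a)\<^sup>2)"
      by (rule mult_left_mono) simp
    then show ?thesis by (simp flip: power_add)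
  qed
  finally show "(\<integral>t. (dual_norm B ?y (next_err w k t))\<^sup>2 \<partial>D)
      \<le> (1 - ?g * (1 - a)) * sqerr w k + recursion_const k"
    by (simp add: recursion_const_def)
qed

section \<open>Measurability of the iterates and their dependence on past samples\<close>

lemma G_comp_measurable:
  assumes "z \<in> borel_measurable M" "\<And>w. w \<in> space M \<Longrightarrow> z w \<in> F" "t \<in> M \<rightarrow>\<^sub>M D"
  shows "(\<lambda>w. G (z w) (t w)) \<in> borel_measurable M"
proof -
  have "(\<lambda>w. (z w, t w)) \<in> M \<rightarrow>\<^sub>M restrict_space borel F \<Otimes>\<^sub>M D"
    using assms by (intro measurable_Pair measurable_restrict_space2) auto
  from measurable_compose[OF this G_measurable] show ?thesis by simp
qed

text \<open>The path is an arbitrary family \<open>W\<close> because it is used on the probability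
  space, on infinite sequences, and on finite prefixes paired with a fresh sample. The iterate with
  index k uses the samples below k, the momentum also sample k; hence the joint induction.\<close>

lemma iterates_measurable:
  "(\<And>j. j < k \<Longrightarrow> (\<lambda>w. W w j) \<in> M \<rightarrow>\<^sub>M D) \<Longrightarrow> (\<lambda>w. X (W w) k) \<in> borel_measurable M"
  "(\<And>j. j \<le> k \<Longrightarrow> (\<lambda>w. W w j) \<in> M \<rightarrow>\<^sub>M D) \<Longrightarrow> (\<lambda>w. mbar (W w) k) \<in> borel_measurable M"
proof (induction k)
  case 0
  {
    case 1
    show ?case by (simp add: em_x_0)
  next
    case 2
    show ?case
      unfolding em_mbar_0 by (intro G_comp_measurable) (use 2 x0 in auto)
  }
next
  case (Suc k)
  {
    case 1
    then have "(\<lambda>w. X (W w) k) \<in> borel_measurable M" "(\<lambda>w. mbar (W w) k) \<in> borel_measurable M"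
      by (auto intro!: Suc.IH)
    then show ?case
      unfolding X_Suc by (intro sipm_step_measurable barrier_estimate_measurable) (auto simp: X_in_F)
  next
    case 2
    have [measurable]: "(\<lambda>w. X (W w) k) \<in> borel_measurable M" "(\<lambda>w. mbar (W w) k) \<in> borel_measurable M"
      using 2 by (auto intro!: Suc.IH)
    then have [measurable]: "(\<lambda>w. X (W w) (Suc k)) \<in> borel_measurable M"
      unfolding X_Suc by (intro sipm_step_measurable barrier_estimate_measurable) (auto simp: X_in_F)
    have "(\<lambda>w. Z (W w) k) \<in> borel_measurable M"
      unfolding Z_def by measurable
    then have [measurable]: "(\<lambda>w. G (Z (W w) k) (W w (Suc k))) \<in> borel_measurable M"
      using 2 by (intro G_comp_measurable) (auto simp: Z_in_F)
    show ?case
      unfolding mbar_Suc by measurable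
  }
qed

lemma gradient_X_measurable:
  "(\<And>j. j < k \<Longrightarrow> (\<lambda>w. W w j) \<in> M \<rightarrow>\<^sub>M D) \<Longrightarrow> (\<lambda>w. gradient f (X (W w) k)) \<in> borel_measurable M"
  by (rule measurable_comp_F[OF iterates_measurable(1) X_in_F gradient_f_continuous])

lemma sqerr_measurable:
  assumes "\<And>j. j \<le> k \<Longrightarrow> (\<lambda>w. W w j) \<in> M \<rightarrow>\<^sub>M D"
  shows "(\<lambda>w. sqerr (W w) k) \<in> borel_measurable M"
proof -
  have "(\<lambda>w. dual_norm B (X (W w) k) (err (W w) k)) \<in> borel_measurable M"
    unfolding err_def using assms
    by (intro dual_norm_measurable iterates_measurable borel_measurable_diff gradient_X_measurable)
      (auto simp: X_in_F)
  then show ?thesis unfolding sqerr_def by measurable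
qed

text \<open>Allows a path to be replaced by its finite prefix, the form in which the past is
  independent of the next sample.\<close>

lemma iterates_cong:
  assumes "\<And>j. j < k \<Longrightarrow> w j = w' j"
  shows "em_state A B G \<eta> \<gamma> \<mu> x0 w k = em_state A B G \<eta> \<gamma> \<mu> x0 w' k"
  using assms by (induction k) (auto simp: Let_def split: prod.split)

end

section \<open>Summed descent of the barrier objective along a sample path\<close>

context sipm_em
begin

definition stationarity :: "(nat \<Rightarrow> 's) \<Rightarrow> nat \<Rightarrow> real" where
  "stationarity w k = dual_norm B (X w k)
    (gradient (barrier_obj f B (\<mu> k)) (X w k) + transpose A *v em_lambda A B G \<eta> \<gamma> \<mu> x0 w k)"

lemma stationarity_nonneg: "0 \<le> stationarity w k"
  by (simp add: stationarity_def X_interior)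

lemma stationarity_measurable:
  assumes "\<And>j. j \<le> k \<Longrightarrow> (\<lambda>w. W w j) \<in> M \<rightarrow>\<^sub>M D"
  shows "(\<lambda>w. stationarity (W w) k) \<in> borel_measurable M"
proof -
  have X: "(\<lambda>w. X (W w) k) \<in> borel_measurable M" and m: "(\<lambda>w. mbar (W w) k) \<in> borel_measurable M"
    using assms by (auto intro!: iterates_measurable)
  have est: "(\<lambda>w. barrier_estimate B (\<mu> k) (X (W w) k) (mbar (W w) k)) \<in> borel_measurable M"
    by (intro barrier_estimate_measurable X m X_in_F)
  have "(\<lambda>w. transpose A *v em_lambda A B G \<eta> \<gamma> \<mu> x0 (W w) k) \<in> borel_measurable M"
    unfolding em_lambda_def em_m_def
    by (intro matrix_vector_mult_measurable borel_measurable_const multiplier_measurable X X_in_F est)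
  moreover have "(\<lambda>w. gradient f (X (W w) k)) \<in> borel_measurable M" "(\<lambda>w. gradient B (X (W w) k)) \<in> borel_measurable M"
    using measurable_comp_F[OF X X_in_F gradient_f_continuous] measurable_comp_F[OF X X_in_F gradient_B_continuous] by auto
  ultimately show ?thesis
    unfolding stationarity_def gradient_barrier_obj[OF X_in_F]
    by (intro dual_norm_measurable X X_in_F borel_measurable_add borel_measurable_scaleR borel_measurable_const)
qed

text \<open>Lowering the barrier parameter changes the objective by its decrement times f + B, and f
  + B is bounded below by the assumption at parameter 1. These costs telescope.\<close>

lemma potential_descent:
  "barrier_obj f B (\<mu> n) (X w n) + (\<Sum>k<n. \<eta> k * stationarity w k) \<le> barrier_obj f B (\<mu> 0) x0
    - (\<mu> 0 - \<mu> n) * min \<phi>low 0 + (\<Sum>k<n. 4 * \<eta> k * dual_norm B (X w k) (err w k) + L_phi L1 s / 2 * (\<eta> k)\<^sup>2)"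
proof (induction n)
  case 0
  then show ?case by (simp add: em_x_0)
next
  case (Suc n)
  let ?x = "X w n" and ?y = "X w (Suc n)"
  have "\<eta> n \<le> s" using \<eta>_le_a[of n] a by simp
  then have "barrier_obj f B (\<mu> n) ?y \<le> barrier_obj f B (\<mu> n) ?x - \<eta> n * stationarity w n
      + 4 * \<eta> n * dual_norm B ?x (err w n) + L_phi L1 s / 2 * (\<eta> n)\<^sup>2"
    unfolding stationarity_def err_def em_lambda_def em_m_def X_Suc using \<mu>[of n] \<eta>(1)[of n]
    by (intro barrier_obj_descent X_in_F) auto
  moreover have "barrier_obj f B (\<mu> (Suc n)) ?y = barrier_obj f B (\<mu> n) ?y - (\<mu> n - \<mu> (Suc n)) * (f ?y + B ?y)"
    by (simp add: barrier_obj_def algebra_simps)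
  moreover have "(\<mu> n - \<mu> (Suc n)) * min \<phi>low 0 \<le> (\<mu> n - \<mu> (Suc n)) * (f ?y + B ?y)"
    using lower[OF X_in_F, of 1 w "Suc n"] \<mu>(3)[of n] by (intro mult_left_mono) auto
  moreover have "(\<mu> 0 - \<mu> (Suc n)) * min \<phi>low 0 = (\<mu> 0 - \<mu> n) * min \<phi>low 0 + (\<mu> n - \<mu> (Suc n)) * min \<phi>low 0"
    by (simp add: algebra_simps)
  ultimately show ?case
    using Suc.IH by simp
qed

text \<open>The final objective is (1 + \<mu>) (f + \<mu> / (1 + \<mu>) B), so its lower bound is
  the assumption at the parameter \<mu> / (1 + \<mu>). Together with the telescoped costs this
  amounts to 1 + \<mu> 0 \<le> 2 copies of \<open>min \<phi>low 0\<close>, the coefficient in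
  \<open>Delta\<close>.\<close>

lemma sum_stationarity:
  "(\<Sum>k<n. \<eta> k * stationarity w k) \<le> Delta f B \<phi>low x0
    + (\<Sum>k<n. 4 * \<eta> k * dual_norm B (X w k) (err w k) + L_phi L1 s / 2 * (\<eta> k)\<^sup>2)"
proof -
  let ?l = "min \<phi>low 0" and ?x = "X w n"
  have "(1 + \<mu> n) * \<phi>low \<le> (1 + \<mu> n) * (f ?x + \<mu> n / (1 + \<mu> n) * B ?x)"
    using \<mu>[of n] by (intro mult_left_mono lower X_in_F) auto
  also have "\<dots> = barrier_obj f B (\<mu> n) ?x"
    using \<mu>(1)[of n] by (simp add: barrier_obj_def field_simps)
  finally have "(1 + \<mu> n) * \<phi>low \<le> barrier_obj f B (\<mu> n) ?x" .
  moreover have "(1 + \<mu> n) * ?l \<le> (1 + \<mu> n) * \<phi>low"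
    using \<mu>(1)[of n] by (intro mult_left_mono) auto
  moreover have "(1 + \<mu> 0) * ?l \<ge> 2 * ?l"
    using \<mu>(2)[of 0] by (intro mult_right_mono_neg) auto
  moreover have "barrier_obj f B (\<mu> 0) x0 \<le> f x0 + max (f x0 + B x0) 0"
  proof -
    have "\<mu> 0 * (f x0 + B x0) \<le> \<mu> 0 * max (f x0 + B x0) 0"
      using \<mu>(1)[of 0] by (intro mult_left_mono) auto
    also have "\<dots> \<le> 1 * max (f x0 + B x0) 0"
      using \<mu>(2)[of 0] by (intro mult_right_mono) auto
    finally show ?thesis by (simp add: barrier_obj_def)
  qed
  moreover have "(\<mu> 0 - \<mu> n) * ?l + (1 + \<mu> n) * ?l = (1 + \<mu> 0) * ?l"
    by (simp add: algebra_simps)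
  ultimately show ?thesis
    using potential_descent[of n w] unfolding Delta_def by linarith
qed

end

subsection \<open>Expectations\<close>

text \<open>The prefix and the next sample have a product joint law, so this is Fubini. With
  nonnegative integrals it can establish integrability as well as bounds. The singleton product
  stems from independence of two restrictions of the family, and \<open>last\<close> turns it into
  \<open>D\<close>.\<close>

lemma (in prob_space) nn_integral_fresh_sample:
  fixes \<xi> :: "nat \<Rightarrow> 'a \<Rightarrow> 's"
  assumes indep: "indep_vars (\<lambda>_. D) \<xi> UNIV" and law: "distr M D (\<xi> k) = D"
    and \<Phi>: "case_prod \<Phi> \<in> borel_measurable (PiM {..<k} (\<lambda>_. D) \<Otimes>\<^sub>M D)"
  shows "(\<integral>\<^sup>+\<omega>. \<Phi> (\<lambda>j\<in>{..<k}. \<xi> j \<omega>) (\<xi> k \<omega>) \<partial>M) = (\<integral>\<^sup>+\<omega>. (\<integral>\<^sup>+t. \<Phi> (\<lambda>j\<in>{..<k}. \<xi> j \<omega>) t \<partial>D) \<partial>M)"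
proof -
  let ?Y = "\<lambda>\<omega>. \<lambda>j\<in>{..<k}. \<xi> j \<omega>" and ?S = "PiM {..<k} (\<lambda>_. D)" and ?T = "PiM {k} (\<lambda>_. D)"
  have \<xi>: "\<xi> k \<in> M \<rightarrow>\<^sub>M D"
    using indep by (auto simp: indep_vars_def)
  have "indep_var ?S ?Y (PiM {k} (\<lambda>_. D)) (\<lambda>\<omega>. \<lambda>j\<in>{k}. \<xi> j \<omega>)"
    by (rule indep_var_restrict[OF indep]) auto
  then have Y: "?Y \<in> M \<rightarrow>\<^sub>M ?S" and T: "(\<lambda>\<omega>. \<lambda>j\<in>{k}. \<xi> j \<omega>) \<in> M \<rightarrow>\<^sub>M ?T"
    and joint: "distr M ?S ?Y \<Otimes>\<^sub>M distr M ?T (\<lambda>\<omega>. \<lambda>j\<in>{k}. \<xi> j \<omega>) =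
      distr M (?S \<Otimes>\<^sub>M ?T) (\<lambda>\<omega>. (?Y \<omega>, \<lambda>j\<in>{k}. \<xi> j \<omega>))" (is "_ \<Otimes>\<^sub>M ?L = _")
    unfolding indep_var_distribution_eq by auto
  interpret L: prob_space ?L
    using T by (rule prob_space_distr)
  have last: "(\<integral>\<^sup>+g. \<Phi> y (g k) \<partial>?L) = (\<integral>\<^sup>+t. \<Phi> y t \<partial>D)" if y: "y \<in> space ?S" for y
  proof -
    have [measurable]: "\<Phi> y \<in> borel_measurable D"
      using measurable_compose[OF measurable_Pair1'[OF y] \<Phi>] by simp
    have "(\<integral>\<^sup>+g. \<Phi> y (g k) \<partial>?L) = (\<integral>\<^sup>+\<omega>. \<Phi> y (\<xi> k \<omega>) \<partial>M)"
      using T by (subst nn_integral_distr) auto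
    also have "\<dots> = (\<integral>\<^sup>+t. \<Phi> y t \<partial>distr M D (\<xi> k))"
      using \<xi> by (subst nn_integral_distr) auto
    finally show ?thesis by (simp add: law)
  qed
  have m: "(\<lambda>p. \<Phi> (fst p) (snd p k)) \<in> borel_measurable (?S \<Otimes>\<^sub>M ?T)"
  proof -
    have "(\<lambda>p. (fst p, snd p k)) \<in> ?S \<Otimes>\<^sub>M ?T \<rightarrow>\<^sub>M ?S \<Otimes>\<^sub>M D" by measurable
    from measurable_compose[OF this \<Phi>] show ?thesis by simp
  qed
  have "(\<integral>\<^sup>+\<omega>. \<Phi> (?Y \<omega>) (\<xi> k \<omega>) \<partial>M) = (\<integral>\<^sup>+p. \<Phi> (fst p) (snd p k)
      \<partial>distr M (?S \<Otimes>\<^sub>M ?T) (\<lambda>\<omega>. (?Y \<omega>, \<lambda>j\<in>{k}. \<xi> j \<omega>)))"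
    using Y T m by (subst nn_integral_distr) (auto intro: measurable_Pair)
  also have "\<dots> = (\<integral>\<^sup>+y. (\<integral>\<^sup>+g. \<Phi> y (g k) \<partial>?L) \<partial>distr M ?S ?Y)"
  proof -
    have "(\<lambda>p. \<Phi> (fst p) (snd p k)) \<in> borel_measurable (distr M ?S ?Y \<Otimes>\<^sub>M ?L)"
      using m by (simp cong: measurable_cong_sets sets_pair_measure_cong)
    from L.nn_integral_fst[OF this] show ?thesis
      unfolding joint[symmetric] by simp
  qed
  also have "\<dots> = (\<integral>\<^sup>+y. (\<integral>\<^sup>+t. \<Phi> y t \<partial>D) \<partial>distr M ?S ?Y)"
    by (rule nn_integral_cong) (simp add: last)
  also have "\<dots> = (\<integral>\<^sup>+\<omega>. (\<integral>\<^sup>+t. \<Phi> (?Y \<omega>) t \<partial>D) \<partial>M)"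
  proof -
    interpret D: prob_space D
      using prob_space_distr[OF \<xi>] by (simp add: law)
    show ?thesis
      using Y D.borel_measurable_nn_integral[OF \<Phi>] by (subst nn_integral_distr) auto
  qed
  finally show ?thesis .
qed

text \<open>Transfers independence of the \<sigma>-algebras of two random elements to real functions
  of them.\<close>

lemma sigma_sets_comp_subset:
  assumes g: "g \<in> L \<rightarrow>\<^sub>M R" and Y: "Y \<in> M \<rightarrow>\<^sub>M L"
  shows "sigma_sets (space M) {(\<lambda>\<omega>. g (Y \<omega>)) -` A \<inter> space M | A. A \<in> sets R}
    \<subseteq> sets (vimage_algebra (space M) Y L)"
proof -
  have "(\<lambda>\<omega>. g (Y \<omega>)) \<in> vimage_algebra (space M) Y L \<rightarrow>\<^sub>M R"
    by (rule measurable_compose[OF measurable_vimage_algebra1 g]) (use measurable_space[OF Y] in blast)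
  then have "{(\<lambda>\<omega>. g (Y \<omega>)) -` A \<inter> space M | A. A \<in> sets R} \<subseteq> sets (vimage_algebra (space M) Y L)"
    by (auto dest: measurable_sets)
  then show ?thesis
    using sets.sigma_sets_subset[of _ "vimage_algebra (space M) Y L"] by simp
qed

text \<open>Almost surely the value is the sum over j of the indicator of \<kappa> = j times h j;
  independence factors each expectation, and uniformity gives the common weight.\<close>

lemma (in prob_space) expectation_random_index:
  fixes \<kappa> :: "'a \<Rightarrow> nat" and h :: "nat \<Rightarrow> 'b \<Rightarrow> real"
  assumes \<kappa> [measurable]: "\<kappa> \<in> M \<rightarrow>\<^sub>M count_space UNIV" and Y [measurable]: "Y \<in> M \<rightarrow>\<^sub>M N"
    and indep: "indep_set (sets (vimage_algebra (space M) \<kappa> (count_space UNIV)))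
      (sets (vimage_algebra (space M) Y N))"
    and uniform: "distr M (count_space UNIV) \<kappa> = measure_pmf (pmf_of_set S)"
    and S: "finite S" "S \<noteq> {}"
    and h: "\<And>j. h j \<in> borel_measurable N" "\<And>j. integrable M (\<lambda>\<omega>. h j (Y \<omega>))"
  shows "integrable M (\<lambda>\<omega>. h (\<kappa> \<omega>) (Y \<omega>))"
    "expectation (\<lambda>\<omega>. h (\<kappa> \<omega>) (Y \<omega>)) = (\<Sum>j\<in>S. expectation (\<lambda>\<omega>. h j (Y \<omega>))) / real (card S)"
    "AE \<omega> in M. \<kappa> \<omega> \<in> S"
proof -
  note [measurable] = h(1)
  have "AE j in distr M (count_space UNIV) \<kappa>. j \<in> S"
    unfolding uniform using S by (simp add: AE_measure_pmf_iff)
  then show AE: "AE \<omega> in M. \<kappa> \<omega> \<in> S"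
    by (subst (asm) AE_distr_iff) auto
  let ?I = "\<lambda>j. indicator {j} :: nat \<Rightarrow> real"
  let ?g = "\<lambda>\<omega>. \<Sum>j\<in>S. ?I j (\<kappa> \<omega>) * h j (Y \<omega>)"
  have I: "integrable M (\<lambda>\<omega>. ?I j (\<kappa> \<omega>))" for j
    by (rule integrable_const_bound[of _ 1]) (auto simp: indicator_def)
  have EI: "expectation (\<lambda>\<omega>. ?I j (\<kappa> \<omega>)) = 1 / real (card S)" if "j \<in> S" for j
  proof -
    have "expectation (\<lambda>\<omega>. ?I j (\<kappa> \<omega>)) = (\<integral>i. ?I j i \<partial>distr M (count_space UNIV) \<kappa>)"
      by (rule integral_distr[symmetric]) auto
    also have "\<dots> = 1 / real (card S)"
      unfolding uniform using S that by (simp add: measure_pmf_single pmf_of_set)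
    finally show ?thesis .
  qed
  have prod: "integrable M (\<lambda>\<omega>. ?I j (\<kappa> \<omega>) * h j (Y \<omega>)) \<and>
      expectation (\<lambda>\<omega>. ?I j (\<kappa> \<omega>) * h j (Y \<omega>)) = expectation (\<lambda>\<omega>. ?I j (\<kappa> \<omega>)) * expectation (\<lambda>\<omega>. h j (Y \<omega>))" for j
  proof -
    have sub1: "sigma_sets (space M) {(\<lambda>\<omega>. ?I j (\<kappa> \<omega>)) -` A \<inter> space M | A. A \<in> sets borel}
        \<subseteq> sets (vimage_algebra (space M) \<kappa> (count_space UNIV))"
      by (rule sigma_sets_comp_subset[OF _ \<kappa>]) simp
    have sub2: "sigma_sets (space M) {(\<lambda>\<omega>. h j (Y \<omega>)) -` A \<inter> space M | A. A \<in> sets borel}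
        \<subseteq> sets (vimage_algebra (space M) Y N)"
      by (rule sigma_sets_comp_subset[OF h(1) Y])
    have "indep_var borel (\<lambda>\<omega>. ?I j (\<kappa> \<omega>)) borel (\<lambda>\<omega>. h j (Y \<omega>))"
      unfolding indep_var_eq
    proof (intro conjI)
      show "indep_set (sigma_sets (space M) {(\<lambda>\<omega>. ?I j (\<kappa> \<omega>)) -` A \<inter> space M | A. A \<in> sets borel})
          (sigma_sets (space M) {(\<lambda>\<omega>. h j (Y \<omega>)) -` A \<inter> space M | A. A \<in> sets borel})"
        unfolding indep_set_def
        by (rule indep_sets_mono_sets[OF indep[unfolded indep_set_def]])
          (use sub1 sub2 in \<open>auto split: bool.split\<close>)
    qed (use measurable_compose[OF \<kappa>, of "?I j" borel] measurable_compose[OF Y h(1)] in auto)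
    then show ?thesis
      using indep_var_integrable indep_var_lebesgue_integral I h(2) by blast
  qed
  have int: "integrable M ?g"
    using prod by (intro Bochner_Integration.integrable_sum) blast
  have eq: "AE \<omega> in M. ?g \<omega> = h (\<kappa> \<omega>) (Y \<omega>)"
    using AE
  proof eventually_elim
    case (elim \<omega>)
    have "?g \<omega> = (\<Sum>j\<in>S. if j = \<kappa> \<omega> then h j (Y \<omega>) else 0)"
      by (intro sum.cong) (auto simp: indicator_def)
    then show ?case using elim S by simp
  qed
  have meas: "(\<lambda>\<omega>. h (\<kappa> \<omega>) (Y \<omega>)) \<in> borel_measurable M"
    by (rule measurable_compose_countable[OF _ \<kappa>]) measurable
  show "integrable M (\<lambda>\<omega>. h (\<kappa> \<omega>) (Y \<omega>))"
    using int eq meas by (subst integrable_cong_AE[symmetric, OF _ _ eq]) auto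
  have "expectation (\<lambda>\<omega>. h (\<kappa> \<omega>) (Y \<omega>)) = expectation ?g"
    using int eq meas by (intro integral_cong_AE) auto
  also have "\<dots> = (\<Sum>j\<in>S. expectation (\<lambda>\<omega>. h j (Y \<omega>))) / real (card S)"
    using prod EI by (simp add: Bochner_Integration.integral_sum sum_divide_distrib)
  finally show "expectation (\<lambda>\<omega>. h (\<kappa> \<omega>) (Y \<omega>)) = (\<Sum>j\<in>S. expectation (\<lambda>\<omega>. h j (Y \<omega>))) / real (card S)" .
qed

locale sipm_em_sampled = sipm_em K \<theta> B A b f L1 L2 s D G \<sigma> a \<phi>low x0 \<eta> \<gamma> \<mu> + prob_space P
  for K :: "(real^'n) set" and \<theta> :: real and B :: "real^'n \<Rightarrow> real" and A :: "real^'n^'m"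
    and b :: "real^'m" and f :: "real^'n \<Rightarrow> real" and L1 L2 s :: real
    and D :: "'s measure" and G :: "real^'n \<Rightarrow> 's \<Rightarrow> real^'n" and \<sigma> a \<phi>low :: real
    and x0 :: "real^'n" and \<eta> \<gamma> \<mu> :: "nat \<Rightarrow> real" and P :: "'w measure" +
  fixes \<xi> :: "nat \<Rightarrow> 'w \<Rightarrow> 's"
  assumes indep: "indep_vars (\<lambda>_. D) \<xi> UNIV"
    and law: "\<And>k. distr P D (\<xi> k) = D"
begin

abbreviation path :: "'w \<Rightarrow> nat \<Rightarrow> 's" where
  "path \<omega> \<equiv> (\<lambda>j. \<xi> j \<omega>)"

lemma \<xi>_measurable: "\<xi> k \<in> P \<rightarrow>\<^sub>M D"
  using indep by (auto simp: indep_vars_def)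

lemma sqerr_0:
  "integrable P (\<lambda>\<omega>. sqerr (path \<omega>) 0)" "expectation (\<lambda>\<omega>. sqerr (path \<omega>) 0) \<le> \<sigma>\<^sup>2"
proof -
  let ?h = "\<lambda>t. (dual_norm B x0 (G x0 t - gradient f x0))\<^sup>2"
  have eq: "sqerr (path \<omega>) 0 = ?h (\<xi> 0 \<omega>)" for \<omega>
    by (simp add: sqerr_def err_def em_x_0 em_mbar_0)
  have i: "integrable (distr P D (\<xi> 0)) ?h"
    using variance_integrable[OF x0] by (simp add: law)
  then have m: "?h \<in> borel_measurable D" by (auto simp: law)
  show "integrable P (\<lambda>\<omega>. sqerr (path \<omega>) 0)"
    unfolding eq using i by (rule integrable_distr[OF \<xi>_measurable])
  have "expectation (\<lambda>\<omega>. ?h (\<xi> 0 \<omega>)) = integral\<^sup>L (distr P D (\<xi> 0)) ?h"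
    by (rule integral_distr[symmetric, OF \<xi>_measurable m])
  then show "expectation (\<lambda>\<omega>. sqerr (path \<omega>) 0) \<le> \<sigma>\<^sup>2"
    unfolding eq using variance[OF x0] by (simp add: law)
qed

text \<open>The first k + 1 samples determine x(k+1) and the point where sample k + 1 is used, so
  that sample may be integrated out first, with the prefix frozen, by
  \<open>next_err_bound\<close>.\<close>

lemma sqerr_Suc:
  assumes int: "integrable P (\<lambda>\<omega>. sqerr (path \<omega>) k)"
  shows "integrable P (\<lambda>\<omega>. sqerr (path \<omega>) (Suc k))"
    "expectation (\<lambda>\<omega>. sqerr (path \<omega>) (Suc k))
      \<le> (1 - \<gamma> k * (1 - a)) * expectation (\<lambda>\<omega>. sqerr (path \<omega>) k) + recursion_const k"
proof -
  let ?c = "\<lambda>\<omega>. (1 - \<gamma> k * (1 - a)) * sqerr (path \<omega>) k + recursion_const k"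
  let ?\<Phi> = "\<lambda>w t. ennreal ((dual_norm B (X w (Suc k)) (next_err w k t))\<^sup>2)"
  let ?Y = "\<lambda>\<omega>. \<lambda>j\<in>{..<Suc k}. \<xi> j \<omega>"
  have st: "em_state A B G \<eta> \<gamma> \<mu> x0 (?Y \<omega>) (Suc k) = em_state A B G \<eta> \<gamma> \<mu> x0 (path \<omega>) (Suc k)"
    "em_state A B G \<eta> \<gamma> \<mu> x0 (?Y \<omega>) k = em_state A B G \<eta> \<gamma> \<mu> x0 (path \<omega>) k" for \<omega>
    by (rule iterates_cong; simp)+
  then have Y: "X (?Y \<omega>) (Suc k) = X (path \<omega>) (Suc k)" "next_err (?Y \<omega>) k = next_err (path \<omega>) k" for \<omega>
    unfolding next_err_def Z_def em_x_def em_mbar_def fun_eq_iff by simp_all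
  have meas: "case_prod ?\<Phi> \<in> borel_measurable (PiM {..<Suc k} (\<lambda>_. D) \<Otimes>\<^sub>M D)"
  proof -
    let ?M = "PiM {..<Suc k} (\<lambda>_. D) \<Otimes>\<^sub>M D"
    have W: "(\<lambda>p. fst p j) \<in> ?M \<rightarrow>\<^sub>M D" if "j < Suc k" for j
      using that by (intro measurable_compose[OF measurable_fst measurable_component_singleton]) simp
    have [measurable]: "(\<lambda>p. X (fst p) (Suc k)) \<in> borel_measurable ?M" "(\<lambda>p. X (fst p) k) \<in> borel_measurable ?M"
      "(\<lambda>p. mbar (fst p) k) \<in> borel_measurable ?M" "(\<lambda>p. gradient f (X (fst p) (Suc k))) \<in> borel_measurable ?M"
      using W by (auto intro!: iterates_measurable gradient_X_measurable)
    have "(\<lambda>p. Z (fst p) k) \<in> borel_measurable ?M"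
      unfolding Z_def by measurable
    then have [measurable]: "(\<lambda>p. G (Z (fst p) k) (snd p)) \<in> borel_measurable ?M"
      by (intro G_comp_measurable) (auto simp: Z_in_F)
    have "(\<lambda>p. next_err (fst p) k (snd p)) \<in> borel_measurable ?M"
      unfolding next_err_def by measurable
    then have [measurable]: "(\<lambda>p. dual_norm B (X (fst p) (Suc k)) (next_err (fst p) k (snd p))) \<in> borel_measurable ?M"
      by (intro dual_norm_measurable) (auto simp: X_in_F)
    show ?thesis
      unfolding case_prod_beta' by measurable
  qed
  \<comment> \<open>The bound dominates the integral of a square; its sign is needed to pass from
    \<open>ennreal\<close> back to reals.\<close>
  have nonneg: "0 \<le> ?c \<omega>" for \<omega>
    using next_err_bound(2)[of "path \<omega>" k] by (smt (verit) integral_nonneg_AE AE_I2 zero_le_power2)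
  have "(\<integral>\<^sup>+\<omega>. sqerr (path \<omega>) (Suc k) \<partial>P) = (\<integral>\<^sup>+\<omega>. ?\<Phi> (?Y \<omega>) (\<xi> (Suc k) \<omega>) \<partial>P)"
    by (simp add: sqerr_def err_Suc Y)
  also have "\<dots> = (\<integral>\<^sup>+\<omega>. (\<integral>\<^sup>+t. ?\<Phi> (?Y \<omega>) t \<partial>D) \<partial>P)"
    by (rule nn_integral_fresh_sample[OF indep law meas])
  also have "\<dots> \<le> (\<integral>\<^sup>+\<omega>. ?c \<omega> \<partial>P)"
  proof (rule nn_integral_mono)
    fix \<omega>
    show "(\<integral>\<^sup>+t. ?\<Phi> (?Y \<omega>) t \<partial>D) \<le> ennreal (?c \<omega>)"
      unfolding Y using next_err_bound[of "path \<omega>" k]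
      by (subst nn_integral_eq_integral) (auto intro: ennreal_leI)
  qed
  also have "\<dots> = ennreal (expectation ?c)"
    using int nonneg by (intro nn_integral_eq_integral) auto
  finally have le: "(\<integral>\<^sup>+\<omega>. sqerr (path \<omega>) (Suc k) \<partial>P) \<le> ennreal (expectation ?c)" .
  have m: "(\<lambda>\<omega>. sqerr (path \<omega>) (Suc k)) \<in> borel_measurable P"
    using \<xi>_measurable by (intro sqerr_measurable) auto
  show i: "integrable P (\<lambda>\<omega>. sqerr (path \<omega>) (Suc k))"
    using le m by (intro integrableI_nonneg) (auto simp: sqerr_def intro: le_less_trans)
  have "ennreal (expectation (\<lambda>\<omega>. sqerr (path \<omega>) (Suc k))) \<le> ennreal (expectation ?c)"
    using le i by (subst nn_integral_eq_integral[symmetric]) (auto simp: sqerr_def)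
  then have "expectation (\<lambda>\<omega>. sqerr (path \<omega>) (Suc k)) \<le> expectation ?c"
    using nonneg by (subst (asm) ennreal_le_iff) (auto intro: integral_nonneg_AE)
  also have "expectation ?c = (1 - \<gamma> k * (1 - a)) * expectation (\<lambda>\<omega>. sqerr (path \<omega>) k) + recursion_const k"
    using int by (simp add: prob_space)
  finally show "expectation (\<lambda>\<omega>. sqerr (path \<omega>) (Suc k))
      \<le> (1 - \<gamma> k * (1 - a)) * expectation (\<lambda>\<omega>. sqerr (path \<omega>) k) + recursion_const k" .
qed

lemma sqerr_integrable: "integrable P (\<lambda>\<omega>. sqerr (path \<omega>) k)"
  by (induction k) (auto intro: sqerr_0 sqerr_Suc)

lemma sqerr_expectation_nonneg: "0 \<le> expectation (\<lambda>\<omega>. sqerr (path \<omega>) k)"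
  by (rule integral_nonneg_AE) (simp add: sqerr_def)

lemma err_integrable: "integrable P (\<lambda>\<omega>. dual_norm B (X (path \<omega>) k) (err (path \<omega>) k))"
proof (rule Bochner_Integration.integrable_bound)
  show "integrable P (\<lambda>\<omega>. 1 + sqerr (path \<omega>) k)"
    using sqerr_integrable by simp
  have "(\<lambda>\<omega>. sqrt (sqerr (path \<omega>) k)) \<in> borel_measurable P"
    using sqerr_measurable[of k "\<lambda>\<omega>. path \<omega>" P] \<xi>_measurable by simp
  then show "(\<lambda>\<omega>. dual_norm B (X (path \<omega>) k) (err (path \<omega>) k)) \<in> borel_measurable P"
    by (simp add: sqerr_def X_interior)
  have "\<bar>x\<bar> \<le> \<bar>1 + x\<^sup>2\<bar>" for x :: real
    using zero_le_power2[of "\<bar>x\<bar> - 1"] by (simp add: power2_eq_square algebra_simps abs_if split: if_splits)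
  then show "AE \<omega> in P. norm (dual_norm B (X (path \<omega>) k) (err (path \<omega>) k)) \<le> norm (1 + sqerr (path \<omega>) k)"
    by (simp add: sqerr_def)
qed

text \<open>All terms of the pathwise sum are nonnegative, so a single one is dominated by the
  integrable bound of \<open>sum_stationarity\<close>, divided by its step size.\<close>

lemma stationarity_integrable: "integrable P (\<lambda>\<omega>. stationarity (path \<omega>) k)"
proof (rule Bochner_Integration.integrable_bound)
  let ?h = "\<lambda>\<omega>. (Delta f B \<phi>low x0 + (\<Sum>k<Suc k. 4 * \<eta> k * dual_norm B (X (path \<omega>) k) (err (path \<omega>) k)
      + L_phi L1 s / 2 * (\<eta> k)\<^sup>2)) / \<eta> k"
  show "integrable P ?h"
    using err_integrable by (intro integrable_divide Bochner_Integration.integrable_add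
        Bochner_Integration.integrable_sum integrable_mult_right) auto
  show "(\<lambda>\<omega>. stationarity (path \<omega>) k) \<in> borel_measurable P"
    using \<xi>_measurable by (intro stationarity_measurable) auto
  show "AE \<omega> in P. norm (stationarity (path \<omega>) k) \<le> norm (?h \<omega>)"
  proof (rule AE_I2)
    fix \<omega>
    have "\<eta> k * stationarity (path \<omega>) k \<le> (\<Sum>i<Suc k. \<eta> i * stationarity (path \<omega>) i)"
      using \<eta>(1) stationarity_nonneg by (simp add: sum_nonneg less_imp_le)
    also note sum_stationarity
    finally have "stationarity (path \<omega>) k \<le> ?h \<omega>"
      using \<eta>(1)[of k] by (simp add: pos_le_divide_eq mult.commute)
    then show "norm (stationarity (path \<omega>) k) \<le> norm (?h \<omega>)"
      using stationarity_nonneg[of "path \<omega>" k] abs_ge_self[of "?h \<omega>"]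
      unfolding real_norm_def by linarith
  qed
qed

text \<open>Weighting the squared error by \<open>p\<close>, the contraction of the recursion absorbs the error term of
  the descent inequality.\<close>

theorem weighted_sum_stationarity:
  fixes p :: "nat \<Rightarrow> real"
  assumes p: "\<And>k. 0 < p k" "p 0 = 1"
    "\<And>k. p (Suc k) * (1 - \<gamma> k * (1 - a)) \<le> p k * (1 - \<gamma> k * (1 - a) / 2)"
  shows "(\<Sum>k<n. \<eta> k * expectation (\<lambda>\<omega>. stationarity (path \<omega>) k)) \<le> Delta f B \<phi>low x0 + \<sigma>\<^sup>2
    + (\<Sum>k<n. L_phi L1 s / 2 * (\<eta> k)\<^sup>2 + 8 * (\<eta> k)\<^sup>2 / (p k * (\<gamma> k * (1 - a))) + p (Suc k) * recursion_const k)"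
proof -
  define \<delta> where "\<delta> k = \<gamma> k * (1 - a)" for k
  have \<delta>: "0 < \<delta> k" for k using \<gamma>(1) a_less_1 by (simp add: \<delta>_def)
  define V where "V k = expectation (\<lambda>\<omega>. sqerr (path \<omega>) k)" for k
  have V0: "0 \<le> V k" for k unfolding V_def by (rule sqerr_expectation_nonneg)
  define E where "E k = expectation (\<lambda>\<omega>. dual_norm B (X (path \<omega>) k) (err (path \<omega>) k))" for k
  have "(\<Sum>k<n. \<eta> k * expectation (\<lambda>\<omega>. stationarity (path \<omega>) k))
      = expectation (\<lambda>\<omega>. \<Sum>k<n. \<eta> k * stationarity (path \<omega>) k)"
    using stationarity_integrable by (simp add: Bochner_Integration.integral_sum)
  also have "\<dots> \<le> expectation (\<lambda>\<omega>. Delta f B \<phi>low x0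
      + (\<Sum>k<n. 4 * \<eta> k * dual_norm B (X (path \<omega>) k) (err (path \<omega>) k) + L_phi L1 s / 2 * (\<eta> k)\<^sup>2))"
    using stationarity_integrable err_integrable sum_stationarity by (intro integral_mono) auto
  also have "\<dots> = Delta f B \<phi>low x0 + (\<Sum>k<n. 4 * \<eta> k * E k + L_phi L1 s / 2 * (\<eta> k)\<^sup>2)"
    using err_integrable by (simp add: E_def prob_space Bochner_Integration.integral_sum)
  also have "\<dots> \<le> Delta f B \<phi>low x0 + (\<Sum>k<n. (\<delta> k / 2 * (p k * V k) + 8 * (\<eta> k)\<^sup>2 / (p k * \<delta> k))
      + L_phi L1 s / 2 * (\<eta> k)\<^sup>2)"
  proof (intro add_left_mono sum_mono add_right_mono)
    fix k
    \<comment> \<open>The coefficient of the square is half of the weighted contraction, exactly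
      what the assumption on \<open>p\<close> leaves over in each step.\<close>
    have amgm: "4 * \<eta> k * x \<le> \<delta> k / 2 * p k * x\<^sup>2 + 8 * (\<eta> k)\<^sup>2 / (p k * \<delta> k)" for x
    proof -
      define c where "c = p k * \<delta> k"
      have c: "0 < c" using p(1) \<delta> by (simp add: c_def)
      have "0 \<le> (c * x - 4 * \<eta> k)\<^sup>2 / (2 * c)" using c by simp
      also have "\<dots> = c / 2 * x\<^sup>2 + 8 * (\<eta> k)\<^sup>2 / c - 4 * \<eta> k * x"
        using c by (simp add: field_simps power2_eq_square)
      finally show ?thesis by (simp add: c_def mult_ac)
    qed
    have "4 * \<eta> k * E k = expectation (\<lambda>\<omega>. 4 * \<eta> k * dual_norm B (X (path \<omega>) k) (err (path \<omega>) k))"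
      by (simp add: E_def)
    also have "\<dots> \<le> expectation (\<lambda>\<omega>. \<delta> k / 2 * p k * sqerr (path \<omega>) k + 8 * (\<eta> k)\<^sup>2 / (p k * \<delta> k))"
      using err_integrable sqerr_integrable amgm by (intro integral_mono) (auto simp: sqerr_def)
    also have "\<dots> = \<delta> k / 2 * (p k * V k) + 8 * (\<eta> k)\<^sup>2 / (p k * \<delta> k)"
      using sqerr_integrable by (simp add: V_def prob_space)
    finally show "4 * \<eta> k * E k \<le> \<delta> k / 2 * (p k * V k) + 8 * (\<eta> k)\<^sup>2 / (p k * \<delta> k)" .
  qed
  also have "\<dots> = Delta f B \<phi>low x0 + (\<Sum>k<n. \<delta> k / 2 * (p k * V k))
      + (\<Sum>k<n. L_phi L1 s / 2 * (\<eta> k)\<^sup>2 + 8 * (\<eta> k)\<^sup>2 / (p k * \<delta> k))"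
    by (simp add: sum.distrib)
  finally have main: "(\<Sum>k<n. \<eta> k * expectation (\<lambda>\<omega>. stationarity (path \<omega>) k)) \<le>
      Delta f B \<phi>low x0 + (\<Sum>k<n. \<delta> k / 2 * (p k * V k))
      + (\<Sum>k<n. L_phi L1 s / 2 * (\<eta> k)\<^sup>2 + 8 * (\<eta> k)\<^sup>2 / (p k * \<delta> k))" .
  \<comment> \<open>The weighted recursion telescopes: each step releases \<delta> / 2 times the
    weighted squared error, and the initial value is at most \<sigma>^2.\<close>
  have "p n * V n + (\<Sum>k<n. \<delta> k / 2 * (p k * V k)) \<le> \<sigma>\<^sup>2 + (\<Sum>k<n. p (Suc k) * recursion_const k)" for n
  proof (induction n)
    case 0
    then show ?case using sqerr_0(2) p(2) by (simp add: V_def)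
  next
    case (Suc n)
    have "p (Suc n) * V (Suc n) \<le> p (Suc n) * ((1 - \<delta> n) * V n + recursion_const n)"
      using sqerr_Suc(2)[OF sqerr_integrable, of n] p(1)[of "Suc n"]
      by (intro mult_left_mono) (auto simp: V_def \<delta>_def)
    also have "\<dots> = (p (Suc n) * (1 - \<delta> n)) * V n + p (Suc n) * recursion_const n"
      by (simp add: algebra_simps)
    also have "(p (Suc n) * (1 - \<delta> n)) * V n \<le> (p n * (1 - \<delta> n / 2)) * V n"
      using p(3)[of n] V0 by (intro mult_right_mono) (auto simp: \<delta>_def)
    finally show ?case
      using Suc.IH by (simp add: algebra_simps)
  qed
  from this[of n] have "(\<Sum>k<n. \<delta> k / 2 * (p k * V k)) \<le> \<sigma>\<^sup>2 + (\<Sum>k<n. p (Suc k) * recursion_const k)"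
    using mult_nonneg_nonneg[OF less_imp_le[OF p(1)] V0, of n n] by linarith
  with main show ?thesis
    by (simp add: sum.distrib \<delta>_def)
qed

end

subsection \<open>The parameter choice\<close>

text \<open>In terms of the seventh root all parameters are integer powers, which makes the
  estimates below algebraic.\<close>

lemma seventh_root:
  fixes k :: nat
  defines "x \<equiv> real (k + 1) powr (1/7)"
  shows "1 \<le> x" "x ^ 7 = real (k + 1)" "real (k + 1) powr (2/7) = x ^ 2"
    "real (k + 1) powr (4/7) = x ^ 4" "real (k + 1) powr (5/7) = x ^ 5"
proof -
  show "1 \<le> x" by (simp add: x_def ge_one_powr_ge_zero)
  have "real (k + 1) powr (real j / 7) = x ^ j" for j
    by (simp add: x_def powr_powr flip: powr_realpow)
  from this[of 7] this[of 2] this[of 4] this[of 5]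
  show "x ^ 7 = real (k + 1)" "real (k + 1) powr (2/7) = x ^ 2"
    "real (k + 1) powr (4/7) = x ^ 4" "real (k + 1) powr (5/7) = x ^ 5"
    by simp_all
qed

text \<open>Tangent bound for the concave seventh root, proved by Bernoulli's inequality; it
  controls the growth of the weight.\<close>

lemma next_seventh_root_le:
  fixes x y :: real
  assumes "1 \<le> x" "0 \<le> y" "y ^ 7 = x ^ 7 + 1"
  shows "y \<le> x * (1 + 1 / (7 * x ^ 7))"
proof -
  have "y ^ 7 = x ^ 7 * (1 + 7 * (1 / (7 * x ^ 7)))"
    using assms by (simp add: field_simps)
  also have "\<dots> \<le> x ^ 7 * (1 + 1 / (7 * x ^ 7)) ^ 7"
  proof (rule mult_left_mono)
    have "0 \<le> 1 / (7 * x ^ 7)" using assms(1) by simp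
    then show "1 + 7 * (1 / (7 * x ^ 7)) \<le> (1 + 1 / (7 * x ^ 7)) ^ 7"
      using Bernoulli_inequality[of "1 / (7 * x ^ 7)" 7] by linarith
  qed (use assms in simp)
  also have "\<dots> = (x * (1 + 1 / (7 * x ^ 7))) ^ 7"
    by (simp add: power_mult_distrib)
  finally show ?thesis
    by (rule power_le_imp_le_base[of y 6, simplified]) (use assms in simp)
qed

text \<open>Integral comparison for the terms t^(-10/7) with t = x^7: the primitive is -7/3 t^(-3/7)
  = -7/3 x^(-3). Bernoulli's inequality replaces the integral.\<close>

lemma previous_seventh_root_cube:
  fixes x w :: real
  assumes "1 < x" "0 < w" "w ^ 7 = x ^ 7 - 1"
  shows "1 / x ^ 10 \<le> 7 / 3 * (1 / w ^ 3 - 1 / x ^ 3)"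
proof -
  define u where "u = 1 / (7 * x ^ 7)"
  have x7: "1 < x ^ 7" using assms(1) by simp
  have u: "0 < u" "u < 1"
  proof -
    have "1 < 7 * x ^ 7" using x7 by linarith
    then show "0 < u" "u < 1" using assms(1) by (simp_all add: u_def divide_less_eq)
  qed
  have "7 * u * x ^ 7 = 1"
    using assms(1) by (simp add: u_def)
  then have "w ^ 7 = x ^ 7 * (1 + 7 * (- u))"
    using assms(3) by (simp add: algebra_simps)
  also have "\<dots> \<le> x ^ 7 * (1 + (- u)) ^ 7"
    using assms(1) u Bernoulli_inequality[of "- u" 7] by (intro mult_left_mono) auto
  also have "\<dots> = (x * (1 - u)) ^ 7"
    by (simp add: power_mult_distrib)
  finally have "w \<le> x * (1 - u)"
    by (rule power_le_imp_le_base[of w 6, simplified]) (use assms u in simp)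
  then have "w * (1 + u) \<le> x * (1 - u) * (1 + u)"
    using u by (intro mult_right_mono) auto
  also have "\<dots> = x * (1 - u * u)"
    by (simp add: algebra_simps)
  also have "\<dots> \<le> x * 1"
    using assms u by (intro mult_left_mono) auto
  finally have "(1 + u) * w \<le> x" by (simp add: mult.commute)
  then have "((1 + u) * w) ^ 3 \<le> x ^ 3"
    using u assms by (intro power_mono) auto
  moreover have "(1 + 3 * u) * w ^ 3 \<le> ((1 + u) * w) ^ 3"
    using u assms Bernoulli_inequality[of u 3] by (simp add: power_mult_distrib mult_right_mono)
  ultimately have "(1 + 3 * u) * w ^ 3 \<le> x ^ 3" by simp
  then have "(1 + 3 * u) / x ^ 3 \<le> 1 / w ^ 3"
    using assms by (simp add: field_simps)
  then have "7 / 3 * (3 * u / x ^ 3) \<le> 7 / 3 * (1 / w ^ 3 - 1 / x ^ 3)"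
    by (intro mult_left_mono) (simp_all add: add_divide_distrib)
  also have "7 / 3 * (3 * u / x ^ 3) = 1 / x ^ 10"
    using assms by (simp add: u_def flip: power_add)
  finally show ?thesis .
qed

text \<open>The value 16/5 is dictated by the coefficient of \<open>L_phi\<close> in
  \<open>M_em\<close>. Telescoping after the first term would give 1 + 7/3, which is too large, so
  the second term is also kept explicitly.\<close>

lemma sum_ten_sevenths: "(\<Sum>k<n. 1 / (real (k + 1) powr (1/7)) ^ 10) \<le> 16 / 5"
proof -
  have *: "(\<Sum>k<n + 2. 1 / (real (k + 1) powr (1/7)) ^ 10) \<le> 16 / 5 - 7 / 3 / (real (n + 2) powr (1/7)) ^ 3" for n
  proof (induction n)
    case 0
    define x where "x = (2 :: real) powr (1/7)"
    have x: "0 < x" "x ^ 7 = 2"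
      using seventh_root(2)[of 1] by (simp_all add: x_def)
    \<comment> \<open>A rational lower bound for 2^(3/7), just large enough that 17/6 divided by it
      is at most 11/5.\<close>
    have "(322 / 250) ^ 7 \<le> (x ^ 3) ^ 7"
    proof -
      have "(x ^ 3) ^ 7 = (x ^ 7) ^ 3" by (simp flip: power_mult)
      also have "\<dots> = 8" by (simp add: x)
      finally show ?thesis by (simp add: power_divide)
    qed
    then have "322 / 250 \<le> x ^ 3"
      by (rule power_le_imp_le_base[of "322 / 250" 6, simplified]) (use x in simp)
    have "x ^ 10 = x ^ 3 * x ^ 7" by (simp flip: power_add)
    then have "x ^ 10 = 2 * x ^ 3" by (simp add: x)
    then have "1 + 1 / x ^ 10 + 7 / 3 / x ^ 3 = 1 + 17 / 6 / x ^ 3"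
      by (simp add: field_simps)
    also have "17 / 6 / x ^ 3 \<le> 17 / 6 / (322 / 250)"
      using \<open>322 / 250 \<le> x ^ 3\<close> x(1) by (intro divide_left_mono mult_pos_pos) auto
    finally have "1 + 1 / x ^ 10 \<le> 16 / 5 - 7 / 3 / x ^ 3" by simp
    moreover have "(\<Sum>k<0 + 2. g k) = g 0 + g 1" for g :: "nat \<Rightarrow> real"
      by (simp add: numeral_2_eq_2)
    ultimately show ?case
      by (simp add: x_def)
  next
    case (Suc n)
    define x w where "x = real (n + 3) powr (1/7)" and "w = real (n + 2) powr (1/7)"
    have "x ^ 7 = real (n + 3)" "w ^ 7 = real (n + 2)" "1 \<le> w" "1 \<le> x"
      using seventh_root(1,2)[of "n + 2"] seventh_root(1,2)[of "n + 1"] by (simp_all add: x_def w_def add.commute)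
    moreover from this have "x \<noteq> 1" by (auto simp: power_one)
    ultimately have "1 / x ^ 10 \<le> 7 / 3 * (1 / w ^ 3 - 1 / x ^ 3)"
      by (intro previous_seventh_root_cube) auto
    moreover have "(\<Sum>k<Suc n + 2. 1 / (real (k + 1) powr (1/7)) ^ 10) =
        (\<Sum>k<n + 2. 1 / (real (k + 1) powr (1/7)) ^ 10) + 1 / x ^ 10"
      by (simp add: x_def add.commute)
    moreover have "real (Suc n + 2) powr (1/7) = x"
      by (simp add: x_def add.commute)
    ultimately show ?case
      using Suc.IH by (simp add: w_def)
  qed
  have "(\<Sum>k<n. 1 / (real (k + 1) powr (1/7)) ^ 10) \<le> (\<Sum>k<n + 2. 1 / (real (k + 1) powr (1/7)) ^ 10)"
    by (intro sum_mono2) auto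
  also have "\<dots> \<le> 16 / 5"
    using *[of n] by (smt (verit) divide_nonneg_nonneg powr_ge_zero zero_le_power)
  finally show ?thesis .
qed

lemma sum_inverse_le_ln: "0 < n \<Longrightarrow> (\<Sum>k<n. 1 / real (k + 1)) \<le> 1 + ln (real n)"
proof (induction n rule: nat_induct_non_zero)
  case (Suc n)
  have "ln (real n / real (n + 1)) \<le> real n / real (n + 1) - 1"
    using Suc by (intro ln_le_minus_one) simp
  then have "1 / real (n + 1) \<le> ln (real (n + 1)) - ln (real n)"
    using Suc by (simp add: ln_div field_simps)
  with Suc show ?case by simp
qed simp

text \<open>If y \<le> e, the global maximum 1 / e of ln u / u suffices. Otherwise the tangent of ln
  at y ln y replaces the monotonicity of ln u / u, and ln (ln y) \<le> ln y - 1 gives the factor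
  2.\<close>

lemma ln_div_self_le:
  fixes u y :: real
  assumes u: "0 < u" and y: "0 < y" and large: "exp 1 < y \<Longrightarrow> y * ln y \<le> u"
  shows "ln u / u \<le> 2 / y"
proof (cases "exp 1 < y")
  case False
  have "ln (u / exp 1) \<le> u / exp 1 - 1"
    using u by (intro ln_le_minus_one) simp
  then have "ln u \<le> u / exp 1"
    using u by (simp add: ln_div)
  then have "ln u / u \<le> 1 / exp 1"
    using u by (simp add: field_simps)
  also have "\<dots> \<le> 2 / y"
    using False y by (intro frac_le) auto
  finally show ?thesis .
next
  case True
  define l where "l = ln y"
  have l: "1 < l"
    using True y ln_less_cancel_iff[of "exp 1" y] by (simp add: l_def)
  have u: "0 < y * l" "y * l \<le> u"
    using l y large[OF True] unfolding l_def[symmetric] by simp_all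
  have "ln (u / (y * l)) \<le> u / (y * l) - 1"
    using u by (intro ln_le_minus_one) simp
  moreover have "ln (u / (y * l)) = ln u - ln (y * l)"
    using u by (subst ln_div) auto
  ultimately have "ln u \<le> ln (y * l) + u / (y * l) - 1" by simp
  also have "ln (y * l) = l + ln l"
    using y l by (simp add: ln_mult l_def)
  also have "ln l \<le> l - 1"
    using l by (intro ln_le_minus_one) simp
  finally have "ln u \<le> 2 * l - 2 + u / (y * l)" by simp
  also have "2 * l - 2 \<le> (u / (y * l)) * (2 * l - 1)"
  proof -
    have "1 * (2 * l - 1) \<le> (u / (y * l)) * (2 * l - 1)"
      using u l by (intro mult_right_mono) auto
    then show ?thesis by simp
  qed
  also have "(u / (y * l)) * (2 * l - 1) + u / (y * l) = 2 * u / y"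
    using l y by (simp add: field_simps)
  finally have "ln u \<le> 2 * u / y" by simp
  then show ?thesis
    using u y by (simp add: field_simps)
qed

text \<open>Letting m tend to 0 gives f x \<ge> \<phi>low, and \<phi>low - 2 min \<phi>low 0 is the
  absolute value of \<phi>low.\<close>

lemma Delta_nonneg:
  assumes "\<And>m. 0 < m \<Longrightarrow> m \<le> 1 \<Longrightarrow> \<phi>low \<le> f x + m * B x"
  shows "0 \<le> Delta f B \<phi>low x"
proof -
  have "((\<lambda>m. f x + m * B x) \<longlongrightarrow> f x + 0 * B x) (at_right 0)"
    by (intro tendsto_intros)
  moreover have "\<forall>\<^sub>F m in at_right 0. \<phi>low \<le> f x + m * B x"
    using eventually_at_right_real[OF zero_less_one] by eventually_elim (use assms in auto)
  ultimately have "\<phi>low \<le> f x + 0 * B x"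
    by (intro tendsto_lowerbound) auto
  then show ?thesis by (auto simp: Delta_def)
qed

lemma recursion_const_em:
  fixes x p a L \<sigma> :: real
  assumes "0 < x" "0 < p"
  shows "(L * (a / x ^ 5)\<^sup>2 / (1 / x ^ 4))\<^sup>2 / (p ^ 3 * (1 / x ^ 4)) + (1 / x ^ 4)\<^sup>2 * \<sigma>\<^sup>2 / p ^ 4 =
    (L\<^sup>2 * a ^ 4 / p ^ 3 + \<sigma>\<^sup>2 / p ^ 4) / x ^ 8"
proof -
  have 1: "L * (a / x ^ 5)\<^sup>2 / (1 / x ^ 4) = L * a\<^sup>2 / x ^ 6"
    using assms by (simp add: divide_simps)
  have 2: "(L * a\<^sup>2 / x ^ 6)\<^sup>2 / (p ^ 3 * (1 / x ^ 4)) = L\<^sup>2 * a ^ 4 / p ^ 3 / x ^ 8"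
    using assms by (simp add: divide_simps)
  have 3: "(1 / x ^ 4)\<^sup>2 * \<sigma>\<^sup>2 / p ^ 4 = \<sigma>\<^sup>2 / p ^ 4 / x ^ 8"
    using assms by (simp add: divide_simps)
  show ?thesis unfolding 1 2 3 by (simp add: add_divide_distrib)
qed

section \<open>Rates for the prescribed step sizes and momentum parameters\<close>

context sipm_em_sampled
begin

text \<open>The weight is \<open>x k\<close>. Its relative growth, at most 1 / (7 (k+1)), stays
  below half of the contraction (1 - a) / (k+1)^(4/7) because s < 1 gives 1 - a \<ge> 2/7.\<close>

lemma sum_stationarity_em:
  assumes param: "\<eta> = em_eta s" "\<gamma> = em_gamma" "a = 5 * s / 7" and n: "3 \<le> n"
  shows "(\<Sum>k<n. \<eta> k * expectation (\<lambda>\<omega>. stationarity (path \<omega>) k))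
    \<le> 5 * s / 14 * M_em (Delta f B \<phi>low x0) L1 L2 \<sigma> s * ln (real n)"
proof -
  define x where "x k = real (k + 1) powr (1/7)" for k
  have x: "1 \<le> x k" "x k ^ 7 = real (k + 1)" for k
    using seventh_root[of k] by (simp_all add: x_def)
  have \<gamma>x: "\<gamma> k = 1 / x k ^ 4" and \<eta>x: "\<eta> k = a / x k ^ 5" for k
    using seventh_root(4,5)[of k] by (simp_all add: x_def param em_eta_def em_gamma_def)
  have a1: "0 < 1 - a" "2 / 7 \<le> 1 - a" "0 < a" using s by (simp_all add: param)
  have y: "x (Suc k) \<le> x k * (1 + 1 / (7 * x k ^ 7))" for k
    using x[of k] x[of "Suc k"] by (intro next_seventh_root_le) auto
  \<comment> \<open>The three costs of a step: curvature, the remainder of the AM-GM inequality, and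
    bias and noise in the error recursion. The factor 2 in \<open>C3\<close> bounds the ratio of
    consecutive weights.\<close>
  define C1 where "C1 = L_phi L1 s / 2 * a\<^sup>2"
  define C2 where "C2 = 8 * a\<^sup>2 / (1 - a)"
  define C3 where "C3 = 2 * (L2\<^sup>2 * a ^ 4 / (1 - a) ^ 3 + \<sigma>\<^sup>2 / (1 - a) ^ 4)"
  have C: "0 \<le> C1" "0 \<le> C2" "0 \<le> C3"
    using L1 L2 s a1 by (simp_all add: C1_def C2_def C3_def L_phi_def)
  have "(\<Sum>k<n. \<eta> k * expectation (\<lambda>\<omega>. stationarity (path \<omega>) k)) \<le> Delta f B \<phi>low x0 + \<sigma>\<^sup>2
    + (\<Sum>k<n. L_phi L1 s / 2 * (\<eta> k)\<^sup>2 + 8 * (\<eta> k)\<^sup>2 / (x k * (\<gamma> k * (1 - a))) + x (Suc k) * recursion_const k)"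
  proof (rule weighted_sum_stationarity)
    fix k
    show "0 < x k" using x(1)[of k] by simp
    define \<delta> where "\<delta> = \<gamma> k * (1 - a)"
    define u where "u = 1 / (7 * x k ^ 7)"
    have u: "0 \<le> u" using x(1)[of k] by (simp add: u_def)
    have "u = (1 / x k ^ 7) * (1 / 7)" by (simp add: u_def)
    also have "\<dots> \<le> (1 / x k ^ 4) * ((1 - a) / 2)"
      using x(1)[of k] a1 by (intro mult_mono divide_left_mono power_increasing) auto
    finally have u\<delta>: "u \<le> \<delta> / 2" by (simp add: \<delta>_def \<gamma>x)
    have \<delta>: "0 < \<delta>" "\<delta> \<le> 1"
      using \<gamma>[of k] a1 mult_le_one[of "\<gamma> k" "1 - a"] by (simp_all add: \<delta>_def)
    have "x (Suc k) * (1 - \<delta>) \<le> (x k * (1 + u)) * (1 - \<delta>)"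
      using y[of k] \<delta> by (intro mult_right_mono) (auto simp: u_def)
    also have "\<dots> = x k * ((1 + u) * (1 - \<delta>))" by simp
    also have "\<dots> \<le> x k * (1 - \<delta> / 2)"
    proof (rule mult_left_mono)
      have "0 \<le> u * \<delta>" using u \<delta> by simp
      then show "(1 + u) * (1 - \<delta>) \<le> 1 - \<delta> / 2"
        using u\<delta> by (simp add: algebra_simps)
    qed (use x(1)[of k] in simp)
    finally show "x (Suc k) * (1 - \<gamma> k * (1 - a)) \<le> x k * (1 - \<gamma> k * (1 - a) / 2)"
      by (simp add: \<delta>_def)
  qed (simp add: x_def)
  also have "\<dots> \<le> Delta f B \<phi>low x0 + \<sigma>\<^sup>2 + (\<Sum>k<n. C1 * (1 / x k ^ 10) + (C2 + C3) * (1 / real (k + 1)))"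
  proof (intro add_left_mono sum_mono)
    fix k
    let ?x = "x k"
    have px: "0 < ?x" using x(1)[of k] by simp
    have t1: "L_phi L1 s / 2 * (\<eta> k)\<^sup>2 = C1 * (1 / ?x ^ 10)"
      by (simp add: \<eta>x C1_def power_divide flip: power_mult)
    have t2: "8 * (\<eta> k)\<^sup>2 / (?x * (\<gamma> k * (1 - a))) = C2 * (1 / ?x ^ 7)"
      unfolding \<eta>x \<gamma>x C2_def using px a1(1)
      by (simp add: divide_simps) (simp add: eval_nat_numeral)?
    have "1 / (7 * ?x ^ 7) \<le> 1"
    proof -
      have "1 \<le> 7 * ?x ^ 7" using one_le_power[OF x(1), of k 7] by linarith
      then show ?thesis using px by (simp add: divide_le_eq)
    qed
    then have "?x * (1 + 1 / (7 * ?x ^ 7)) \<le> ?x * 2"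
      using px by (intro mult_left_mono) linarith+
    with y[of k] have "x (Suc k) \<le> ?x * 2"
      by (rule order_trans)
    moreover have r0: "0 \<le> recursion_const k"
      using \<gamma>[of k] a1 by (simp add: recursion_const_def less_imp_le)
    ultimately have "x (Suc k) * recursion_const k \<le> (?x * 2) * recursion_const k"
      by (rule mult_right_mono)
    also have "\<dots> = C3 * (1 / ?x ^ 7)"
    proof -
      have "recursion_const k = (L2\<^sup>2 * a ^ 4 / (1 - a) ^ 3 + \<sigma>\<^sup>2 / (1 - a) ^ 4) / ?x ^ 8"
        unfolding recursion_const_def \<eta>x \<gamma>x by (rule recursion_const_em[OF px a1(1)])
      moreover have "?x * 2 * (c / ?x ^ 8) = 2 * c * (1 / ?x ^ 7)" for c
        using px by (simp add: divide_simps) (simp add: eval_nat_numeral)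
      ultimately show ?thesis by (simp add: C3_def)
    qed
    finally show "L_phi L1 s / 2 * (\<eta> k)\<^sup>2 + 8 * (\<eta> k)\<^sup>2 / (?x * (\<gamma> k * (1 - a))) + x (Suc k) * recursion_const k
        \<le> C1 * (1 / ?x ^ 10) + (C2 + C3) * (1 / real (k + 1))"
      unfolding t1 t2 x(2)[symmetric] by (simp add: add_divide_distrib)
  qed
  also have "\<dots> = Delta f B \<phi>low x0 + \<sigma>\<^sup>2 + (C1 * (\<Sum>k<n. 1 / x k ^ 10) + (C2 + C3) * (\<Sum>k<n. 1 / real (k + 1)))"
    by (simp add: sum.distrib sum_distrib_left)
  \<comment> \<open>The curvature terms form a convergent series; the other two costs are harmonic
    and produce the logarithm.\<close>
  also have "\<dots> \<le> Delta f B \<phi>low x0 + \<sigma>\<^sup>2 + (C1 * (16 / 5) + (C2 + C3) * (1 + ln (real n)))"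
    using sum_ten_sevenths[of n] sum_inverse_le_ln[of n] n C
    by (intro add_left_mono add_mono mult_left_mono) (auto simp: x_def)
  also have "\<dots> \<le> (Delta f B \<phi>low x0 + \<sigma>\<^sup>2 + C1 * (16 / 5) + 2 * (C2 + C3)) * ln (real n)"
  proof -
    \<comment> \<open>For n \<ge> 3 the logarithm is at least 1, so the constants can be multiplied
      by it and 1 + ln n \<le> 2 ln n; hence the factor 2 before the last bracket of
      \<open>M_em\<close>.\<close>
    have "exp 1 \<le> real n" using exp_le n by simp
    then have "ln (exp 1) \<le> ln (real n)" using n by (intro ln_mono) auto
    then have l: "1 \<le> ln (real n)" by simp
    have "0 \<le> Delta f B \<phi>low x0 + \<sigma>\<^sup>2 + C1 * (16 / 5) + (C2 + C3)"
      using Delta_nonneg[of \<phi>low f x0 B] lower[OF x0] C by simp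
    from mult_left_mono[OF l this] show ?thesis by (simp add: algebra_simps)
  qed
  also have "Delta f B \<phi>low x0 + \<sigma>\<^sup>2 + C1 * (16 / 5) + 2 * (C2 + C3) = 5 * s / 14 * M_em (Delta f B \<phi>low x0) L1 L2 \<sigma> s"
  proof -
    define q where "q = 7 - 5 * s"
    have q: "0 < q" "1 - a = q / 7" "1 - 5 * s / 7 = q / 7" using s by (simp_all add: q_def param)
    have a': "a = 5 * s / 7" by (rule param)
    have "C1 * (16 / 5) = s * (40 * s * L_phi L1 s / 49)"
      by (simp add: C1_def a' power2_eq_square)
    moreover have "C2 = s * (200 * s / (7 * q))"
      unfolding C2_def q(2) unfolding a' using q(1) by (simp add: power2_eq_square)
    moreover have "C3 = s * (1250 * L2\<^sup>2 * s ^ 3 / (7 * q ^ 3) + 2 * \<sigma>\<^sup>2 / (s * (q / 7) ^ 4))"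
    proof -
      have "2 * (L2\<^sup>2 * (5 * s / 7) ^ 4 / (q / 7) ^ 3) = s * (1250 * L2\<^sup>2 * s ^ 3 / (7 * q ^ 3))"
        using q(1) by (simp add: divide_simps) (simp add: eval_nat_numeral)
      moreover have "2 * (\<sigma>\<^sup>2 / (q / 7) ^ 4) = s * (2 * \<sigma>\<^sup>2 / (s * (q / 7) ^ 4))"
        using s by simp
      ultimately show ?thesis
        unfolding C3_def q(2) unfolding a' by (simp only: distrib_left)
    qed
    moreover have "5 * s / 14 * (14 / 5 * ((d + \<sigma>\<^sup>2) / s + c1 + 2 * (c2 + c3 + c4))) =
        d + \<sigma>\<^sup>2 + s * c1 + 2 * (s * c2 + s * (c3 + c4))" for d c1 c2 c3 c4
      using s by (simp add: field_simps)
    ultimately show ?thesis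
      unfolding M_em_def q(3) q_def[symmetric] by metis
  qed
  finally show ?thesis .
qed

text \<open>The step sizes decrease, so on the second half they are at least the last one, and the
  half has at least n / 2 indices. The product of these two bounds is 5 s / 14 times n^(2/7), which
  cancels the prefactor of the weighted sum.\<close>

lemma expected_stationarity_em:
  assumes param: "\<eta> = em_eta s" "\<gamma> = em_gamma" "a = 5 * s / 7" and n: "3 \<le> n"
  shows "(\<Sum>k\<in>{n div 2..n - 1}. expectation (\<lambda>\<omega>. stationarity (path \<omega>) k)) / real (card {n div 2..n - 1})
    \<le> M_em (Delta f B \<phi>low x0) L1 L2 \<sigma> s * (ln (real n) / real n powr (2/7))"
proof -
  let ?S = "{n div 2..n - 1}" and ?E = "\<lambda>k. expectation (\<lambda>\<omega>. stationarity (path \<omega>) k)"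
  let ?M = "M_em (Delta f B \<phi>low x0) L1 L2 \<sigma> s"
  define h where "h = \<eta> (n - 1)"
  define z where "z = real n powr (1/7)"
  have nn: "n - 1 + 1 = n" using n by simp
  have z: "1 \<le> z" "z ^ 7 = real n" "real n powr (2/7) = z ^ 2" "h = 5 * s / (7 * z ^ 5)"
    using seventh_root[of "n - 1"] unfolding nn z_def h_def param em_eta_def by simp_all
  have h: "0 < h" using \<eta>(1) by (simp add: h_def)
  have E0: "0 \<le> ?E k" for k by (rule integral_nonneg_AE) (simp add: stationarity_nonneg)
  have "h * (\<Sum>k\<in>?S. ?E k) \<le> (\<Sum>k\<in>?S. \<eta> k * ?E k)"
    unfolding sum_distrib_left
  proof (intro sum_mono mult_right_mono E0)
    fix k assume "k \<in> ?S"
    then have "real (k + 1) powr (5/7) \<le> real (n - 1 + 1) powr (5/7)"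
      by (intro powr_mono2) auto
    then show "h \<le> \<eta> k"
      using s unfolding h_def param em_eta_def by (intro divide_left_mono) auto
  qed
  also have "\<dots> \<le> (\<Sum>k<n. \<eta> k * ?E k)"
    using n by (intro sum_mono2 mult_nonneg_nonneg E0 less_imp_le[OF \<eta>(1)]) auto
  also have "\<dots> \<le> 5 * s / 14 * ?M * ln (real n)"
    by (rule sum_stationarity_em[OF param n])
  finally have sum: "h * (\<Sum>k\<in>?S. ?E k) \<le> 5 * s / 14 * ?M * ln (real n)" .
  have "card ?S = n - n div 2"
    using n by simp
  then have card: "real n / 2 \<le> real (card ?S)"
    by linarith
  define T where "T = (\<Sum>k\<in>?S. ?E k)"
  have T: "0 \<le> T" "T * h \<le> 5 * s / 14 * ?M * ln (real n)"
    using sum unfolding mult.commute[of h] T_def by (auto intro: sum_nonneg[OF E0])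
  have "T / real (card ?S) \<le> T / (real n / 2)"
  proof (rule divide_left_mono[OF card T(1)])
    show "0 < real (card ?S) * (real n / 2)"
      using card n by (intro mult_pos_pos) simp_all
  qed
  also have "\<dots> \<le> (5 * s / 14 * ?M * ln (real n) / h) / (real n / 2)"
    using mult_imp_le_div_pos[OF h T(2)] by (rule divide_right_mono) simp
  also have "\<dots> = ?M * (ln (real n) / real n powr (2/7))"
  proof -
    have "(5 * s / 14 * m * l / (5 * s / (7 * z ^ 5))) / (z ^ 7 / 2) = m * (l / z\<^sup>2)" for m l
    proof -
      have "0 < z" using z(1) by simp
      with s(1) show ?thesis by (simp add: divide_simps)
    qed
    then show ?thesis unfolding z(2,3,4) .
  qed
  finally show ?thesis unfolding T_def .
qed

end

section \<open>Random output index and choice of the horizon\<close>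

theorem theorem6:
  fixes K :: "(real^'n) set" and A :: "real^'n^'m" and b :: "real^'m"
    and f B :: "real^'n \<Rightarrow> real" and \<theta> \<phi>low :: real
    and L1 L2 :: "real \<Rightarrow> real" and \<sigma> s\<^sub>\<eta> \<epsilon> :: real and x0 :: "real^'n"
    and D :: "'s measure" and G :: "real^'n \<Rightarrow> 's \<Rightarrow> real^'n"
    and P :: "'w measure" and \<xi> :: "nat \<Rightarrow> 'w \<Rightarrow> 's"
    and N :: nat and \<kappa> :: "'w \<Rightarrow> nat"
  defines "\<Omega> \<equiv> feasible K A b" and "\<Omega>\<^sub>o \<equiv> strictly_feasible K A b"
    and "\<eta> \<equiv> em_eta s\<^sub>\<eta>" and "\<gamma> \<equiv> em_gamma" and "\<mu> \<equiv> em_mu \<epsilon> \<theta>"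
  defines "x \<equiv> (\<lambda>k \<omega>. em_x A B G \<eta> \<gamma> \<mu> x0 (\<lambda>j. \<xi> j \<omega>) k)"
    and "m \<equiv> (\<lambda>k \<omega>. em_m A B G \<eta> \<gamma> \<mu> x0 (\<lambda>j. \<xi> j \<omega>) k)"
    and "lam \<equiv> (\<lambda>k \<omega>. em_lambda A B G \<eta> \<gamma> \<mu> x0 (\<lambda>j. \<xi> j \<omega>) k)"
  defines "stat \<equiv> (\<lambda>\<omega>. dual_norm B (x (\<kappa> \<omega>) \<omega>)
      (gradient (barrier_obj f B (\<mu> (\<kappa> \<omega>))) (x (\<kappa> \<omega>) \<omega>) + transpose A *v lam (\<kappa> \<omega>) \<omega>))"
    and "M \<equiv> M_em (Delta f B \<phi>low x0) (L1 s\<^sub>\<eta>) (L2 s\<^sub>\<eta>) \<sigma> s\<^sub>\<eta>"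
  assumes cone: "proper_cone K"
    and full_row_rank: "rank A = CARD('m)"
    and f_C1: "Ck_on 1 f \<Omega>"
    and optimal: "\<exists>x\<in>\<Omega>. \<forall>y\<in>\<Omega>. f x \<le> f y"
    and theta: "\<theta> \<ge> 1"
    and barrier: "lh_self_concordant_barrier K \<theta> B"
    and s_eta: "0 < s\<^sub>\<eta>" "s\<^sub>\<eta> < 1"
    and x0: "x0 \<in> \<Omega>\<^sub>o"
    and a: "\<Omega>\<^sub>o \<noteq> {}" "\<And>x \<mu>. x \<in> \<Omega>\<^sub>o \<Longrightarrow> 0 < \<mu> \<Longrightarrow> \<mu> \<le> 1 \<Longrightarrow> \<phi>low \<le> f x + \<mu> * B x"
    and b: "\<And>s. 0 < s \<Longrightarrow> s < 1 \<Longrightarrow> L1 s > 0"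
      "\<And>s x y. 0 < s \<Longrightarrow> s < 1 \<Longrightarrow> x \<in> \<Omega>\<^sub>o \<Longrightarrow> y \<in> \<Omega>\<^sub>o \<Longrightarrow> local_norm B x (y - x) \<le> s \<Longrightarrow>
         dual_norm B x (gradient f y - gradient f x) \<le> L1 s * local_norm B x (y - x)"
    and sigma: "\<sigma> > 0"
    and G_measurable: "case_prod G \<in> borel_measurable (restrict_space borel \<Omega>\<^sub>o \<Otimes>\<^sub>M D)"
    and c_unbiased: "\<And>x. x \<in> \<Omega>\<^sub>o \<Longrightarrow> has_bochner_integral D (G x) (gradient f x)"
    and c_variance: "\<And>x. x \<in> \<Omega>\<^sub>o \<Longrightarrow> integrable D (\<lambda>s. (dual_norm B x (G x s - gradient f x))\<^sup>2)"
      "\<And>x. x \<in> \<Omega>\<^sub>o \<Longrightarrow> (\<integral>s. (dual_norm B x (G x s - gradient f x))\<^sup>2 \<partial>D) \<le> \<sigma>\<^sup>2"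
    and d: "Ck_on 2 f \<Omega>\<^sub>o"
      "\<And>s. 0 < s \<Longrightarrow> s < 1 \<Longrightarrow> L2 s > 0"
      "\<And>s x y. 0 < s \<Longrightarrow> s < 1 \<Longrightarrow> x \<in> \<Omega>\<^sub>o \<Longrightarrow> y \<in> \<Omega>\<^sub>o \<Longrightarrow> local_norm B x (y - x) \<le> s \<Longrightarrow>
         dual_mat_norm B x (hessian f y - hessian f x) \<le> L2 s * local_norm B x (y - x)"
    and eps: "0 < \<epsilon>" "\<epsilon> < 1"
    and P: "prob_space P"
    and samples_indep: "prob_space.indep_vars P (\<lambda>_. D) \<xi> UNIV"
    and samples_law: "\<And>k. distr P D (\<xi> k) = D"
    and well_defined: "AE \<omega> in P. \<forall>k. m k \<omega> + transpose A *v lam k \<omega> \<noteq> 0"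
    and kappa_measurable: "\<kappa> \<in> P \<rightarrow>\<^sub>M count_space UNIV"
    and kappa_uniform: "distr P (count_space UNIV) \<kappa> = measure_pmf (pmf_of_set {N div 2..N - 1})"
    and kappa_indep: "prob_space.indep_set P
      (sets (vimage_algebra (space P) \<kappa> (count_space UNIV)))
      (sets (vimage_algebra (space P) (\<lambda>\<omega> k. \<xi> k \<omega>) (PiM UNIV (\<lambda>_. D))))"
    and N: "real N \<ge> Max {2 * ((1 + sqrt \<theta>) / \<epsilon>) powr (7/2),
      (7 * M * (1 + sqrt \<theta>) / \<epsilon> * ln (7 * M * (1 + sqrt \<theta>) / \<epsilon>)) powr (7/2), 3}"
  shows "integrable P stat \<and>
    (AE \<omega> in P. prob_space.expectation P stat \<le> \<mu> (\<kappa> \<omega>) \<and>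
       \<mu> (\<kappa> \<omega>) \<le> \<epsilon> / (1 + sqrt \<theta>))"
proof -
  let ?\<tau> = "\<epsilon> / (1 + sqrt \<theta>)" and ?S = "{N div 2..N - 1}"
  have \<xi>: "\<xi> k \<in> P \<rightarrow>\<^sub>M D" for k
    using samples_indep by (auto simp: prob_space.indep_vars_def[OF P])
  have D: "prob_space D"
    using prob_space.prob_space_distr[OF P \<xi>[of 0]] by (simp add: samples_law)
  have \<tau>: "0 < ?\<tau>"
    using eps theta by (intro divide_pos_pos) (auto intro: add_pos_nonneg)
  have roots: "real (k + 1) powr (4/7) \<le> real (k + 1) powr (5/7)" for k
    by (auto intro: powr_mono)
  interpret sipm_em_sampled K \<theta> B A b f "L1 s\<^sub>\<eta>" "L2 s\<^sub>\<eta>" s\<^sub>\<eta> D G \<sigma> "5 * s\<^sub>\<eta> / 7" \<phi>low x0 \<eta> \<gamma> \<mu> P \<xi>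
  proof (intro sipm_em_sampled.intro sipm_em.intro sipm_problem.intro barrier_cone.intro
      sipm_problem_axioms.intro sipm_em_axioms.intro sipm_em_sampled_axioms.intro)
    fix k
    show "0 < \<gamma> k" "\<gamma> k \<le> 1" "0 < \<eta> k"
      using s_eta by (simp_all add: \<gamma>_def em_gamma_def \<eta>_def em_eta_def ge_one_powr_ge_zero)
    have "5 * s\<^sub>\<eta> / 7 * (1 / real (k + 1) powr (5/7)) \<le> 5 * s\<^sub>\<eta> / 7 * (1 / real (k + 1) powr (4/7))"
      using roots[of k] s_eta by (intro mult_left_mono divide_left_mono) auto
    then show "\<eta> k \<le> 5 * s\<^sub>\<eta> / 7 * \<gamma> k"
      by (simp add: \<eta>_def em_eta_def \<gamma>_def em_gamma_def)
    show "0 < \<mu> k"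
      using \<tau> by (simp add: \<mu>_def em_mu_def)
    have "\<epsilon> \<le> 1 + sqrt \<theta>"
      using eps theta by (smt (verit) real_sqrt_ge_zero)
    then show "\<mu> k \<le> 1"
      using eps theta by (auto simp: \<mu>_def em_mu_def ge_one_powr_ge_zero divide_le_eq)
    have "1 / real (Suc k + 1) powr (2/7) \<le> 1 / real (k + 1) powr (2/7)"
      by (intro divide_left_mono powr_mono2 mult_pos_pos) auto
    then show "\<mu> (Suc k) \<le> \<mu> k"
      by (auto simp: \<mu>_def em_mu_def)
  qed (use assms(10-) s_eta D in \<open>simp_all add: \<Omega>\<^sub>o_def\<close>)
  have "3 \<le> real N" and N1: "2 * ((1 + sqrt \<theta>) / \<epsilon>) powr (7/2) \<le> real N"
    and N2: "(7 * M * (1 + sqrt \<theta>) / \<epsilon> * ln (7 * M * (1 + sqrt \<theta>) / \<epsilon>)) powr (7/2) \<le> real N"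
    using N by simp_all
  then have N3: "3 \<le> N" by simp
  let ?path = "\<lambda>\<omega> k. \<xi> k \<omega>" and ?\<Pi> = "PiM UNIV (\<lambda>_. D)"
  have stat: "stat = (\<lambda>\<omega>. stationarity (?path \<omega>) (\<kappa> \<omega>))"
    unfolding stat_def x_def lam_def stationarity_def ..
  have path: "?path \<in> P \<rightarrow>\<^sub>M ?\<Pi>"
    using \<xi> measurable_space[OF \<xi>] by (intro measurable_PiM_single') auto
  have meas: "(\<lambda>w. stationarity w j) \<in> borel_measurable ?\<Pi>" for j
    by (rule stationarity_measurable) (auto intro: measurable_component_singleton)
  have S: "finite ?S" "?S \<noteq> {}"
    using N3 by auto
  note index = expectation_random_index[where h = "\<lambda>j w. stationarity w j",
      OF kappa_measurable path kappa_indep kappa_uniform S meas stationarity_integrable]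
  have int: "integrable P stat"
    unfolding stat by (rule index(1))
  have "expectation stat = (\<Sum>j\<in>?S. expectation (\<lambda>\<omega>. stationarity (?path \<omega>) j)) / real (card ?S)"
    unfolding stat by (rule index(2))
  also have "\<dots> \<le> M * (ln (real N) / real N powr (2/7))"
    unfolding M_def by (rule expected_stationarity_em[OF \<eta>_def[THEN meta_eq_to_obj_eq] \<gamma>_def[THEN meta_eq_to_obj_eq] refl N3])
  also have "\<dots> \<le> ?\<tau>"
  \<comment> \<open>A nonpositive \<open>M\<close> makes the bound nonpositive; in the other case
    \<open>y\<close> below is positive and its logarithm is meaningful.\<close>
  proof (cases "0 < M")
    case False
    have "0 \<le> ln (real N) / real N powr (2/7)"
      using N3 by simp
    then have "M * (ln (real N) / real N powr (2/7)) \<le> 0"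
      using False by (intro mult_nonpos_nonneg) auto
    with \<tau> show ?thesis by simp
  next
    case True
    define y where "y = 7 * M * (1 + sqrt \<theta>) / \<epsilon>"
    \<comment> \<open>In this variable the second condition on \<open>N\<close> reads y ln y \<le>
      u, and ln N = 7/2 ln u. The resulting bound 7 M / y is exactly \<open>?\<tau>\<close>, which
      explains the 7 in the condition.\<close>
    define u where "u = real N powr (2/7)"
    have \<theta>: "0 < 1 + sqrt \<theta>"
      using theta by (auto intro: add_pos_nonneg)
    then have y: "0 < y" and u: "0 < u"
      using True eps N3 by (simp_all add: y_def u_def)
    have "ln u / u \<le> 2 / y"
    proof (rule ln_div_self_le[OF u y])
      assume "exp 1 < y"
      \<comment> \<open>The exponents 7/2 and 2/7 of \<open>powr\<close> cancel for a nonnegative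
        base.\<close>
      then have "0 \<le> y * ln y"
        using y by (smt (verit) ln_ge_zero mult_nonneg_nonneg one_le_exp_iff)
      moreover have "((y * ln y) powr (7/2)) powr (2/7) \<le> u"
        using N2 unfolding u_def y_def by (intro powr_mono2) auto
      ultimately show "y * ln y \<le> u"
        by (simp add: powr_powr)
    qed
    moreover have "ln (real N) / u = 7 / 2 * (ln u / u)"
      using N3 by (simp add: u_def ln_powr)
    ultimately have "ln (real N) / u \<le> 7 / 2 * (2 / y)"
      by linarith
    then have "M * (ln (real N) / u) \<le> M * (7 / 2 * (2 / y))"
      using True by (intro mult_left_mono) auto
    also have "\<dots> = ?\<tau>"
      using True eps \<theta> by (simp add: y_def)
    finally show ?thesis by (simp add: u_def)
  qed
  finally have "expectation stat \<le> ?\<tau>" .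
  moreover have "AE \<omega> in P. \<mu> (\<kappa> \<omega>) \<le> ?\<tau>"
    using index(3)
  proof eventually_elim
    case (elim \<omega>)
    define k where "k = \<kappa> \<omega>"
    have "N div 2 \<le> k" using elim by (simp add: k_def)
    \<comment> \<open>Rounding down loses at most 1/2, which the shift in k + 1 makes up
      for.\<close>
    then have "real N / 2 \<le> real (k + 1)" by linarith
    with N1 have "((1 + sqrt \<theta>) / \<epsilon>) powr (7/2) \<le> real (k + 1)" by simp
    then have "(((1 + sqrt \<theta>) / \<epsilon>) powr (7/2)) powr (2/7) \<le> real (k + 1) powr (2/7)"
      by (intro powr_mono2) auto
    then have le: "(1 + sqrt \<theta>) / \<epsilon> \<le> real (k + 1) powr (2/7)"
      using eps theta by (simp add: powr_powr)
    have "1 / real (k + 1) powr (2/7) \<le> 1 / ((1 + sqrt \<theta>) / \<epsilon>)"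
      using eps theta by (intro divide_left_mono le mult_pos_pos divide_pos_pos add_pos_nonneg) auto
    then show ?case
      by (simp add: \<mu>_def em_mu_def k_def)
  qed
  \<comment> \<open>The deterministic bound on the expectation is compared with the floor of \<mu>,
    so the random value of \<kappa> causes no difficulty.\<close>
  moreover have "?\<tau> \<le> \<mu> k" for k
    by (simp add: \<mu>_def em_mu_def)
  ultimately show ?thesis
    using int by (auto elim!: eventually_mono intro: order_trans)
qed

end
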